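(* Let $s\ge2$ be an integer and $\nu>0$. For the fully discrete IMEX BDF3 Fourier pseudo-spectral scheme (described in the context), assume that $\omega_0\in H^{s+1}$ is periodic with zero mean, that the initial guess data $\omega^{-j}$, $1\le j\le 2$, are bounded in $H^{s+1}$, and that $\boldsymbol f\in L^\infty(0,T;H^{s-1})$, with $\|\boldsymbol f\|_\infty^{(s-1)}:=\|\boldsymbol f\|_{L^\infty(0,T;H^{s-1})}=M^{(s-1)}$ (the bound holding for all times, so that $T$ may be taken to be $+\infty$). Then there exist a constant $C_w>0$ depending only on $\Omega$, a constant $M_0=M_0(\|\omega_0\|_{H^2},\nu,\|\boldsymbol f\|_{L^\infty(0,T;L^2)})$, a positive constant $\beta_0$ associated with the temporal stencil and elliptic regularity on $\Omega$ ($C_w,M_0,\beta_0$ being independent of $s$), and a uniform-in-time constant $R^{(s)}$ depending only on $\|\omega^0\|_{H^{s+1}}$, $\|\boldsymbol f\|_\infty^{(s-1)}$, $\Omega$ and $\nu$, such that under the time step constraint $$\Delta t\le\frac{\nu}{C_wM_0^2}$$ we have $$\|\nabla^s\boldsymbol\omega^n\|\le\alpha_1^{-1}(1+\beta_0\nu\Delta t)^{-n/2}(G_s^0)^{1/2}+R^{(s)},\qquad\forall\,n\ge0,$$ where $\boldsymbol\omega^n$ is the continuous extension of $\omega^n$ and $$\begin{aligned}G_s^0=&\|\alpha_1\nabla_N^s\omega^0\|_2^2+\|\nabla_N^s(\alpha_2\omega^0+\alpha_3\omega^{-1})\|_2^2+\|\nabla_N^s(\alpha_4\omega^0+\alpha_5\omega^{-1}+\alpha_6\omega^{-2})\|_2^2\\&+\tfrac{37\nu\Delta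 t}{24}\|\nabla_N^{s+1}\omega^0\|_2^2+\tfrac{17\nu\Delta t}{48}\|\nabla_N^{s+1}\omega^{-1}\|_2^2+\tfrac{17\nu\Delta t}{96}\|\nabla_N^{s+1}\omega^{-2}\|_2^2\\&+\tfrac56\|\nabla_N^s(\omega^0-\omega^{-1})\|_2^2+\tfrac16\|\nabla_N^s(\omega^{-1}-\omega^{-2})\|_2^2.\end{aligned}$$
   Context: Domain and grid: $\Omega=[0,1]^2$ with periodic boundary conditions; $N=2K+1$ is a positive odd integer, $h=1/N$, grid points $x_i=ih$, $y_j=jh$. All functions on the grid are periodic grid functions. $\mathcal B^K$ is the space of trigonometric polynomials in $(x,y)$ of degree up to $K$ in each variable. Fourier differentiation: a grid function has the discrete expansion $f_{i,j}=\sum_{k,l=-K}^{K}\hat f_{k,l}\,e^{2\pi \mathrm i(kx_i+ly_j)}$; then $(\mathcal D_{Nx}f)_{i,j}=\sum_{k,l}(2\pi\mathrm i k)\hat f_{k,l}e^{2\pi\mathrm i(kx_i+ly_j)}$, similarly $\mathcal D_{Ny}$, and $\nabla_N f=(\mathcal D_{Nx}f,\mathcal D_{Ny}f)^T$, $\nabla_N\cdot(f_1,f_2)^T=\mathcal D_{Nx}f_1+\mathcal D_{Ny}f_2$, $\Delta_N=\mathcal D_{Nx}^2+\mathcal D_{Ny}^2$, $\nabla_N^\perp\psi=(\mathcal D_{Ny}\psi,-\mathcal D_{Nx}\psi)$. Products of grid functions are pointwise. Higher-order operators: $\nabla^sf=\Delta^kf$ if $s=2k$ and $\nabla^sf=\nabla\Delta^kf$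 if $s=2k+1$; likewise $\nabla_N^sf=\Delta_N^kf$ if $s=2k$ and $\nabla_N^sf=\nabla_N\Delta_N^kf$ if $s=2k+1$. The continuous extension of the grid function $f$ is $\sum_{k,l=-K}^K\hat f_{k,l}e^{2\pi\mathrm i(kx+ly)}\in\mathcal B^K$. Discrete inner product and norm: $\langle f,g\rangle=h^2\sum_{i,j=0}^{N-1}f_{i,j}g_{i,j}$, $\|f\|_2=\langle f,f\rangle^{1/2}$ (componentwise sum for vectors); discrete average $\overline f=\langle f,1\rangle$. $\|\cdot\|$ is the $L^2(\Omega)$ norm. The $H^k$ norm of a grid function means the $H^k$ norm of its continuous extension. Problem: 2-D Navier-Stokes in vorticity form, $\partial_t\omega+\boldsymbol u\cdot\nabla\omega=\nu\Delta\omega+\boldsymbol f$, $-\Delta\psi=\omega$, $\boldsymbol u=\nabla^\perp\psi=(\partial_y\psi,-\partial_x\psi)$, with initial vorticity $\omega_0$, $\nu>0$ the kinematic viscosity and scalar external force $\boldsymbol f$ having $\int_\Omega\boldsymbol f(\cdot,t)\,d\mathbf x=0$. IMEX BDF3 scheme: with time step $\Delta t$, $t^n=n\Delta t$, given zero-average grid functions $\omega^0,\omega^{-1},\omega^{-2}$ (where $\omega^0$ is the grid restriction of the Fourier projection of $\omega_0$ onto $\mathcal B^K$, and $\omega^{-1},\omega^{-2}$ are the initial guess data), find for $n\ge0$ the grid functions $\omega^{n+1},\psi^{n+1},\boldsymbol u^{n+1}$ with $$\frac{\frac{11}{6}\omega^{n+1}-3\omega^n+\frac32\omega^{n-1}-\frac13\omega^{n-2}}{\Delta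 t}+\frac32\mathcal N^n-\frac32\mathcal N^{n-1}+\frac12\mathcal N^{n-2}=\nu\Delta_N\omega^{n+1}+\boldsymbol f_N^{n+1},$$ $$\mathcal N^\ell:=\boldsymbol u^\ell\cdot\nabla_N\omega^\ell+\nabla_N\cdot(\boldsymbol u^\ell\omega^\ell)-\overline{\boldsymbol u^\ell\cdot\nabla_N\omega^\ell},$$ $$-\Delta_N\psi^{n+1}=\omega^{n+1},\quad \overline{\psi^{n+1}}=0,\qquad \boldsymbol u^{n+1}=\nabla_N^\perp\psi^{n+1},$$ where $\boldsymbol f_N^{n+1}$ is (the grid restriction of) the Fourier projection of $\boldsymbol f(\cdot,t^{n+1})$ onto $\mathcal B^K$, and $\psi^\ell,\boldsymbol u^\ell$ for $\ell=0,-1,-2$ are obtained from $\omega^\ell$ by the same two kinematic relations. Stencil constants: $\alpha_1,\dots,\alpha_{10}$ are fixed real constants with $\alpha_1>0$ such that for all grid functions $f^{n+1},f^n,f^{n-1},f^{n-2}$, $$\begin{aligned}&\langle\tfrac{11}{6}f^{n+1}-3f^n+\tfrac32f^{n-1}-\tfrac13f^{n-2},\,2f^{n+1}-f^n\rangle\\=\;&\|\alpha_1f^{n+1}\|_2^2-\|\alpha_1f^n\|_2^2+\|\alpha_2f^{n+1}+\alpha_3f^n\|_2^2-\|\alpha_2f^n+\alpha_3f^{n-1}\|_2^2\\&+\|\alpha_4f^{n+1}+\alpha_5f^n+\alpha_6f^{n-1}\|_2^2-\|\alpha_4f^n+\alpha_5f^{n-1}+\alpha_6f^{n-2}\|_2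^2+\|\alpha_7f^{n+1}+\alpha_8f^n+\alpha_9f^{n-1}+\alpha_{10}f^{n-2}\|_2^2.\end{aligned}$$
   Formalization: M_0 may also depend on a bound for the initial guess data in H^2, and R^(s) on their bound in H^{s+1}; without this the estimate fails (ω_0=0, f=0, ω^{-2}=0, ω^{-1}=A g with nonzero nonlinear term, A→∞: ω^1 grows like A^2, while (G_s^0)^{1/2} grows like A). *)

theory Defs
  imports "HOL-Analysis.Analysis"
begin

section \<open>Grid functions and Fourier differentiation\<close>

text \<open>
  A grid function carries all integer indices; periodicity is the predicate \<open>grid_fun\<close>.
  Throughout, \<open>K\<close> is the cut-off degree and \<open>N = 2 * K + 1\<close> the number of points per direction.
\<close>

type_synonym grid = "int \<Rightarrow> int \<Rightarrow> real"

definition npts :: "nat \<Rightarrow> int" where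
  "npts K = 2 * int K + 1"

definition mesh :: "nat \<Rightarrow> real" where
  "mesh K = 1 / of_int (npts K)"

definition grid_fun :: "nat \<Rightarrow> grid \<Rightarrow> bool" where
  "grid_fun K f \<longleftrightarrow> (\<forall>i j. f (i + npts K) j = f i j \<and> f i (j + npts K) = f i j)"

definition modes :: "nat \<Rightarrow> (int \<times> int) set" where
  "modes K = {- int K..int K} \<times> {- int K..int K}"

definition wave :: "int \<times> int \<Rightarrow> real \<times> real \<Rightarrow> complex" where
  "wave \<kappa> p = cis (2 * pi * (of_int (fst \<kappa>) * fst p + of_int (snd \<kappa>) * snd p))"

definition node :: "nat \<Rightarrow> int \<Rightarrow> int \<Rightarrow> real \<times> real" where
  "node K i j = (of_int i * mesh K, of_int j * mesh K)"

definition dft :: "nat \<Rightarrow> grid \<Rightarrow> int \<times> int \<Rightarrow> complex" where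
  "dft K f \<kappa> = of_real ((mesh K)\<^sup>2) *
     (\<Sum>i = 0..<npts K. \<Sum>j = 0..<npts K. of_real (f i j) * cnj (wave \<kappa> (node K i j)))"

text \<open>
  \<open>dft K f\<close> is the family of coefficients of the discrete Fourier expansion of \<open>f\<close>
  (lemma \<open>dft_expansion\<close> below).
\<close>

lemma npts_pos: "npts K > 0" by (simp add: npts_def)

lemma sum_cis_modes:
  fixes m :: int
  shows "(\<Sum>k\<in>{- int K..int K}. cis (2 * pi * (of_int k * (of_int m * mesh K))))
         = (if npts K dvd m then of_int (npts K) else 0)"
proof -
  define c where "c = 2 * pi * of_int m * mesh K"
  define g where "g = (\<lambda>k::int. cis (of_int k * c))"
  have N: "real_of_int (npts K) \<noteq> 0" using npts_pos[of K] by linarith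
  have gN: "g (k + npts K) = g k" for k
  proof -
    have "of_int (k + npts K) * c = of_int k * c + 2 * pi * of_int m"
      using N by (simp add: c_def mesh_def field_simps)
    then show ?thesis by (simp add: g_def flip: cis_mult) 
  qed
  have e: "2 * pi * (of_int k * (of_int m * mesh K)) = of_int k * c" for k :: int
    by (simp add: c_def)
  have s: "(\<Sum>k\<in>{- int K..int K}. cis (2 * pi * (of_int k * (of_int m * mesh K)))) = sum g {- int K..int K}"
    by (simp add: e g_def)
  show ?thesis
  proof (cases "npts K dvd m")
    case True
    then obtain q where q: "m = npts K * q" by blast
    have "c = 2 * pi * of_int q" using N by (simp add: c_def q mesh_def)
    then have "of_int k * c = 2 * pi * of_int (k * q)" for k by simp
    then have "g k = 1" for k unfolding g_def using cis_multiple_2pi by (metis Ints_of_int)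
    then show ?thesis using True unfolding s by (simp add: npts_def)
  next
    case False
    have "g 1 \<noteq> 1"
    proof
      assume "g 1 = 1"
      then have "cos c = 1" by (simp add: g_def cis.code complex_eq_iff)
      then obtain q :: int where "c = of_int q * 2 * pi" using cos_one_2pi_int by blast
      then have "real_of_int m = of_int (q * npts K)" using N by (simp add: c_def mesh_def field_simps)
      then have "m = q * npts K" by linarith
      then show False using False by simp
    qed
    moreover have "g 1 * sum g {- int K..int K} = sum g {- int K..int K}"
    proof -
      have "g 1 * sum g {- int K..int K} = (\<Sum>k\<in>{- int K..int K}. g (k + 1))"
        by (simp add: sum_distrib_left g_def cis_mult algebra_simps)
      also have "\<dots> = sum g {- int K + 1..int K + 1}"
        by (rule sum.reindex_bij_witness[of _ "\<lambda>k. k - 1" "\<lambda>k. k + 1"]) auto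
      also have "{- int K + 1..int K + 1} = insert (int K + 1) {- int K + 1..int K}" by auto
      also have "sum g \<dots> = g (int K + 1) + sum g {- int K + 1..int K}" by simp
      also have "g (int K + 1) = g (- int K)" using gN[of "- int K"] by (simp add: npts_def algebra_simps)
      also have "g (- int K) + sum g {- int K + 1..int K} = sum g (insert (- int K) {- int K + 1..int K})" by simp
      also have "insert (- int K) {- int K + 1..int K} = {- int K..int K}" by auto
      finally show ?thesis .
    qed
    ultimately show ?thesis using False unfolding s by simp
  qed
qed

lemma grid_fun_mod:
  assumes "grid_fun K f" shows "f (i mod npts K) (j mod npts K) = f i j"
proof -
  have a: "h (x + q * N) = h x" if "\<And>x. h (x + N) = h x" for h :: "int \<Rightarrow> real" and x q N
  proof (induction q rule: int_induct[of _ 0])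
    case (step1 i) then show ?case using that[of "x + i * N"] by (simp add: algebra_simps)
  next
    case (step2 i) then show ?case using that[of "x + (i - 1) * N"] by (simp add: algebra_simps)
  qed simp
  have "f (i mod npts K) y = f i y" for y
    using a[of "\<lambda>i. f i y" "npts K" "i mod npts K" "i div npts K"] assms by (simp add: grid_fun_def)
  moreover have "f x (j mod npts K) = f x j" for x
    using a[of "f x" "npts K" "j mod npts K" "j div npts K"] assms by (simp add: grid_fun_def)
  ultimately show ?thesis by simp
qed

lemma dft_expansion:
  assumes "grid_fun K f"
  shows "of_real (f i j) = (\<Sum>\<kappa>\<in>modes K. dft K f \<kappa> * wave \<kappa> (node K i j))"
proof -
  let ?N = "npts K" and ?I = "{0..<npts K}" and ?M = "{- int K..int K}"
  let ?E = "\<lambda>k m. cis (2 * pi * (of_int k * (of_int m * mesh K)))"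
  have N: "real_of_int ?N \<noteq> 0" "complex_of_int ?N \<noteq> 0" using npts_pos[of K] by simp_all
  have w: "cnj (wave \<kappa> (node K a b)) * wave \<kappa> (node K i j) = ?E (fst \<kappa>) (i - a) * ?E (snd \<kappa>) (j - b)"
    for \<kappa> a b by (simp add: wave_def node_def cis_cnj cis_mult algebra_simps)
  have dw: "dft K f \<kappa> * wave \<kappa> (node K i j) = of_real ((mesh K)\<^sup>2) *
      (\<Sum>a\<in>?I. \<Sum>b\<in>?I. of_real (f a b) * (?E (fst \<kappa>) (i - a) * ?E (snd \<kappa>) (j - b)))" for \<kappa>
    unfolding dft_def w[symmetric] by (simp add: sum_distrib_right mult.assoc)
  have dv: "(?N dvd x - a) = (a = x mod ?N)" if "a \<in> ?I" for a x
    using that by (metis atLeastLessThan_iff mod_eq_dvd_iff mod_pos_pos_trivial)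
  have "(\<Sum>\<kappa>\<in>modes K. dft K f \<kappa> * wave \<kappa> (node K i j))
      = (\<Sum>k\<in>?M. \<Sum>l\<in>?M. of_real ((mesh K)\<^sup>2) *
          (\<Sum>a\<in>?I. \<Sum>b\<in>?I. of_real (f a b) * (?E k (i - a) * ?E l (j - b))))"
    unfolding modes_def dw by (simp only: sum.cartesian_product case_prod_unfold)
  also have "\<dots> = of_real ((mesh K)\<^sup>2) * (\<Sum>k\<in>?M. \<Sum>l\<in>?M. \<Sum>a\<in>?I. \<Sum>b\<in>?I. of_real (f a b) * (?E k (i - a) * ?E l (j - b)))"
    by (simp add: sum_distrib_left)
  also have "(\<Sum>k\<in>?M. \<Sum>l\<in>?M. \<Sum>a\<in>?I. \<Sum>b\<in>?I. of_real (f a b) * (?E k (i - a) * ?E l (j - b)))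
      = (\<Sum>a\<in>?I. \<Sum>b\<in>?I. of_real (f a b) * ((\<Sum>k\<in>?M. ?E k (i - a)) * (\<Sum>l\<in>?M. ?E l (j - b))))"
    (is "?L = _")
  proof -
    have "?L = (\<Sum>k\<in>?M. \<Sum>a\<in>?I. \<Sum>l\<in>?M. \<Sum>b\<in>?I. of_real (f a b) * (?E k (i - a) * ?E l (j - b)))"
      by (intro sum.cong refl sum.swap)
    also have "\<dots> = (\<Sum>a\<in>?I. \<Sum>k\<in>?M. \<Sum>l\<in>?M. \<Sum>b\<in>?I. of_real (f a b) * (?E k (i - a) * ?E l (j - b)))"
      by (rule sum.swap)
    also have "\<dots> = (\<Sum>a\<in>?I. \<Sum>k\<in>?M. \<Sum>b\<in>?I. \<Sum>l\<in>?M. of_real (f a b) * (?E k (i - a) * ?E l (j - b)))"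
      by (intro sum.cong refl sum.swap)
    also have "\<dots> = (\<Sum>a\<in>?I. \<Sum>b\<in>?I. \<Sum>k\<in>?M. \<Sum>l\<in>?M. of_real (f a b) * (?E k (i - a) * ?E l (j - b)))"
      by (intro sum.cong refl sum.swap)
    finally show ?thesis unfolding sum_product unfolding sum_distrib_left .
  qed
  also have "\<dots> = (\<Sum>a\<in>?I. \<Sum>b\<in>?I. if b = j mod ?N then (if a = i mod ?N then of_real (f a b) * of_int ?N ^ 2 else 0) else 0)"
    by (intro sum.cong refl) (simp add: sum_cis_modes dv power2_eq_square flip: of_int_diff)
  also have "\<dots> = of_real (f (i mod ?N) (j mod ?N)) * of_int ?N ^ 2"
    using npts_pos[of K] by (simp add: sum.delta)
  finally show ?thesis using N by (simp add: grid_fun_mod[OF assms] mesh_def power_divide)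
qed

text \<open>
  For real data the coefficients at \<open>\<kappa>\<close> and \<open>- \<kappa>\<close> are conjugate and \<open>modes K\<close> is symmetric,
  so all sums below to which \<^const>\<open>Re\<close> is applied are real.
\<close>

definition DNx :: "nat \<Rightarrow> grid \<Rightarrow> grid" where
  "DNx K f = (\<lambda>i j. Re (\<Sum>\<kappa>\<in>modes K.
     (2 * pi * \<i> * of_int (fst \<kappa>)) * dft K f \<kappa> * wave \<kappa> (node K i j)))"

definition DNy :: "nat \<Rightarrow> grid \<Rightarrow> grid" where
  "DNy K f = (\<lambda>i j. Re (\<Sum>\<kappa>\<in>modes K.
     (2 * pi * \<i> * of_int (snd \<kappa>)) * dft K f \<kappa> * wave \<kappa> (node K i j)))"

definition lapN :: "nat \<Rightarrow> grid \<Rightarrow> grid" where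
  "lapN K f = (\<lambda>i j. DNx K (DNx K f) i j + DNy K (DNy K f) i j)"

definition divN :: "nat \<Rightarrow> grid \<times> grid \<Rightarrow> grid" where
  "divN K v = (\<lambda>i j. DNx K (fst v) i j + DNy K (snd v) i j)"

definition perpN :: "nat \<Rightarrow> grid \<Rightarrow> grid \<times> grid" where
  "perpN K \<psi> = (DNy K \<psi>, \<lambda>i j. - DNx K \<psi> i j)"

text \<open>The list of components: one entry if \<open>s\<close> is even, two if \<open>s\<close> is odd.\<close>

definition nablaN :: "nat \<Rightarrow> nat \<Rightarrow> grid \<Rightarrow> grid list" where
  "nablaN K s f = (let g = (lapN K ^^ (s div 2)) f in
     if even s then [g] else [DNx K g, DNy K g])"

definition innerN :: "nat \<Rightarrow> grid \<Rightarrow> grid \<Rightarrow> real" where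
  "innerN K f g = (mesh K)\<^sup>2 * (\<Sum>i = 0..<npts K. \<Sum>j = 0..<npts K. f i j * g i j)"

definition norm2N :: "nat \<Rightarrow> grid list \<Rightarrow> real" where
  "norm2N K fs = sqrt (\<Sum>f\<leftarrow>fs. innerN K f f)"

definition avgN :: "nat \<Rightarrow> grid \<Rightarrow> real" where
  "avgN K f = innerN K f (\<lambda>i j. 1)"

definition cont_ext :: "nat \<Rightarrow> grid \<Rightarrow> real \<times> real \<Rightarrow> real" where
  "cont_ext K f = (\<lambda>p. Re (\<Sum>\<kappa>\<in>modes K. dft K f \<kappa> * wave \<kappa> p))"


section \<open>Periodic functions on the unit square\<close>

definition Omega :: "(real \<times> real) set" where
  "Omega = cbox (0, 0) (1, 1)"

definition periodic :: "(real \<times> real \<Rightarrow> real) \<Rightarrow> bool" where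
  "periodic f \<longleftrightarrow> (\<forall>x y. f (x + 1, y) = f (x, y) \<and> f (x, y + 1) = f (x, y))"

definition zero_mean :: "(real \<times> real \<Rightarrow> real) \<Rightarrow> bool" where
  "zero_mean f \<longleftrightarrow> integral\<^sup>L (lebesgue_on Omega) f = 0"

definition dx :: "(real \<times> real \<Rightarrow> real) \<Rightarrow> real \<times> real \<Rightarrow> real" where
  "dx f = (\<lambda>(x, y). deriv (\<lambda>r. f (r, y)) x)"

definition dy :: "(real \<times> real \<Rightarrow> real) \<Rightarrow> real \<times> real \<Rightarrow> real" where
  "dy f = (\<lambda>(x, y). deriv (\<lambda>r. f (x, r)) y)"

definition lap :: "(real \<times> real \<Rightarrow> real) \<Rightarrow> real \<times> real \<Rightarrow> real" where
  "lap f = (\<lambda>p. dx (dx f) p + dy (dy f) p)"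

definition nabla :: "nat \<Rightarrow> (real \<times> real \<Rightarrow> real) \<Rightarrow> (real \<times> real \<Rightarrow> real) list" where
  "nabla s f = (let g = (lap ^^ (s div 2)) f in if even s then [g] else [dx g, dy g])"

definition normL2 :: "(real \<times> real \<Rightarrow> real) list \<Rightarrow> real" where
  "normL2 fs = sqrt (\<Sum>f\<leftarrow>fs. integral\<^sup>L (lebesgue_on Omega) (\<lambda>p. (f p)\<^sup>2))"

definition fourier :: "(real \<times> real \<Rightarrow> real) \<Rightarrow> int \<times> int \<Rightarrow> complex" where
  "fourier f \<kappa> = integral\<^sup>L (lebesgue_on Omega) (\<lambda>p. of_real (f p) * cnj (wave \<kappa> p))"

definition fproj :: "nat \<Rightarrow> (real \<times> real \<Rightarrow> real) \<Rightarrow> real \<times> real \<Rightarrow> real" where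
  "fproj K f = (\<lambda>p. Re (\<Sum>\<kappa>\<in>modes K. fourier f \<kappa> * wave \<kappa> p))"

definition restrictN :: "nat \<Rightarrow> (real \<times> real \<Rightarrow> real) \<Rightarrow> grid" where
  "restrictN K f = (\<lambda>i j. f (node K i j))"

text \<open>
  Periodic Sobolev spaces.  The term \<open>sob_term m f \<kappa>\<close> is the contribution of the mode \<open>\<kappa>\<close> to the
  squared \<open>L\<^sup>2\<close> norm of the weak derivative \<open>\<nabla>\<^sup>m f\<close> (Plancherel), so that the squared norm below is
  the sum of the squared \<open>L\<^sup>2\<close> norms of \<open>f, \<nabla> f, \<dots>, \<nabla>\<^sup>m f\<close>.
\<close>

definition sob_term :: "nat \<Rightarrow> (real \<times> real \<Rightarrow> real) \<Rightarrow> int \<times> int \<Rightarrow> real" where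
  "sob_term m f \<kappa> =
     (4 * pi\<^sup>2 * ((of_int (fst \<kappa>))\<^sup>2 + (of_int (snd \<kappa>))\<^sup>2)) ^ m * (cmod (fourier f \<kappa>))\<^sup>2"

definition Hper :: "nat \<Rightarrow> (real \<times> real \<Rightarrow> real) set" where
  "Hper m = {f. periodic f \<and> f \<in> borel_measurable (lebesgue_on Omega) \<and>
     integrable (lebesgue_on Omega) (\<lambda>p. (f p)\<^sup>2) \<and> sob_term m f summable_on UNIV}"

definition normH :: "nat \<Rightarrow> (real \<times> real \<Rightarrow> real) \<Rightarrow> real" where
  "normH m f = sqrt ((normL2 [f])\<^sup>2 + (\<Sum>j = 1..m. infsum (sob_term j f) UNIV))"

text \<open>The \<open>H\<^sup>m\<close> norm of a grid function.\<close>

definition normHN :: "nat \<Rightarrow> nat \<Rightarrow> grid \<Rightarrow> real" where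
  "normHN K m f = normH m (cont_ext K f)"

text \<open>
  \<open>L\<^sup>\<infinity>(0, \<infinity>; H\<^sup>m)\<close>: strongly (Bochner) measurable, \<open>\<phi>\<close> being the approximating simple functions,
  and bounded.  The scheme samples the force at individual times, so the bound is required at every
  \<open>t > 0\<close>, and the norm is the supremum over all \<open>t > 0\<close>, not the essential supremum.
\<close>

definition LinfH :: "nat \<Rightarrow> (real \<Rightarrow> real \<times> real \<Rightarrow> real) set" where
  "LinfH m = {f. (\<forall>t>0. f t \<in> Hper m) \<and>
     (\<exists>\<phi> :: nat \<Rightarrow> real \<Rightarrow> real \<times> real \<Rightarrow> real.
        (\<forall>n. finite (\<phi> n ` {0<..}) \<and>
             (\<forall>t>0. \<phi> n t \<in> Hper m \<and> {r \<in> {0<..}. \<phi> n r = \<phi> n t} \<in> sets lebesgue)) \<and>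
        (AE t in lebesgue_on {0<..}. (\<lambda>n. normH m (\<lambda>p. \<phi> n t p - f t p)) \<longlonglongrightarrow> 0)) \<and>
     bdd_above ((\<lambda>t. normH m (f t)) ` {0<..})}"

definition normLinfH :: "nat \<Rightarrow> (real \<Rightarrow> real \<times> real \<Rightarrow> real) \<Rightarrow> real" where
  "normLinfH m f = (SUP t\<in>{0<..}. normH m (f t))"

definition normLinfL2 :: "(real \<Rightarrow> real \<times> real \<Rightarrow> real) \<Rightarrow> real" where
  "normLinfL2 f = (SUP t\<in>{0<..}. normL2 [f t])"


section \<open>The IMEX BDF3 scheme\<close>

definition bdf3_stencil :: "(nat \<Rightarrow> real) \<Rightarrow> bool" where
  "bdf3_stencil \<alpha> \<longleftrightarrow> \<alpha> 1 > 0 \<and>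
    (\<forall>K f3 f2 f1 f0. grid_fun K f3 \<and> grid_fun K f2 \<and> grid_fun K f1 \<and> grid_fun K f0 \<longrightarrow>
       innerN K (\<lambda>i j. 11/6 * f3 i j - 3 * f2 i j + 3/2 * f1 i j - 1/3 * f0 i j)
                (\<lambda>i j. 2 * f3 i j - f2 i j) =
         (norm2N K [\<lambda>i j. \<alpha> 1 * f3 i j])\<^sup>2 - (norm2N K [\<lambda>i j. \<alpha> 1 * f2 i j])\<^sup>2
       + (norm2N K [\<lambda>i j. \<alpha> 2 * f3 i j + \<alpha> 3 * f2 i j])\<^sup>2
       - (norm2N K [\<lambda>i j. \<alpha> 2 * f2 i j + \<alpha> 3 * f1 i j])\<^sup>2
       + (norm2N K [\<lambda>i j. \<alpha> 4 * f3 i j + \<alpha> 5 * f2 i j + \<alpha> 6 * f1 i j])\<^sup>2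
       - (norm2N K [\<lambda>i j. \<alpha> 4 * f2 i j + \<alpha> 5 * f1 i j + \<alpha> 6 * f0 i j])\<^sup>2
       + (norm2N K [\<lambda>i j. \<alpha> 7 * f3 i j + \<alpha> 8 * f2 i j + \<alpha> 9 * f1 i j + \<alpha> 10 * f0 i j])\<^sup>2)"

definition advect :: "nat \<Rightarrow> grid \<times> grid \<Rightarrow> grid \<Rightarrow> grid" where
  "advect K u \<omega> = (\<lambda>i j. fst u i j * DNx K \<omega> i j + snd u i j * DNy K \<omega> i j)"

definition nonlin :: "nat \<Rightarrow> grid \<times> grid \<Rightarrow> grid \<Rightarrow> grid" where
  "nonlin K u \<omega> = (\<lambda>i j. advect K u \<omega> i j
     + divN K (\<lambda>k l. fst u k l * \<omega> k l, \<lambda>k l. snd u k l * \<omega> k l) i j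
     - avgN K (advect K u \<omega>))"

definition kinematic :: "nat \<Rightarrow> grid \<Rightarrow> grid \<Rightarrow> grid \<times> grid \<Rightarrow> bool" where
  "kinematic K \<omega> \<psi> u \<longleftrightarrow> grid_fun K \<omega> \<and> grid_fun K \<psi> \<and>
     (\<forall>i j. - lapN K \<psi> i j = \<omega> i j) \<and> avgN K \<psi> = 0 \<and> u = perpN K \<psi>"

text \<open>Time levels are integers, so that \<open>- 1\<close> and \<open>- 2\<close> are the levels of the initial guesses.\<close>

definition imex_bdf3 ::
  "nat \<Rightarrow> real \<Rightarrow> real \<Rightarrow> (real \<times> real \<Rightarrow> real) \<Rightarrow> (real \<Rightarrow> real \<times> real \<Rightarrow> real) \<Rightarrow>
   (int \<Rightarrow> grid) \<Rightarrow> (int \<Rightarrow> grid) \<Rightarrow> (int \<Rightarrow> grid \<times> grid) \<Rightarrow> bool" where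
  "imex_bdf3 K \<nu> dt \<omega>0 f \<omega> \<psi> u \<longleftrightarrow>
     \<omega> 0 = restrictN K (fproj K \<omega>0) \<and>
     avgN K (\<omega> 0) = 0 \<and> avgN K (\<omega> (- 1)) = 0 \<and> avgN K (\<omega> (- 2)) = 0 \<and>
     (\<forall>n\<ge>- 2. kinematic K (\<omega> n) (\<psi> n) (u n)) \<and>
     (\<forall>n\<ge>0. \<forall>i j.
        (11/6 * \<omega> (n + 1) i j - 3 * \<omega> n i j + 3/2 * \<omega> (n - 1) i j - 1/3 * \<omega> (n - 2) i j) / dt
        + 3/2 * nonlin K (u n) (\<omega> n) i j
        - 3/2 * nonlin K (u (n - 1)) (\<omega> (n - 1)) i j
        + 1/2 * nonlin K (u (n - 2)) (\<omega> (n - 2)) i j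
        = \<nu> * lapN K (\<omega> (n + 1)) i j
          + restrictN K (fproj K (f (of_int (n + 1) * dt))) i j)"

definition G0 :: "(nat \<Rightarrow> real) \<Rightarrow> nat \<Rightarrow> nat \<Rightarrow> real \<Rightarrow> real \<Rightarrow> (int \<Rightarrow> grid) \<Rightarrow> real" where
  "G0 \<alpha> K s \<nu> dt \<omega> =
       (norm2N K (map (\<lambda>g i j. \<alpha> 1 * g i j) (nablaN K s (\<omega> 0))))\<^sup>2
     + (norm2N K (nablaN K s (\<lambda>i j. \<alpha> 2 * \<omega> 0 i j + \<alpha> 3 * \<omega> (- 1) i j)))\<^sup>2
     + (norm2N K (nablaN K s (\<lambda>i j. \<alpha> 4 * \<omega> 0 i j + \<alpha> 5 * \<omega> (- 1) i j + \<alpha> 6 * \<omega> (- 2) i j)))\<^sup>2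
     + 37 * \<nu> * dt / 24 * (norm2N K (nablaN K (s + 1) (\<omega> 0)))\<^sup>2
     + 17 * \<nu> * dt / 48 * (norm2N K (nablaN K (s + 1) (\<omega> (- 1))))\<^sup>2
     + 17 * \<nu> * dt / 96 * (norm2N K (nablaN K (s + 1) (\<omega> (- 2))))\<^sup>2
     + 5/6 * (norm2N K (nablaN K s (\<lambda>i j. \<omega> 0 i j - \<omega> (- 1) i j)))\<^sup>2
     + 1/6 * (norm2N K (nablaN K s (\<lambda>i j. \<omega> (- 1) i j - \<omega> (- 2) i j)))\<^sup>2"

end

theory Submission
  imports Defs
begin

text \<open>Two scales of data have to be kept apart. The time step restriction may see only the H2
  norm of the initial vorticity and the L2 norm of the force, while the final bound is expressed by
  the H^(s+1) norm of the projected vorticity and the H^(s-1) norm of the force. Neither set of data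
  controls the other, so the base estimate is run with the smaller of the two and enlarged by
  monotonicity in either direction. The restriction also contains a bound of the very H1 norm that
  it serves to establish. This is not circular: in two dimensions the nonlinear term is bounded in
  L2 by the power 5/4 of the L2 norm times the power 3/4 of the H2 norm. The second exponent is
  below 1, so any fraction of the dissipation absorbs it, and the remainder involves the L2 bound
  alone. The numerical constants come from one budget: the tested stencil leaves 1/12 of each
  squared increment and \<nu> dt / 8 of the dissipation on four time levels. Half of that
  dissipation may be spent on force and nonlinearity; the other half dominates the energy, because
  zero mean excludes frequencies below 1.\<close>

text \<open>
  Everything takes place on the discrete Fourier coefficients, where a pointwise product becomes a
  cyclic convolution; since the centred residue of an integer is not larger than the integer itself,
  aliasing does not spoil the usual product estimates.  The scheme is tested with
  \<open>3 \<omega>\<^sup>n\<^sup>+\<^sup>1 - 2 \<omega>\<^sup>n\<close>, so that the stencil dissipates the increments \<open>\<omega>\<^sup>n\<^sup>+\<^sup>1 - \<omega>\<^sup>n\<close> in addition to the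
  viscous dissipation.  At the level of \<open>L\<^sup>2\<close> the discrete transport term is skew-symmetric, hence the
  nonlinear terms are linear in the increments and are absorbed when \<open>\<Delta>t M\<^sup>2 \<le> c \<nu>\<close>, where \<open>M\<close> bounds
  the \<open>H\<^sup>1\<close> norm.  The \<open>L\<^sup>2\<close> bound so obtained does not involve \<open>M\<close>, and by interpolation it controls the
  \<open>H\<^sup>1\<close> norm without any further restriction of the time step, so both bounds propagate together by
  induction in time.  The levels \<open>s \<ge> 2\<close> follow one after the other, the nonlinear term being of lower
  order given a bound at level \<open>s - 1\<close>.  The resulting bound is uniform in time and depends only on the
  data that \<open>R\<close> may depend on, so it serves as \<open>R\<close>, and the decaying term on the right-hand side is
  just nonnegative.
\<close>

section \<open>Convolution estimates on centred residues\<close>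

definition redi :: "nat \<Rightarrow> int \<Rightarrow> int" where
  "redi K x = (x + int K) mod npts K - int K"

definition red :: "nat \<Rightarrow> int \<times> int \<Rightarrow> int \<times> int" where
  "red K \<kappa> = (redi K (fst \<kappa>), redi K (snd \<kappa>))"

text \<open>The square root of the symbol of minus the Laplacian, so that its powers are the Fourier
  weights of all higher-order operators. Writing it as the norm of a pair provides the triangle
  inequality.\<close>

definition rad :: "int \<times> int \<Rightarrow> real" where
  "rad \<kappa> = 2 * pi * norm (real_of_int (fst \<kappa>), real_of_int (snd \<kappa>))"

lemma finite_modes [simp]: "finite (modes K)"
  by (simp add: modes_def)

lemma zero_in_modes [simp]: "0 \<in> modes K"
  by (simp add: modes_def zero_prod_def)

lemma modes_minus: "- \<kappa> \<in> modes K \<longleftrightarrow> \<kappa> \<in> modes K"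
  by (cases \<kappa>) (auto simp: modes_def)

lemma redi_range: "redi K x \<in> {- int K..int K}"
  using pos_mod_sign[of "npts K" "x + int K"] pos_mod_bound[of "npts K" "x + int K"] npts_pos[of K]
  by (auto simp: redi_def npts_def)

lemma red_in_modes [simp]: "red K \<kappa> \<in> modes K"
  using redi_range by (simp add: red_def modes_def)

lemma redi_id: "x \<in> {- int K..int K} \<Longrightarrow> redi K x = x"
  unfolding redi_def by (subst mod_pos_pos_trivial) (auto simp: npts_def)

lemma red_id: "\<kappa> \<in> modes K \<Longrightarrow> red K \<kappa> = \<kappa>"
  by (cases \<kappa>) (auto simp: red_def modes_def redi_id)

lemma redi_cong: "x mod npts K = y mod npts K \<Longrightarrow> redi K x = redi K y"
  unfolding redi_def by (metis mod_add_left_eq)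

lemma redi_mod: "redi K x mod npts K = x mod npts K"
  unfolding redi_def by (simp add: mod_diff_left_eq)

lemma redi_add: "redi K (redi K x + y) = redi K (x + y)"
  by (rule redi_cong) (metis mod_add_left_eq redi_mod)

lemma redi_diff: "redi K (x - redi K y) = redi K (x - y)"
  by (rule redi_cong) (metis mod_diff_right_eq redi_mod)

lemma red_add: "red K (red K \<kappa> + l) = red K (\<kappa> + l)"
  by (simp add: red_def redi_add)

lemma red_diff: "red K (\<kappa> - red K l) = red K (\<kappa> - l)"
  by (simp add: red_def redi_diff)

lemma redi_abs: "\<bar>redi K x\<bar> \<le> \<bar>x\<bar>"
proof (cases "x \<in> {- int K..int K}")
  case True then show ?thesis by (simp add: redi_id)
next
  case False then show ?thesis using redi_range[of K x] by auto
qed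

text \<open>Translation by \<open>l\<close> permutes the group of frequencies modulo
  \<open>npts K\<close>, of which \<open>modes K\<close> is a set of representatives.\<close>

lemma sum_red_diff: "(\<Sum>\<kappa>\<in>modes K. F (red K (\<kappa> - l))) = sum F (modes K)"
  by (rule sum.reindex_bij_witness[of _ "\<lambda>\<kappa>. red K (\<kappa> + l)" "\<lambda>\<kappa>. red K (\<kappa> - l)"])
    (use red_add[of K _ l] red_add[of K _ "- l"] in \<open>auto simp: red_id\<close>)

lemma red_diff_involution: "l \<in> modes K \<Longrightarrow> red K (\<kappa> - red K (\<kappa> - l)) = l"
  by (simp add: red_diff red_id)

lemma sum_red_diff': "(\<Sum>l\<in>modes K. F l (red K (\<kappa> - l))) = (\<Sum>l\<in>modes K. F (red K (\<kappa> - l)) l)"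
  by (rule sum.reindex_bij_witness[of _ "\<lambda>l. red K (\<kappa> - l)" "\<lambda>l. red K (\<kappa> - l)"])
    (auto simp: red_diff_involution)

lemma sum_red_diff_right: "(\<Sum>l\<in>modes K. F (red K (\<kappa> - l))) = sum F (modes K)"
  using sum_red_diff'[of "\<lambda>_. F" K \<kappa>] by simp

section \<open>Frequency moduli and lattice sums\<close>

lemma rad_nonneg [simp]: "rad \<kappa> \<ge> 0"
  by (simp add: rad_def)

lemma rad_0 [simp]: "rad 0 = 0"
  by (simp add: rad_def flip: zero_prod_def)

lemma rad_sq: "(rad \<kappa>)\<^sup>2 = 4 * pi\<^sup>2 * ((of_int (fst \<kappa>))\<^sup>2 + (of_int (snd \<kappa>))\<^sup>2)"
  by (simp add: rad_def norm_Pair power_mult_distrib)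

text \<open>Bounding the isotropic weight below by a product lets lattice sums factor into
  one-dimensional ones. A nonzero mode has x^2 + y^2 >= 1 and integers satisfy |k| <= k^2, so the
  product is at most 3 (x^2 + y^2), and 3 <= 4 pi^2.\<close>

lemma rad_lower:
  assumes "\<kappa> \<noteq> 0"
  shows "(1 + \<bar>real_of_int (fst \<kappa>)\<bar>) * (1 + \<bar>real_of_int (snd \<kappa>)\<bar>) \<le> (rad \<kappa>)\<^sup>2"
proof -
  define x y where "x = \<bar>real_of_int (fst \<kappa>)\<bar>" and "y = \<bar>real_of_int (snd \<kappa>)\<bar>"
  have le: "\<bar>k\<bar> \<le> k\<^sup>2" for k :: int
  proof (cases "k = 0")
    case False
    then have "1 * \<bar>k\<bar> \<le> \<bar>k\<bar> * \<bar>k\<bar>" by (intro mult_right_mono) auto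
    then show ?thesis by (simp add: power2_eq_square)
  qed simp
  have x: "x \<le> x\<^sup>2" and y: "y \<le> y\<^sup>2"
    using le[of "fst \<kappa>"] le[of "snd \<kappa>"] unfolding x_def y_def
    by (metis of_int_abs of_int_le_iff of_int_power power2_abs)+
  have "fst \<kappa> \<noteq> 0 \<or> snd \<kappa> \<noteq> 0" using assms by (auto simp: prod_eq_iff)
  then have "x \<ge> 1 \<or> y \<ge> 1" by (auto simp: x_def y_def)
  then have 1: "1 \<le> x\<^sup>2 + y\<^sup>2" using x y by (auto simp: add_increasing add_increasing2)
  have "2 * (x * y) \<le> x\<^sup>2 + y\<^sup>2" using sum_squares_bound[of x y] by simp
  then have "(1 + x) * (1 + y) \<le> 3 * (x\<^sup>2 + y\<^sup>2)" using 1 x y by (simp add: algebra_simps)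
  also have "\<dots> \<le> 4 * pi\<^sup>2 * (x\<^sup>2 + y\<^sup>2)"
    using pi_gt3 power_mono[of 3 pi 2] by (intro mult_right_mono) auto
  finally show ?thesis by (simp add: rad_sq x_def y_def)
qed

lemma rad_ge_1:
  assumes "\<kappa> \<noteq> 0" shows "rad \<kappa> \<ge> 1"
proof -
  have "1 \<le> (1 + \<bar>real_of_int (fst \<kappa>)\<bar>) * (1 + \<bar>real_of_int (snd \<kappa>)\<bar>)"
    by (simp add: algebra_simps)
  then have "1\<^sup>2 \<le> (rad \<kappa>)\<^sup>2" using rad_lower[OF assms] by simp
  then show ?thesis using power2_le_imp_le rad_nonneg by blast
qed

lemma rad_eq_0_iff [simp]: "rad \<kappa> = 0 \<longleftrightarrow> \<kappa> = 0"
proof (cases "\<kappa> = 0")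
  case False then show ?thesis using rad_ge_1[of \<kappa>] by simp
qed simp

text \<open>With \<open>m\<close> the residue of \<open>\<kappa> - l\<close>, the mode
  \<open>\<kappa>\<close> is the residue of \<open>l + m\<close>, so its components are at most
  those of \<open>l + m\<close> in absolute value; the Euclidean triangle inequality does the
  rest.\<close>

lemma rad_triangle:
  assumes "\<kappa> \<in> modes K"
  shows "rad \<kappa> \<le> rad l + rad (red K (\<kappa> - l))"
proof -
  define m where "m = red K (\<kappa> - l)"
  have "red K (l + m) = \<kappa>"
    using red_add[of K "\<kappa> - l" l] assms by (simp add: m_def red_id add.commute)
  then have k: "fst \<kappa> = redi K (fst l + fst m)" "snd \<kappa> = redi K (snd l + snd m)"
    by (auto simp: red_def)
  have "\<bar>real_of_int (fst \<kappa>)\<bar> \<le> \<bar>real_of_int (fst l) + real_of_int (fst m)\<bar>"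
    using redi_abs[of K "fst l + fst m"] unfolding k(1) by linarith
  moreover have "\<bar>real_of_int (snd \<kappa>)\<bar> \<le> \<bar>real_of_int (snd l) + real_of_int (snd m)\<bar>"
    using redi_abs[of K "snd l + snd m"] unfolding k(2) by linarith
  ultimately have "norm (real_of_int (fst \<kappa>), real_of_int (snd \<kappa>))
      \<le> norm (real_of_int (fst l) + real_of_int (fst m), real_of_int (snd l) + real_of_int (snd m))"
    unfolding norm_Pair real_norm_def by (intro real_sqrt_le_mono add_mono power_mono) auto
  also have "\<dots> \<le> norm (real_of_int (fst l), real_of_int (snd l)) + norm (real_of_int (fst m), real_of_int (snd m))"
    using norm_triangle_ineq[of "(real_of_int (fst l), real_of_int (snd l))" "(real_of_int (fst m), real_of_int (snd m))"]
    by simp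
  finally show ?thesis unfolding rad_def m_def[symmetric] by (simp flip: distrib_left)
qed

text \<open>A bound, uniform in \<open>K\<close>, for the sum of \<open>rad\<close> to the power -3
  over nonzero modes: by \<open>rad_lower\<close> it factors into two equal one-dimensional sums
  with exponent -3/2, each at most twice the sum over nonnegative integers.\<close>

definition lattice_bound :: real where
  "lattice_bound = (2 * (\<Sum>n. (1 + real n) powr (-3/2)))\<^sup>2"

lemma lattice_sum: "(\<Sum>\<kappa>\<in>modes K - {0}. 1 / rad \<kappa> ^ 3) \<le> lattice_bound"
proof -
  let ?p = "\<lambda>k::int. (1 + \<bar>real_of_int k\<bar>) powr (-3/2)"
  let ?M = "{- int K..int K}"
  have sm: "summable (\<lambda>n. (1 + real n) powr (-3/2))"
  proof -
    have "summable (\<lambda>n. real n powr (-3/2))" by (simp add: summable_real_powr_iff)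
    then have "summable (\<lambda>n. real (Suc n) powr (-3/2))" by (rule summable_Suc_iff[THEN iffD2])
    then show ?thesis by (simp add: add.commute)
  qed
  have "1 / rad \<kappa> ^ 3 \<le> ?p (fst \<kappa>) * ?p (snd \<kappa>)" if "\<kappa> \<noteq> 0" for \<kappa>
  proof -
    have r: "rad \<kappa> > 0" using rad_ge_1[OF that] by linarith
    have "1 / rad \<kappa> ^ 3 = ((rad \<kappa>)\<^sup>2) powr (-3/2)"
    proof -
      have "((rad \<kappa>)\<^sup>2) powr (-3/2) = (rad \<kappa> powr 2) powr (-3/2)" using r by simp
      also have "\<dots> = rad \<kappa> powr (- real 3)" unfolding powr_powr by simp
      also have "\<dots> = 1 / rad \<kappa> ^ 3" using r powr_realpow[of "rad \<kappa>" 3] by (simp add: powr_minus_divide)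
      finally show ?thesis by simp
    qed
    also have "\<dots> \<le> ((1 + \<bar>real_of_int (fst \<kappa>)\<bar>) * (1 + \<bar>real_of_int (snd \<kappa>)\<bar>)) powr (-3/2)"
      by (rule powr_mono2') (use rad_lower[OF that] in \<open>auto intro!: mult_pos_pos add_pos_nonneg\<close>)
    finally show ?thesis by (simp add: powr_mult)
  qed
  then have "(\<Sum>\<kappa>\<in>modes K - {0}. 1 / rad \<kappa> ^ 3) \<le> (\<Sum>\<kappa>\<in>modes K - {0}. ?p (fst \<kappa>) * ?p (snd \<kappa>))"
    by (intro sum_mono) auto
  also have "\<dots> \<le> (\<Sum>\<kappa>\<in>modes K. ?p (fst \<kappa>) * ?p (snd \<kappa>))"
    by (intro sum_mono2) auto
  also have "\<dots> = (\<Sum>k\<in>?M. ?p k)\<^sup>2"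
    unfolding modes_def power2_eq_square sum_product by (simp add: sum.cartesian_product case_prod_unfold)
  also have "\<dots> \<le> lattice_bound"
  proof -
    have "(\<Sum>k\<in>?M. ?p k) \<le> (\<Sum>k\<in>{0..int K} \<union> uminus ` {0..int K}. ?p k)"
      by (intro sum_mono2) (auto simp: image_iff intro: bexI[of _ "- x" for x])
    also have "\<dots> \<le> (\<Sum>k\<in>{0..int K}. ?p k) + (\<Sum>k\<in>uminus ` {0..int K}. ?p k)"
      by (subst sum_Un) (auto intro: sum_nonneg)
    also have "(\<Sum>k\<in>uminus ` {0..int K}. ?p k) = (\<Sum>k\<in>{0..int K}. ?p k)"
      by (subst sum.reindex) (auto simp: inj_on_def)
    also have "(\<Sum>k\<in>{0..int K}. ?p k) = (\<Sum>n\<in>{0..K}. (1 + real n) powr (-3/2))"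
      by (rule sum.reindex_bij_witness[of _ int nat]) auto
    also have "\<dots> \<le> (\<Sum>n. (1 + real n) powr (-3/2))"
      by (rule sum_le_suminf[OF sm]) auto
    finally show ?thesis unfolding lattice_bound_def
      by (intro power_mono) (auto intro: sum_nonneg)
  qed
  finally show ?thesis .
qed

lemma lattice_bound_nonneg [simp]: "lattice_bound \<ge> 0"
  by (simp add: lattice_bound_def)

text \<open>Division by zero yields 0, so the zero mode adds nothing and may stay in the index
  set.\<close>

lemma lattice_sum3: "(\<Sum>\<kappa>\<in>modes K. 1 / rad \<kappa> ^ 3) \<le> lattice_bound"
  using lattice_sum[of K] by (subst (asm) sum_diff1) auto

lemma lattice_sum4: "(\<Sum>\<kappa>\<in>modes K. 1 / rad \<kappa> ^ 4) \<le> lattice_bound"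
proof -
  have "1 / rad \<kappa> ^ 4 \<le> 1 / rad \<kappa> ^ 3" for \<kappa>
    using rad_ge_1[of \<kappa>] by (cases "\<kappa> = 0") (auto intro!: divide_left_mono power_increasing)
  then show ?thesis using lattice_sum3[of K] sum_mono by (metis (no_types, lifting) order_trans)
qed

section \<open>Homogeneous Sobolev norms of coefficient families\<close>

definition hs :: "nat \<Rightarrow> nat \<Rightarrow> (int \<times> int \<Rightarrow> real) \<Rightarrow> real" where
  "hs K s a = L2_set (\<lambda>\<kappa>. rad \<kappa> ^ s * a \<kappa>) (modes K)"

lemma hs_nonneg [simp]: "hs K s a \<ge> 0"
  by (simp add: hs_def)

lemma hs_sq: "(hs K s a)\<^sup>2 = (\<Sum>\<kappa>\<in>modes K. rad \<kappa> ^ (2 * s) * (a \<kappa>)\<^sup>2)"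
  by (simp add: hs_def L2_set_def sum_nonneg power_mult_distrib power_mult[symmetric] mult.commute)

text \<open>Nonzero frequencies are at least 1. The condition on \<open>a 0\<close> is due to order
  0, where the weight at the zero mode is 0 ^ 0 = 1, whereas every higher order ignores that
  mode.\<close>

lemma hs_mono_order:
  assumes "s \<le> t" "a 0 = 0 \<or> s \<ge> 1"
  shows "hs K s a \<le> hs K t a"
proof -
  have "rad \<kappa> ^ (2 * s) * (a \<kappa>)\<^sup>2 \<le> rad \<kappa> ^ (2 * t) * (a \<kappa>)\<^sup>2" for \<kappa>
  proof (cases "\<kappa> = 0")
    case True then show ?thesis using assms by (auto simp: power_0_left)
  next
    case False
    then show ?thesis using rad_ge_1[of \<kappa>] assms by (intro mult_right_mono power_increasing) auto
  qed
  then have "(hs K s a)\<^sup>2 \<le> (hs K t a)\<^sup>2" unfolding hs_sq by (intro sum_mono)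
  then show ?thesis using power2_le_imp_le hs_nonneg by blast
qed

lemma hs_weight_mult: "hs K s (\<lambda>\<kappa>. rad \<kappa> ^ t * a \<kappa>) = hs K (s + t) a"
  by (simp add: hs_def power_add mult.assoc)

lemma hs_weight_divide:
  assumes "a 0 = 0" shows "hs K (Suc s) (\<lambda>\<kappa>. a \<kappa> / rad \<kappa>) = hs K s a"
proof -
  have "rad \<kappa> ^ Suc s * (a \<kappa> / rad \<kappa>) = rad \<kappa> ^ s * a \<kappa>" for \<kappa>
    using rad_ge_1[of \<kappa>] assms by (cases "\<kappa> = 0") auto
  then show ?thesis by (simp add: hs_def)
qed

lemma hs_interpolation: "(\<Sum>\<kappa>\<in>modes K. rad \<kappa> ^ (s + t) * (a \<kappa>)\<^sup>2) \<le> hs K s a * hs K t a"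
proof -
  have "(\<Sum>\<kappa>\<in>modes K. rad \<kappa> ^ (s + t) * (a \<kappa>)\<^sup>2)
      = (\<Sum>\<kappa>\<in>modes K. \<bar>rad \<kappa> ^ s * a \<kappa>\<bar> * \<bar>rad \<kappa> ^ t * a \<kappa>\<bar>)"
    by (intro sum.cong refl) (simp add: abs_mult power_add power2_eq_square mult_ac)
  also have "\<dots> \<le> hs K s a * hs K t a"
    unfolding hs_def by (rule L2_set_mult_ineq)
  finally show ?thesis .
qed

lemma hs_interpolation_Suc: "(hs K (Suc s) a)\<^sup>2 \<le> hs K s a * hs K (s + 2) a"
  using hs_interpolation[where s = s and t = "s + 2" and a = a and K = K] by (simp add: hs_sq mult_2)

text \<open>Agmon's inequality on the Fourier side: Cauchy-Schwarz with the weight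
  \<open>rad\<close> to the power 3/2. Its square has exponent 3, which exceeds the dimension, so
  the lattice sum stays bounded; and 3 = 1 + 2, which produces the geometric mean of the orders 1
  and 2.\<close>

lemma sum_sq_le_hs:
  assumes "a 0 = 0"
  shows "(\<Sum>\<kappa>\<in>modes K. a \<kappa>)\<^sup>2 \<le> lattice_bound * (hs K 1 a * hs K 2 a)"
proof -
  have "(\<Sum>\<kappa>\<in>modes K. a \<kappa>) = (\<Sum>\<kappa>\<in>modes K. sqrt (1 / rad \<kappa> ^ 3) * (sqrt (rad \<kappa> ^ 3) * a \<kappa>))"
  proof (intro sum.cong refl)
    fix \<kappa>
    have "sqrt (1 / rad \<kappa> ^ 3) * sqrt (rad \<kappa> ^ 3) = 1" if "\<kappa> \<noteq> 0"
      using that by (simp flip: real_sqrt_mult)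
    then show "a \<kappa> = sqrt (1 / rad \<kappa> ^ 3) * (sqrt (rad \<kappa> ^ 3) * a \<kappa>)"
      using assms by (cases "\<kappa> = 0") (auto simp: mult.assoc[symmetric])
  qed
  also have "\<dots>\<^sup>2 \<le> (\<Sum>\<kappa>\<in>modes K. (sqrt (1 / rad \<kappa> ^ 3))\<^sup>2) * (\<Sum>\<kappa>\<in>modes K. (sqrt (rad \<kappa> ^ 3) * a \<kappa>)\<^sup>2)"
    by (rule Cauchy_Schwarz_ineq_sum)
  also have "(\<Sum>\<kappa>\<in>modes K. (sqrt (1 / rad \<kappa> ^ 3))\<^sup>2) = (\<Sum>\<kappa>\<in>modes K. 1 / rad \<kappa> ^ 3)"
    by (intro sum.cong refl real_sqrt_pow2) simp
  also have "(\<Sum>\<kappa>\<in>modes K. (sqrt (rad \<kappa> ^ 3) * a \<kappa>)\<^sup>2) = (\<Sum>\<kappa>\<in>modes K. rad \<kappa> ^ (1 + 2) * (a \<kappa>)\<^sup>2)"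
    by (intro sum.cong refl) (simp add: power_mult_distrib numeral_3_eq_3)
  also have "(\<Sum>\<kappa>\<in>modes K. 1 / rad \<kappa> ^ 3) * \<dots> \<le> lattice_bound * (hs K 1 a * hs K 2 a)"
    by (intro mult_mono lattice_sum3 hs_interpolation) (auto intro: sum_nonneg)
  finally show ?thesis .
qed

lemma sum_le_hs:
  assumes "a 0 = 0"
  shows "(\<Sum>\<kappa>\<in>modes K. a \<kappa>) \<le> sqrt lattice_bound * hs K 2 a"
proof -
  have "(\<Sum>\<kappa>\<in>modes K. a \<kappa>)\<^sup>2 \<le> lattice_bound * (hs K 2 a * hs K 2 a)"
    using sum_sq_le_hs[of a K, OF assms] hs_mono_order[of 1 2 a K]
    by (meson lattice_bound_nonneg hs_nonneg mult_left_mono mult_right_mono one_le_numeral order_trans le_refl)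
  also have "\<dots> = (sqrt lattice_bound * hs K 2 a)\<^sup>2"
    by (simp add: power_mult_distrib power2_eq_square[of "hs K 2 a"])
  finally show ?thesis using power2_le_imp_le by fastforce
qed

section \<open>Cyclic convolution estimates\<close>

definition conv :: "nat \<Rightarrow> (int \<times> int \<Rightarrow> real) \<Rightarrow> (int \<times> int \<Rightarrow> real) \<Rightarrow> int \<times> int \<Rightarrow> real" where
  "conv K a b \<kappa> = (\<Sum>l\<in>modes K. a l * b (red K (\<kappa> - l)))"

lemma conv_commute: "conv K a b = conv K b a"
  unfolding conv_def by (subst sum_red_diff') (simp add: mult.commute)

text \<open>Young's inequality for a summable and a square summable factor: Cauchy-Schwarz with
  \<open>a\<close> itself as weight, and translation invariance of the sum over
  \<open>\<kappa>\<close>.\<close>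

lemma L2_conv_le:
  assumes "\<And>l. a l \<ge> 0"
  shows "L2_set (conv K a b) (modes K) \<le> sum a (modes K) * L2_set b (modes K)"
proof -
  let ?M = "modes K"
  have 1: "(conv K a b \<kappa>)\<^sup>2 \<le> sum a ?M * (\<Sum>l\<in>?M. a l * (b (red K (\<kappa> - l)))\<^sup>2)" for \<kappa>
  proof -
    have "conv K a b \<kappa> = (\<Sum>l\<in>?M. sqrt (a l) * (sqrt (a l) * b (red K (\<kappa> - l))))"
      unfolding conv_def using assms by (simp add: mult.assoc[symmetric])
    also have "\<dots>\<^sup>2 \<le> (\<Sum>l\<in>?M. (sqrt (a l))\<^sup>2) * (\<Sum>l\<in>?M. (sqrt (a l) * b (red K (\<kappa> - l)))\<^sup>2)"
      by (rule Cauchy_Schwarz_ineq_sum)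
    also have "\<dots> = sum a ?M * (\<Sum>l\<in>?M. a l * (b (red K (\<kappa> - l)))\<^sup>2)"
      using assms by (simp add: power_mult_distrib)
    finally show ?thesis .
  qed
  have "(\<Sum>\<kappa>\<in>?M. (conv K a b \<kappa>)\<^sup>2) \<le> (\<Sum>\<kappa>\<in>?M. sum a ?M * (\<Sum>l\<in>?M. a l * (b (red K (\<kappa> - l)))\<^sup>2))"
    by (intro sum_mono 1)
  also have "\<dots> = sum a ?M * (\<Sum>l\<in>?M. a l * (\<Sum>\<kappa>\<in>?M. (b (red K (\<kappa> - l)))\<^sup>2))"
    unfolding sum_distrib_left by (rule sum.swap)
  also have "\<dots> = sum a ?M * (\<Sum>l\<in>?M. a l * (\<Sum>\<kappa>\<in>?M. (b \<kappa>)\<^sup>2))"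
    by (simp add: sum_red_diff[of "\<lambda>\<kappa>. (b \<kappa>)\<^sup>2"])
  also have "\<dots> = (sum a ?M * L2_set b ?M)\<^sup>2"
    by (simp add: L2_set_def power_mult_distrib sum_nonneg sum_distrib_right[symmetric] power2_eq_square)
  finally have "sqrt (\<Sum>\<kappa>\<in>?M. (conv K a b \<kappa>)\<^sup>2) \<le> sqrt ((sum a ?M * L2_set b ?M)\<^sup>2)"
    by (rule real_sqrt_le_mono)
  also have "\<dots> = sum a ?M * L2_set b ?M"
    using assms by (simp add: sum_nonneg)
  finally show ?thesis by (simp add: L2_set_def)
qed

text \<open>In two dimensions the product of two H1 functions is in L2. Splitting off the
  reciprocals of both frequency moduli from the convolution sum leaves a lattice sum bounded
  uniformly in \<open>\<kappa>\<close>; the remaining squares sum to a product of norms.\<close>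

lemma L2_conv_le_hs:
  assumes "a 0 = 0" "b 0 = 0"
  shows "L2_set (conv K a b) (modes K) \<le> sqrt lattice_bound * (hs K 1 a * hs K 1 b)"
proof -
  let ?M = "modes K"
  have inv: "1 / rad l * (rad l * c) = c" if "l = 0 \<longrightarrow> c = 0" for l c
    using that rad_ge_1[of l] by (cases "l = 0") auto
  \<comment> \<open>Decouples the two reciprocals, whose lattice sums agree after the reflection of
    \<open>l\<close> to \<open>\<kappa> - l\<close>.\<close>
  have mean4: "(p * q)\<^sup>2 \<le> (p ^ 4 + q ^ 4) / 2" for p q :: real
    using sum_squares_bound[of "p\<^sup>2" "q\<^sup>2"] by (simp add: power_mult_distrib flip: power_mult)
  have 1: "(conv K a b \<kappa>)\<^sup>2 \<le> lattice_bound * (\<Sum>l\<in>?M. (rad l * a l)\<^sup>2 * (rad (red K (\<kappa> - l)) * b (red K (\<kappa> - l)))\<^sup>2)" for \<kappa>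
  proof -
    let ?m = "\<lambda>l. red K (\<kappa> - l)"
    have "(\<Sum>l\<in>?M. (1 / rad l * (1 / rad (?m l)))\<^sup>2) \<le> (\<Sum>l\<in>?M. (1 / rad l ^ 4 + 1 / rad (?m l) ^ 4) / 2)"
    proof (intro sum_mono)
      fix l
      show "(1 / rad l * (1 / rad (?m l)))\<^sup>2 \<le> (1 / rad l ^ 4 + 1 / rad (?m l) ^ 4) / 2"
        using mean4[of "1 / rad l" "1 / rad (?m l)"] by (simp only: power_one_over)
    qed
    also have "\<dots> = (\<Sum>l\<in>?M. 1 / rad l ^ 4)"
      using sum_red_diff_right[of "\<lambda>l. 1 / rad l ^ 4" K \<kappa>] by (simp add: sum.distrib flip: sum_divide_distrib)
    also have "\<dots> \<le> lattice_bound" by (rule lattice_sum4)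
    finally have lat: "(\<Sum>l\<in>?M. (1 / rad l * (1 / rad (?m l)))\<^sup>2) \<le> lattice_bound" .
    have e: "conv K a b \<kappa> = (\<Sum>l\<in>?M. (1 / rad l * (1 / rad (?m l))) * ((rad l * a l) * (rad (?m l) * b (?m l))))"
      unfolding conv_def
    proof (intro sum.cong refl)
      fix l
      have "1 / rad l * (rad l * a l) = a l" "1 / rad (?m l) * (rad (?m l) * b (?m l)) = b (?m l)"
        using assms by (auto intro!: inv)
      then have "a l * b (?m l) = (1 / rad l * (rad l * a l)) * (1 / rad (?m l) * (rad (?m l) * b (?m l)))"
        by metis
      then show "a l * b (?m l) = (1 / rad l * (1 / rad (?m l))) * ((rad l * a l) * (rad (?m l) * b (?m l)))"
        by (simp only: mult_ac)
    qed
    have "(conv K a b \<kappa>)\<^sup>2 \<le> (\<Sum>l\<in>?M. (1 / rad l * (1 / rad (?m l)))\<^sup>2) * (\<Sum>l\<in>?M. ((rad l * a l) * (rad (?m l) * b (?m l)))\<^sup>2)"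
      unfolding e by (rule Cauchy_Schwarz_ineq_sum)
    also have "\<dots> \<le> lattice_bound * (\<Sum>l\<in>?M. ((rad l * a l) * (rad (?m l) * b (?m l)))\<^sup>2)"
      by (intro mult_right_mono lat sum_nonneg) auto
    finally show ?thesis by (simp only: power_mult_distrib)
  qed
  have "(\<Sum>\<kappa>\<in>?M. (conv K a b \<kappa>)\<^sup>2)
      \<le> (\<Sum>\<kappa>\<in>?M. lattice_bound * (\<Sum>l\<in>?M. (rad l * a l)\<^sup>2 * (rad (red K (\<kappa> - l)) * b (red K (\<kappa> - l)))\<^sup>2))"
    by (intro sum_mono 1)
  also have "\<dots> = lattice_bound * (\<Sum>l\<in>?M. (rad l * a l)\<^sup>2 * (\<Sum>\<kappa>\<in>?M. (rad (red K (\<kappa> - l)) * b (red K (\<kappa> - l)))\<^sup>2))"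
    unfolding sum_distrib_left by (rule sum.swap)
  also have "\<dots> = lattice_bound * ((\<Sum>l\<in>?M. (rad l * a l)\<^sup>2) * (\<Sum>\<kappa>\<in>?M. (rad \<kappa> * b \<kappa>)\<^sup>2))"
    by (simp add: sum_red_diff[of "\<lambda>\<kappa>. (rad \<kappa> * b \<kappa>)\<^sup>2"] sum_distrib_right)
  finally have "sqrt (\<Sum>\<kappa>\<in>?M. (conv K a b \<kappa>)\<^sup>2) \<le> sqrt (lattice_bound * ((\<Sum>l\<in>?M. (rad l * a l)\<^sup>2) * (\<Sum>\<kappa>\<in>?M. (rad \<kappa> * b \<kappa>)\<^sup>2)))"
    by (rule real_sqrt_le_mono)
  then show ?thesis by (simp add: L2_set_def hs_def real_sqrt_mult)
qed

lemma L2_set_cmult: "c \<ge> 0 \<Longrightarrow> L2_set (\<lambda>x. c * f x) A = c * L2_set f A"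
  using L2_set_right_distrib[of c f A] by simp

text \<open>
  The Fourier coefficients of \<open>u \<cdot> \<nabla>\<phi> + \<nabla> \<cdot> (u \<phi>)\<close>, where \<open>a\<close> and \<open>b\<close> are the moduli of the coefficients
  of the vorticity that generates \<open>u\<close> and of \<open>\<phi>\<close>, are dominated in this way once the outer derivative
  is distributed by the triangle inequality for frequencies.
\<close>

definition transport_dominated ::
  "nat \<Rightarrow> (int \<times> int \<Rightarrow> real) \<Rightarrow> (int \<times> int \<Rightarrow> real) \<Rightarrow> (int \<times> int \<Rightarrow> real) \<Rightarrow> bool" where
  "transport_dominated K a b n \<longleftrightarrow>
     (\<forall>l. a l \<ge> 0) \<and> (\<forall>l. b l \<ge> 0) \<and> a 0 = 0 \<and> b 0 = 0 \<and>
     (\<forall>\<kappa>\<in>modes K. 0 \<le> n \<kappa> \<and>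
        n \<kappa> \<le> 4 * conv K (\<lambda>l. a l / rad l) (\<lambda>l. rad l * b l) \<kappa> + 2 * conv K a b \<kappa>)"

lemma transport_dominatedD:
  assumes "transport_dominated K a b n"
  shows "a l \<ge> 0" "b l \<ge> 0" "a 0 = 0" "b 0 = 0" "a l / rad l \<ge> 0"
    "\<kappa> \<in> modes K \<Longrightarrow> 0 \<le> n \<kappa>"
    "\<kappa> \<in> modes K \<Longrightarrow> n \<kappa> \<le> 4 * conv K (\<lambda>l. a l / rad l) (\<lambda>l. rad l * b l) \<kappa> + 2 * conv K a b \<kappa>"
  using assms unfolding transport_dominated_def by (simp_all del: split_paired_All)

section \<open>Bounds for transport-dominated terms\<close>

lemma transport_L2:
  assumes "transport_dominated K a b n"
  shows "hs K 0 n \<le> 4 * L2_set (conv K (\<lambda>l. a l / rad l) (\<lambda>l. rad l * b l)) (modes K)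
    + 2 * L2_set (conv K a b) (modes K)"
proof -
  note D = transport_dominatedD[OF assms]
  have "hs K 0 n \<le> L2_set (\<lambda>\<kappa>. 4 * conv K (\<lambda>l. a l / rad l) (\<lambda>l. rad l * b l) \<kappa> + 2 * conv K a b \<kappa>) (modes K)"
    unfolding hs_def using D by (intro L2_set_mono) auto
  also have "\<dots> \<le> L2_set (\<lambda>\<kappa>. 4 * conv K (\<lambda>l. a l / rad l) (\<lambda>l. rad l * b l) \<kappa>) (modes K)
      + L2_set (\<lambda>\<kappa>. 2 * conv K a b \<kappa>) (modes K)"
    by (rule L2_set_triangle_ineq)
  finally show ?thesis by (simp add: L2_set_cmult)
qed

lemma hs0: "hs K 0 a = L2_set a (modes K)" and hs1: "hs K 1 a = L2_set (\<lambda>\<kappa>. rad \<kappa> * a \<kappa>) (modes K)"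
  by (simp_all add: hs_def)

text \<open>The velocity is taken in the summable class, since division by \<open>rad\<close> turns
  an H1 bound into an H2 bound; the other convolution has two H1 factors. The generating vorticity
  and the transported function are distinct because the skew-symmetry argument transports the test
  function.\<close>

lemma transport_bilinear:
  assumes "transport_dominated K a b n"
  shows "hs K 0 n \<le> 6 * sqrt lattice_bound * (hs K 1 a * hs K 1 b)"
proof -
  note D = transport_dominatedD[OF assms]
  have "L2_set (conv K (\<lambda>l. a l / rad l) (\<lambda>l. rad l * b l)) (modes K)
      \<le> (\<Sum>l\<in>modes K. a l / rad l) * hs K 1 b"
    unfolding hs1 using D by (intro L2_conv_le)
  also have "\<dots> \<le> sqrt lattice_bound * hs K 1 a * hs K 1 b"
    using sum_le_hs[of "\<lambda>l. a l / rad l" K] hs_weight_divide[of a K 1] D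
    by (intro mult_right_mono) (auto simp: numeral_2_eq_2)
  finally show ?thesis using transport_L2[OF assms] L2_conv_le_hs[of a b K] D by (simp add: mult.assoc)
qed

text \<open>Both convolutions are of size A0^(5/4) A2^(3/4), and the eighth power makes all
  exponents integral. Agmon's inequality is applied to the velocity in one of them and to
  \<open>a\<close> in the other; A1^2 <= A0 A2 eliminates the middle order.\<close>

lemma transport_interpolated:
  assumes "transport_dominated K a a n"
  shows "hs K 0 n ^ 8 \<le> (6 ^ 8 * lattice_bound ^ 4) * (hs K 0 a ^ 10 * hs K 2 a ^ 6)"
proof -
  note D = transport_dominatedD[OF assms]
  define A0 A1 A2 L where "A0 = hs K 0 a" and "A1 = hs K 1 a" and "A2 = hs K 2 a" and "L = lattice_bound"
  define p q where "p = (\<Sum>l\<in>modes K. a l / rad l)" and "q = (\<Sum>l\<in>modes K. a l)"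
  have nn: "A0 \<ge> 0" "A1 \<ge> 0" "A2 \<ge> 0" "L \<ge> 0" "p \<ge> 0" "q \<ge> 0"
    unfolding A0_def A1_def A2_def L_def p_def q_def using D by (auto intro!: sum_nonneg)
  have i: "A1\<^sup>2 \<le> A0 * A2" using hs_interpolation_Suc[of K 0 a] by (simp add: A0_def A1_def A2_def numeral_2_eq_2)
  have p: "p\<^sup>2 \<le> L * (A0 * A1)"
    using sum_sq_le_hs[of "\<lambda>l. a l / rad l" K] hs_weight_divide[of a K 1] hs_weight_divide[of a K 0] D
    by (simp add: p_def L_def A0_def A1_def numeral_2_eq_2)
  have q: "q\<^sup>2 \<le> L * (A1 * A2)"
    using sum_sq_le_hs[of a K] D by (simp add: q_def L_def A1_def A2_def)
  have "(p * A1) ^ 8 = (p\<^sup>2) ^ 4 * A1 ^ 8" by (simp add: power_mult_distrib flip: power_mult)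
  also have "\<dots> \<le> (L * (A0 * A1)) ^ 4 * A1 ^ 8"
    using p nn by (intro mult_right_mono power_mono) auto
  also have "\<dots> = (L * A0) ^ 4 * (A1\<^sup>2) ^ 6" by (simp add: power_mult_distrib flip: power_mult power_add)
  also have "\<dots> \<le> (L * A0) ^ 4 * (A0 * A2) ^ 6"
    using i nn by (intro mult_left_mono power_mono) auto
  finally have 1: "(p * A1) ^ 8 \<le> L ^ 4 * (A0 ^ 10 * A2 ^ 6)"
    by (simp add: power_mult_distrib mult.assoc flip: power_add)
  have "(q * A0) ^ 8 = (q\<^sup>2) ^ 4 * A0 ^ 8" by (simp add: power_mult_distrib flip: power_mult)
  also have "\<dots> \<le> (L * (A1 * A2)) ^ 4 * A0 ^ 8"
    using q nn by (intro mult_right_mono power_mono) auto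
  also have "\<dots> = L ^ 4 * A2 ^ 4 * A0 ^ 8 * (A1\<^sup>2)\<^sup>2" by (simp add: power_mult_distrib flip: power_mult)
  also have "\<dots> \<le> L ^ 4 * A2 ^ 4 * A0 ^ 8 * (A0 * A2)\<^sup>2"
    using i nn by (intro mult_left_mono power_mono) auto
  also have "\<dots> = L ^ 4 * (A0 ^ 10 * A2 ^ 6)" by (simp add: power_mult_distrib eval_nat_numeral)
  finally have 2: "(q * A0) ^ 8 \<le> L ^ 4 * (A0 ^ 10 * A2 ^ 6)" .
  have "L2_set (conv K (\<lambda>l. a l / rad l) (\<lambda>l. rad l * a l)) (modes K) \<le> p * A1"
    unfolding p_def A1_def hs1 using D by (intro L2_conv_le)
  moreover have "L2_set (conv K a a) (modes K) \<le> q * A0"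
    unfolding q_def A0_def hs0 using D by (intro L2_conv_le)
  ultimately have "hs K 0 n \<le> 4 * (p * A1) + 2 * (q * A0)"
    using transport_L2[OF assms] by linarith
  also have "\<dots> \<le> 6 * max (p * A1) (q * A0)"
    using max.cobounded1[of "p * A1" "q * A0"] max.cobounded2[of "q * A0" "p * A1"] by linarith
  finally have "hs K 0 n ^ 8 \<le> (6 * max (p * A1) (q * A0)) ^ 8" by (intro power_mono) auto
  also have "\<dots> \<le> 6 ^ 8 * (L ^ 4 * (A0 ^ 10 * A2 ^ 6))"
    unfolding power_mult_distrib using 1 2 by (intro mult_left_mono) (auto simp: max_def)
  finally show ?thesis by (simp add: A0_def A1_def A2_def L_def mult.assoc)
qed

lemma power_add_le: "x \<ge> 0 \<Longrightarrow> y \<ge> 0 \<Longrightarrow> (x + y) ^ s \<le> 2 ^ s * (x ^ s + y ^ s)" for x y :: real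
proof -
  assume "x \<ge> 0" "y \<ge> 0"
  then have "(x + y) ^ s \<le> (2 * max x y) ^ s" by (intro power_mono) auto
  also have "\<dots> \<le> 2 ^ s * (x ^ s + y ^ s)"
    using \<open>x \<ge> 0\<close> \<open>y \<ge> 0\<close> by (auto simp: power_mult_distrib max_def)
  finally show ?thesis .
qed

text \<open>A substitute for the Leibniz rule: by the triangle inequality for frequencies the weight
  at \<open>\<kappa>\<close> falls on one of the two factors.\<close>

lemma rad_power_conv_le:
  assumes "\<And>l. a l \<ge> 0" "\<And>l. b l \<ge> 0" "\<kappa> \<in> modes K"
  shows "rad \<kappa> ^ s * conv K a b \<kappa>
    \<le> 2 ^ s * (conv K (\<lambda>l. rad l ^ s * a l) b \<kappa> + conv K a (\<lambda>l. rad l ^ s * b l) \<kappa>)"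
proof -
  have "rad \<kappa> ^ s * (a l * b (red K (\<kappa> - l)))
      \<le> 2 ^ s * (rad l ^ s * a l * b (red K (\<kappa> - l)) + a l * (rad (red K (\<kappa> - l)) ^ s * b (red K (\<kappa> - l))))" for l
  proof -
    have "rad \<kappa> ^ s \<le> (rad l + rad (red K (\<kappa> - l))) ^ s"
      using rad_triangle[OF assms(3)] by (intro power_mono) auto
    also have "\<dots> \<le> 2 ^ s * (rad l ^ s + rad (red K (\<kappa> - l)) ^ s)" by (rule power_add_le) auto
    finally have "rad \<kappa> ^ s * (a l * b (red K (\<kappa> - l)))
        \<le> 2 ^ s * (rad l ^ s + rad (red K (\<kappa> - l)) ^ s) * (a l * b (red K (\<kappa> - l)))"
      using assms by (intro mult_right_mono) auto
    then show ?thesis by (simp add: algebra_simps)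
  qed
  then show ?thesis unfolding conv_def sum_distrib_left sum.distrib[symmetric] by (intro sum_mono)
qed

text \<open>In each of the four convolutions one factor is made summable at the cost of two orders.
  The orders \<open>s\<close> and \<open>s + 1\<close> suffice because the velocity has gained one
  order and, \<open>s\<close> being positive, H1 and H2 lie below H^s and H^(s+1). The constant is
  12 = 4 + 4 + 2 + 2.\<close>

lemma transport_higher:
  assumes "transport_dominated K a a n" "s \<ge> 1"
  shows "hs K s n \<le> (12 * 2 ^ s * sqrt lattice_bound) * (hs K s a * hs K (Suc s) a)"
proof -
  note D = transport_dominatedD[OF assms(1)]
  let ?M = "modes K" and ?L = "sqrt lattice_bound"
  let ?c1 = "conv K (\<lambda>l. rad l ^ s * (a l / rad l)) (\<lambda>l. rad l * a l)"
  let ?c2 = "conv K (\<lambda>l. a l / rad l) (\<lambda>l. rad l ^ s * (rad l * a l))"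
  let ?c3 = "conv K (\<lambda>l. rad l ^ s * a l) a" and ?c4 = "conv K a (\<lambda>l. rad l ^ s * a l)"
  let ?P = "hs K s a * hs K (Suc s) a"
  have "rad \<kappa> ^ s * n \<kappa> \<le> 2 ^ s * ((4 * ?c1 \<kappa> + 4 * ?c2 \<kappa>) + (2 * ?c3 \<kappa> + 2 * ?c4 \<kappa>))" if "\<kappa> \<in> ?M" for \<kappa>
  proof -
    have "rad \<kappa> ^ s * n \<kappa> \<le> rad \<kappa> ^ s * (4 * conv K (\<lambda>l. a l / rad l) (\<lambda>l. rad l * a l) \<kappa> + 2 * conv K a a \<kappa>)"
      using D that by (intro mult_left_mono) auto
    then show ?thesis
      using rad_power_conv_le[of "\<lambda>l. a l / rad l" "\<lambda>l. rad l * a l" \<kappa> K s] rad_power_conv_le[of a a \<kappa> K s] D that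
      by (simp add: algebra_simps)
  qed
  then have "hs K s n \<le> L2_set (\<lambda>\<kappa>. 2 ^ s * ((4 * ?c1 \<kappa> + 4 * ?c2 \<kappa>) + (2 * ?c3 \<kappa> + 2 * ?c4 \<kappa>))) ?M"
    unfolding hs_def using D by (intro L2_set_mono) auto
  also have "\<dots> = 2 ^ s * L2_set (\<lambda>\<kappa>. (4 * ?c1 \<kappa> + 4 * ?c2 \<kappa>) + (2 * ?c3 \<kappa> + 2 * ?c4 \<kappa>)) ?M"
    by (simp add: L2_set_cmult)
  also have "\<dots> \<le> 2 ^ s * ((4 * L2_set ?c1 ?M + 4 * L2_set ?c2 ?M) + (2 * L2_set ?c3 ?M + 2 * L2_set ?c4 ?M))"
    unfolding L2_set_cmult[of 4, symmetric, simplified] L2_set_cmult[of 2, symmetric, simplified]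
    by (intro mult_left_mono order_trans[OF L2_set_triangle_ineq] add_mono L2_set_triangle_ineq) auto
  also have "\<dots> \<le> 2 ^ s * ((4 * (?L * ?P) + 4 * (?L * ?P)) + (2 * (?L * ?P) + 2 * (?L * ?P)))"
  proof (intro mult_left_mono add_mono)
    have m1: "hs K 1 a \<le> hs K s a" and m2: "hs K 2 a \<le> hs K (Suc s) a"
      using assms(2) by (auto intro: hs_mono_order)
    have "L2_set ?c1 ?M \<le> (\<Sum>l\<in>?M. rad l ^ s * (a l / rad l)) * hs K 1 a"
      unfolding hs1 using D by (intro L2_conv_le) auto
    also have "\<dots> \<le> (?L * hs K 2 (\<lambda>l. rad l ^ s * (a l / rad l))) * hs K s a"
      using D by (intro mult_mono m1 sum_le_hs sum_nonneg) auto
    also have "hs K 2 (\<lambda>l. rad l ^ s * (a l / rad l)) = hs K (Suc s) a"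
      using hs_weight_divide[of "\<lambda>l. rad l ^ s * a l" K 1] hs_weight_mult[of K 1 s a] D
      by (simp add: numeral_2_eq_2)
    finally show "L2_set ?c1 ?M \<le> ?L * ?P" by (simp add: mult_ac)
    have "L2_set ?c2 ?M \<le> (\<Sum>l\<in>?M. a l / rad l) * hs K (Suc s) a"
      unfolding hs_def using D L2_conv_le[of "\<lambda>l. a l / rad l" K "\<lambda>l. rad l ^ s * (rad l * a l)"]
      by (simp add: mult_ac)
    also have "\<dots> \<le> (?L * hs K 2 (\<lambda>l. a l / rad l)) * hs K (Suc s) a"
      using D by (intro mult_right_mono sum_le_hs) auto
    also have "\<dots> \<le> (?L * hs K s a) * hs K (Suc s) a"
      using hs_weight_divide[of a K 1] D m1 by (intro mult_right_mono mult_left_mono) (auto simp: numeral_2_eq_2)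
    finally show "L2_set ?c2 ?M \<le> ?L * ?P" by (simp add: mult_ac)
    have "L2_set ?c4 ?M \<le> (\<Sum>l\<in>?M. a l) * hs K s a"
      unfolding hs_def using D by (intro L2_conv_le)
    also have "\<dots> \<le> (?L * hs K (Suc s) a) * hs K s a"
      using D m2 by (intro mult_right_mono order_trans[OF sum_le_hs] mult_left_mono) auto
    finally show c4: "L2_set ?c4 ?M \<le> ?L * ?P" by (simp add: mult_ac)
    then show "L2_set ?c3 ?M \<le> ?L * ?P" by (subst conv_commute)
  qed auto
  finally show ?thesis by (simp add: mult_ac)
qed

section \<open>The discrete Fourier transform\<close>

lemma wave_add: "wave (\<kappa> + l) p = wave \<kappa> p * wave l p"
  by (simp add: wave_def cis_mult algebra_simps)

lemma wave_minus: "wave (- \<kappa>) p = cnj (wave \<kappa> p)"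
  by (simp add: wave_def cis_cnj algebra_simps)

lemma wave_diff: "wave (\<kappa> - l) p = wave \<kappa> p * cnj (wave l p)"
  using wave_add[of \<kappa> "- l" p] by (simp add: wave_minus)

lemma wave_0 [simp]: "wave 0 p = 1"
  by (simp add: wave_def)

lemma norm_wave [simp]: "cmod (wave \<kappa> p) = 1"
  by (simp add: wave_def)

lemma wave_node: "wave \<kappa> (node K i j) = cis (2 * pi * (of_int (fst \<kappa> * i + snd \<kappa> * j) * mesh K))"
  by (simp add: wave_def node_def algebra_simps)

lemma cis_mesh_cong:
  assumes "m mod npts K = m' mod npts K"
  shows "cis (2 * pi * (of_int m * mesh K)) = cis (2 * pi * (of_int m' * mesh K))"
proof -
  obtain q where q: "m = m' + npts K * q"
    using assms by (metis mod_eq_dvd_iff dvdE diff_add_cancel add.commute)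
  have N: "real_of_int (npts K) \<noteq> 0" using npts_pos[of K] by linarith
  have "2 * pi * (of_int m * mesh K) = 2 * pi * (of_int m' * mesh K) + 2 * pi * of_int q"
    using N by (simp add: q mesh_def field_simps)
  then show ?thesis by (simp flip: cis_mult)
qed

lemma wave_node_cong:
  assumes "fst \<kappa> mod npts K = fst \<kappa>' mod npts K" "snd \<kappa> mod npts K = snd \<kappa>' mod npts K"
    "i mod npts K = i' mod npts K" "j mod npts K = j' mod npts K"
  shows "wave \<kappa> (node K i j) = wave \<kappa>' (node K i' j')"
  unfolding wave_node by (intro cis_mesh_cong mod_add_cong mod_mult_cong assms)

lemma wave_red: "wave (red K \<kappa>) (node K i j) = wave \<kappa> (node K i j)"
  by (rule wave_node_cong) (auto simp: red_def redi_mod)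

lemma dft_red: "dft K f (red K \<kappa>) = dft K f \<kappa>"
  by (simp add: dft_def wave_red)

text \<open>Orthogonality is known for the centred range of indices; periodicity modulo
  \<open>npts K\<close> carries it over to the range of grid indices.\<close>

lemma sum_cis_grid:
  "(\<Sum>i\<in>{0..<npts K}. cis (2 * pi * (of_int (m * i) * mesh K))) = (if npts K dvd m then of_int (npts K) else 0)"
proof -
  have "(\<Sum>i\<in>{0..<npts K}. cis (2 * pi * (of_int (m * i) * mesh K)))
      = (\<Sum>k\<in>{- int K..int K}. cis (2 * pi * (of_int (m * k) * mesh K)))"
  proof (rule sum.reindex_bij_witness[of _ "\<lambda>k. k mod npts K" "redi K"])
    fix i assume "i \<in> {0..<npts K}"
    then show "redi K i mod npts K = i" by (simp add: redi_mod)
    show "redi K i \<in> {- int K..int K}" by (rule redi_range)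
    show "cis (2 * pi * (of_int (m * redi K i) * mesh K)) = cis (2 * pi * (of_int (m * i) * mesh K))"
      by (intro cis_mesh_cong mod_mult_cong redi_mod refl)
  next
    fix k assume k: "k \<in> {- int K..int K}"
    have "redi K (k mod npts K) = redi K k" by (rule redi_cong) simp
    then show "redi K (k mod npts K) = k" using k by (simp add: redi_id)
    show "k mod npts K \<in> {0..<npts K}" using npts_pos[of K] by simp
  qed
  also have "\<dots> = (\<Sum>k\<in>{- int K..int K}. cis (2 * pi * (of_int k * (of_int m * mesh K))))"
    by (simp add: mult_ac)
  finally show ?thesis by (simp only: sum_cis_modes)
qed

lemma npts_dvd_iff: "npts K dvd x \<longleftrightarrow> redi K x = 0"
proof -
  have "redi K x = 0 \<longleftrightarrow> x mod npts K = 0"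
    by (metis redi_mod mod_0 redi_cong[of x K 0] redi_id[of 0 K] atLeastAtMost_iff of_nat_0_le_iff neg_le_0_iff_le)
  then show ?thesis by (simp add: dvd_eq_mod_eq_0)
qed

lemma red_eq_0_iff: "red K \<kappa> = 0 \<longleftrightarrow> npts K dvd fst \<kappa> \<and> npts K dvd snd \<kappa>"
  by (simp add: red_def npts_dvd_iff zero_prod_def)

lemma sum_wave_grid:
  "(mesh K)\<^sup>2 * (\<Sum>i = 0..<npts K. \<Sum>j = 0..<npts K. wave \<kappa> (node K i j)) = (if red K \<kappa> = 0 then 1 else 0)"
proof -
  have N: "complex_of_int (npts K) \<noteq> 0" using npts_pos[of K] by simp
  have "(\<Sum>i = 0..<npts K. \<Sum>j = 0..<npts K. wave \<kappa> (node K i j))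
      = (\<Sum>i = 0..<npts K. cis (2 * pi * (of_int (fst \<kappa> * i) * mesh K)))
        * (\<Sum>j = 0..<npts K. cis (2 * pi * (of_int (snd \<kappa> * j) * mesh K)))"
    unfolding sum_product by (simp add: wave_node cis_mult algebra_simps)
  then show ?thesis using N
    by (simp only: sum_cis_grid red_eq_0_iff) (simp add: mesh_def power2_eq_square)
qed

lemma red_diff_eq_0_iff:
  assumes "\<kappa> \<in> modes K" "l \<in> modes K" shows "red K (\<kappa> - l) = 0 \<longleftrightarrow> \<kappa> = l"
  using red_add[of K "\<kappa> - l" l] assms by (auto simp: red_id)

section \<open>Trigonometric polynomials and their transform\<close>

definition csym :: "nat \<Rightarrow> (int \<times> int \<Rightarrow> complex) \<Rightarrow> bool" where
  "csym K c \<longleftrightarrow> (\<forall>\<kappa>\<in>modes K. c (- \<kappa>) = cnj (c \<kappa>))"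

text \<open>Common form of continuous extensions, Fourier projections and, at the nodes, discrete
  derivatives, so that all of them are handled through their coefficients. Under \<open>csym\<close>
  the sum is real and \<open>Re\<close> discards nothing.\<close>

definition trig :: "nat \<Rightarrow> (int \<times> int \<Rightarrow> complex) \<Rightarrow> real \<times> real \<Rightarrow> real" where
  "trig K c p = Re (\<Sum>\<kappa>\<in>modes K. c \<kappa> * wave \<kappa> p)"

lemma sum_modes_minus: "(\<Sum>\<kappa>\<in>modes K. F (- \<kappa>)) = sum F (modes K)"
  by (rule sum.reindex_bij_witness[of _ uminus uminus]) (auto simp: modes_minus)

lemma of_real_trig:
  assumes "csym K c"
  shows "of_real (trig K c p) = (\<Sum>\<kappa>\<in>modes K. c \<kappa> * wave \<kappa> p)"
proof -
  have "cnj (\<Sum>\<kappa>\<in>modes K. c \<kappa> * wave \<kappa> p) = (\<Sum>\<kappa>\<in>modes K. c (- \<kappa>) * wave (- \<kappa>) p)"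
    using assms by (simp add: csym_def wave_minus)
  also have "\<dots> = (\<Sum>\<kappa>\<in>modes K. c \<kappa> * wave \<kappa> p)" by (rule sum_modes_minus)
  finally show ?thesis unfolding trig_def by (intro of_real_Re) (simp only: Reals_cnj_iff)
qed

lemma csym_dft [simp]: "csym K (dft K f)"
  by (simp add: csym_def dft_def wave_minus)

lemma grid_fun_trig: "grid_fun K (\<lambda>i j. trig K c (node K i j))"
proof -
  have "wave \<kappa> (node K (i + npts K) j) = wave \<kappa> (node K i j)" "wave \<kappa> (node K i (j + npts K)) = wave \<kappa> (node K i j)"
    for \<kappa> i j by (auto intro!: wave_node_cong)
  then show ?thesis by (simp add: grid_fun_def trig_def)
qed

lemma dft_trig:
  assumes "csym K c" "\<kappa> \<in> modes K"
  shows "dft K (\<lambda>i j. trig K c (node K i j)) \<kappa> = c \<kappa>"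
proof -
  have "dft K (\<lambda>i j. trig K c (node K i j)) \<kappa>
      = (mesh K)\<^sup>2 * (\<Sum>i = 0..<npts K. \<Sum>j = 0..<npts K. \<Sum>l\<in>modes K. c l * wave (l - \<kappa>) (node K i j))"
    by (simp add: dft_def of_real_trig[OF assms(1)] sum_distrib_right wave_diff mult.assoc)
  also have "\<dots> = (\<Sum>l\<in>modes K. c l * ((mesh K)\<^sup>2 * (\<Sum>i = 0..<npts K. \<Sum>j = 0..<npts K. wave (l - \<kappa>) (node K i j))))"
    by (simp add: sum_distrib_left sum.swap[of _ "modes K"] mult_ac)
  also have "\<dots> = (\<Sum>l\<in>modes K. if l = \<kappa> then c l else 0)"
    unfolding sum_wave_grid by (intro sum.cong refl) (simp add: red_diff_eq_0_iff assms)
  also have "\<dots> = c \<kappa>" using assms by (simp add: sum.delta)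
  finally show ?thesis .
qed

lemma DNx_trig: "DNx K f = (\<lambda>i j. trig K (\<lambda>\<kappa>. (2 * pi * \<i> * of_int (fst \<kappa>)) * dft K f \<kappa>) (node K i j))"
  and DNy_trig: "DNy K f = (\<lambda>i j. trig K (\<lambda>\<kappa>. (2 * pi * \<i> * of_int (snd \<kappa>)) * dft K f \<kappa>) (node K i j))"
  by (simp_all add: DNx_def DNy_def trig_def)

lemma csym_diff:
  assumes "csym K c"
  shows "csym K (\<lambda>\<kappa>. (2 * pi * \<i> * of_int (fst \<kappa>)) * c \<kappa>)" "csym K (\<lambda>\<kappa>. (2 * pi * \<i> * of_int (snd \<kappa>)) * c \<kappa>)"
  using assms by (simp_all add: csym_def)

lemma grid_fun_DN [simp]: "grid_fun K (DNx K f)" "grid_fun K (DNy K f)"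
  by (simp_all only: DNx_trig DNy_trig grid_fun_trig)

lemma dft_DN:
  assumes "\<kappa> \<in> modes K"
  shows "dft K (DNx K f) \<kappa> = (2 * pi * \<i> * of_int (fst \<kappa>)) * dft K f \<kappa>"
    "dft K (DNy K f) \<kappa> = (2 * pi * \<i> * of_int (snd \<kappa>)) * dft K f \<kappa>"
  unfolding DNx_trig DNy_trig by (intro dft_trig csym_diff csym_dft assms)+

lemma dft_add: "dft K (\<lambda>i j. f i j + g i j) \<kappa> = dft K f \<kappa> + dft K g \<kappa>"
  by (simp add: dft_def sum.distrib distrib_left distrib_right)

lemma dft_cmult: "dft K (\<lambda>i j. c * f i j) \<kappa> = of_real c * dft K f \<kappa>"
  by (simp add: dft_def sum_distrib_left mult_ac)

lemma dft_minus: "dft K (\<lambda>i j. - f i j) \<kappa> = - dft K f \<kappa>"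
  using dft_cmult[of K "-1" f \<kappa>] by simp

lemma dft_diff: "dft K (\<lambda>i j. f i j - g i j) \<kappa> = dft K f \<kappa> - dft K g \<kappa>"
  using dft_add[of K f "\<lambda>i j. - g i j" \<kappa>] by (simp add: dft_minus)

lemma dft_divide: "dft K (\<lambda>i j. f i j / c) \<kappa> = dft K f \<kappa> / of_real c"
  using dft_cmult[of K "inverse c" f \<kappa>] by (simp add: divide_inverse mult.commute)

lemma dft_const: "dft K (\<lambda>i j. c) \<kappa> = (if red K \<kappa> = 0 then of_real c else 0)"
proof -
  have "dft K (\<lambda>i j. c) \<kappa> = of_real c * ((mesh K)\<^sup>2 * (\<Sum>i = 0..<npts K. \<Sum>j = 0..<npts K. wave (- \<kappa>) (node K i j)))"
    by (simp add: dft_def sum_distrib_left wave_minus mult_ac)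
  moreover have "red K (- \<kappa>) = 0 \<longleftrightarrow> red K \<kappa> = 0" by (simp add: red_eq_0_iff)
  ultimately show ?thesis by (simp only: sum_wave_grid) simp
qed

lemma dft_lapN:
  assumes "\<kappa> \<in> modes K"
  shows "dft K (lapN K f) \<kappa> = - of_real ((rad \<kappa>)\<^sup>2) * dft K f \<kappa>"
  unfolding lapN_def dft_add dft_DN[OF assms] rad_sq
  by (simp add: algebra_simps power2_eq_square)

lemma avgN_dft: "of_real (avgN K f) = dft K f 0"
  by (simp add: avgN_def innerN_def dft_def)

text \<open>Aliasing appears as the reduction of \<open>\<kappa> - l\<close>: on the grid a wave
  depends only on its frequency modulo \<open>npts K\<close>.\<close>

lemma dft_mult:
  assumes "grid_fun K f"
  shows "dft K (\<lambda>i j. f i j * g i j) \<kappa> = (\<Sum>l\<in>modes K. dft K f l * dft K g (red K (\<kappa> - l)))"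
proof -
  have e: "of_real (f i j * g i j) * cnj (wave \<kappa> (node K i j))
      = (\<Sum>l\<in>modes K. dft K f l * (of_real (g i j) * cnj (wave (\<kappa> - l) (node K i j))))" for i j
    unfolding of_real_mult dft_expansion[OF assms, of i j] sum_distrib_right by (simp add: wave_diff mult_ac)
  have "dft K (\<lambda>i j. f i j * g i j) \<kappa>
      = (mesh K)\<^sup>2 * (\<Sum>i = 0..<npts K. \<Sum>j = 0..<npts K. \<Sum>l\<in>modes K. dft K f l * (of_real (g i j) * cnj (wave (\<kappa> - l) (node K i j))))"
    unfolding dft_def[of K "\<lambda>i j. f i j * g i j"] e ..
  also have "\<dots> = (\<Sum>l\<in>modes K. dft K f l * ((mesh K)\<^sup>2 * (\<Sum>i = 0..<npts K. \<Sum>j = 0..<npts K. of_real (g i j) * cnj (wave (\<kappa> - l) (node K i j)))))"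
    by (simp add: sum_distrib_left sum.swap[of _ "modes K"] mult_ac)
  also have "\<dots> = (\<Sum>l\<in>modes K. dft K f l * dft K g (red K (\<kappa> - l)))"
    by (simp only: dft_red) (simp add: dft_def)
  finally show ?thesis .
qed

lemma norm_dft_mult_le:
  assumes "grid_fun K f"
    and "\<And>l. l \<in> modes K \<Longrightarrow> cmod (dft K f l) \<le> a l" "\<And>l. l \<in> modes K \<Longrightarrow> cmod (dft K g l) \<le> b l"
  shows "cmod (dft K (\<lambda>i j. f i j * g i j) \<kappa>) \<le> conv K a b \<kappa>"
  unfolding dft_mult[OF assms(1)] conv_def
  by (rule sum_norm_le) (auto simp: norm_mult intro!: mult_mono assms(2,3) order_trans[OF norm_ge_zero assms(2)])

lemma parseval:
  assumes "grid_fun K f"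
  shows "innerN K f g = Re (\<Sum>\<kappa>\<in>modes K. dft K f \<kappa> * cnj (dft K g \<kappa>))"
proof -
  have e: "of_real (f i j * g i j) = (\<Sum>\<kappa>\<in>modes K. dft K f \<kappa> * (of_real (g i j) * wave \<kappa> (node K i j)))" for i j
    unfolding of_real_mult dft_expansion[OF assms, of i j] sum_distrib_right by (simp add: mult_ac)
  have "of_real (innerN K f g) = (mesh K)\<^sup>2 * (\<Sum>i = 0..<npts K. \<Sum>j = 0..<npts K. \<Sum>\<kappa>\<in>modes K. dft K f \<kappa> * (of_real (g i j) * wave \<kappa> (node K i j)))"
    unfolding innerN_def of_real_mult[of "(mesh K)\<^sup>2"] of_real_sum e ..
  also have "\<dots> = (\<Sum>\<kappa>\<in>modes K. dft K f \<kappa> * ((mesh K)\<^sup>2 * (\<Sum>i = 0..<npts K. \<Sum>j = 0..<npts K. of_real (g i j) * wave \<kappa> (node K i j))))"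
    by (simp add: sum_distrib_left sum.swap[of _ "modes K"] mult_ac)
  also have "\<dots> = (\<Sum>\<kappa>\<in>modes K. dft K f \<kappa> * cnj (dft K g \<kappa>))"
    by (simp add: dft_def)
  finally show ?thesis by (metis Re_complex_of_real)
qed

section \<open>Skew-symmetry and domination of the discrete nonlinear term\<close>

lemma innerN_DN_skew:
  assumes "grid_fun K f" "grid_fun K g"
  shows "innerN K (DNx K f) g = - innerN K f (DNx K g)" "innerN K (DNy K f) g = - innerN K f (DNy K g)"
proof -
  have "innerN K (DNx K f) g = Re (\<Sum>\<kappa>\<in>modes K. - (dft K f \<kappa> * cnj (dft K (DNx K g) \<kappa>)))"
    unfolding parseval[OF grid_fun_DN(1)] by (intro arg_cong[where f = Re] sum.cong refl) (simp add: dft_DN)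
  then show "innerN K (DNx K f) g = - innerN K f (DNx K g)"
    by (simp add: parseval assms sum_negf)
  have "innerN K (DNy K f) g = Re (\<Sum>\<kappa>\<in>modes K. - (dft K f \<kappa> * cnj (dft K (DNy K g) \<kappa>)))"
    unfolding parseval[OF grid_fun_DN(2)] by (intro arg_cong[where f = Re] sum.cong refl) (simp add: dft_DN)
  then show "innerN K (DNy K f) g = - innerN K f (DNy K g)"
    by (simp add: parseval assms sum_negf)
qed

lemma grid_fun_mult: "grid_fun K f \<Longrightarrow> grid_fun K g \<Longrightarrow> grid_fun K (\<lambda>i j. f i j * g i j)"
  by (simp add: grid_fun_def)

lemma innerN_add_left: "innerN K (\<lambda>i j. f i j + g i j) h = innerN K f h + innerN K g h"
  by (simp add: innerN_def sum.distrib distrib_left distrib_right)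

lemma innerN_diff_left: "innerN K (\<lambda>i j. f i j - g i j) h = innerN K f h - innerN K g h"
  by (simp add: innerN_def sum_subtractf right_diff_distrib left_diff_distrib)

lemma innerN_diff_right: "innerN K h (\<lambda>i j. f i j - g i j) = innerN K h f - innerN K h g"
  by (simp add: innerN_def sum_subtractf right_diff_distrib)

lemma innerN_const_left: "innerN K (\<lambda>i j. c) h = c * avgN K h"
  by (simp add: innerN_def avgN_def sum_distrib_left mult_ac)

text \<open>Aliasing destroys the product rule, so skew-symmetry rests on the split form of the
  nonlinear term: with \<open>A f g\<close> the pairing of \<open>u g\<close> with the gradient of
  \<open>f\<close>, the advective half gives \<open>A f g\<close> and, by summation by parts, the
  conservative half gives \<open>- A g f\<close>. The subtracted average is orthogonal to functions
  of zero mean.\<close>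

lemma nonlin_skew:
  assumes "grid_fun K (fst u)" "grid_fun K (snd u)" "grid_fun K f" "grid_fun K g" "avgN K f = 0" "avgN K g = 0"
  shows "innerN K (nonlin K u f) g = - innerN K (nonlin K u g) f"
proof -
  define A where "A = (\<lambda>f g. innerN K (\<lambda>i j. fst u i j * g i j) (DNx K f) + innerN K (\<lambda>i j. snd u i j * g i j) (DNy K f))"
  have "innerN K (nonlin K u f) g = A f g - A g f" if "grid_fun K f" "grid_fun K g" "avgN K g = 0" for f g
  proof -
    have "innerN K (advect K u f) g = A f g"
      by (simp add: advect_def A_def innerN_def sum.distrib distrib_left distrib_right mult_ac)
    moreover have "innerN K (divN K (\<lambda>k l. fst u k l * f k l, \<lambda>k l. snd u k l * f k l)) g = - A g f"
      using innerN_DN_skew[of K "\<lambda>k l. fst u k l * f k l" g] innerN_DN_skew[of K "\<lambda>k l. snd u k l * f k l" g] that assms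
      by (simp add: divN_def A_def innerN_add_left grid_fun_mult)
    ultimately show ?thesis
      by (simp add: nonlin_def innerN_add_left innerN_diff_left innerN_const_left that)
  qed
  then show ?thesis using assms by simp
qed

lemma abs_int_le_rad: "2 * pi * \<bar>real_of_int (fst \<kappa>)\<bar> \<le> rad \<kappa>" "2 * pi * \<bar>real_of_int (snd \<kappa>)\<bar> \<le> rad \<kappa>"
  using norm_fst_le[of "real_of_int (fst \<kappa>)" "real_of_int (snd \<kappa>)"]
    norm_snd_le[of "real_of_int (snd \<kappa>)" "real_of_int (fst \<kappa>)"]
  by (simp_all add: rad_def)

lemma norm_dft_DN_le:
  assumes "\<kappa> \<in> modes K"
  shows "cmod (dft K (DNx K f) \<kappa>) \<le> rad \<kappa> * cmod (dft K f \<kappa>)" "cmod (dft K (DNy K f) \<kappa>) \<le> rad \<kappa> * cmod (dft K f \<kappa>)"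
  using abs_int_le_rad[of \<kappa>] assms by (simp_all add: dft_DN norm_mult mult_right_mono)

lemma kinematic_dft:
  assumes "kinematic K w psi u" "\<kappa> \<in> modes K"
  shows "dft K w \<kappa> = of_real ((rad \<kappa>)\<^sup>2) * dft K psi \<kappa>"
proof -
  have "w = (\<lambda>i j. - lapN K psi i j)" using assms by (simp add: kinematic_def fun_eq_iff)
  then show ?thesis by (simp add: dft_minus dft_lapN assms)
qed

lemma kinematic_dft_0: "kinematic K w psi u \<Longrightarrow> dft K w 0 = 0"
  using kinematic_dft[of K w psi u 0] by simp

text \<open>The stream function coefficient is that of the vorticity over the square of
  \<open>rad\<close>, and the velocity costs one factor \<open>rad\<close>. At the zero mode both
  sides of the bounds vanish, the quotient by convention.\<close>

lemma kinematic_velocity: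
  assumes "kinematic K w psi u"
  shows "grid_fun K (fst u)" "grid_fun K (snd u)"
    and "\<kappa> \<in> modes K \<Longrightarrow> cmod (dft K (fst u) \<kappa>) \<le> cmod (dft K w \<kappa>) / rad \<kappa>"
    and "\<kappa> \<in> modes K \<Longrightarrow> cmod (dft K (snd u) \<kappa>) \<le> cmod (dft K w \<kappa>) / rad \<kappa>"
proof -
  have u: "u = (DNy K psi, \<lambda>i j. - DNx K psi i j)" using assms by (simp add: kinematic_def perpN_def)
  show "grid_fun K (fst u)" "grid_fun K (snd u)"
    using grid_fun_DN[of K psi] by (simp_all add: u grid_fun_def)
  assume k: "\<kappa> \<in> modes K"
  have e: "cmod (dft K w \<kappa>) / rad \<kappa> = rad \<kappa> * cmod (dft K psi \<kappa>)"
    by (simp add: kinematic_dft[OF assms k] norm_mult norm_power power2_eq_square)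
  show "cmod (dft K (fst u) \<kappa>) \<le> cmod (dft K w \<kappa>) / rad \<kappa>" "cmod (dft K (snd u) \<kappa>) \<le> cmod (dft K w \<kappa>) / rad \<kappa>"
    unfolding e using norm_dft_DN_le[OF k, of psi] by (simp_all add: u dft_minus)
qed

lemma rad_conv_le:
  assumes "\<And>l. a l \<ge> 0" "\<And>l. b l \<ge> 0" "\<kappa> \<in> modes K"
  shows "rad \<kappa> * conv K a b \<kappa> \<le> conv K (\<lambda>l. rad l * a l) b \<kappa> + conv K a (\<lambda>l. rad l * b l) \<kappa>"
proof -
  have "rad \<kappa> * (a l * b (red K (\<kappa> - l)))
      \<le> rad l * a l * b (red K (\<kappa> - l)) + a l * (rad (red K (\<kappa> - l)) * b (red K (\<kappa> - l)))" for l
    using mult_right_mono[OF rad_triangle[OF assms(3), of l], of "a l * b (red K (\<kappa> - l))"] assms(1)[of l] assms(2)[of "red K (\<kappa> - l)"]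
    by (simp add: algebra_simps)
  then show ?thesis unfolding conv_def sum_distrib_left sum.distrib[symmetric] by (intro sum_mono)
qed

text \<open>Each of the two advective products contributes one convolution of velocity and gradient.
  Each of the two products under the divergence carries a factor \<open>rad \<kappa>\<close>, which
  splits into one more such convolution and one of \<open>a\<close> with \<open>b\<close>. Hence the
  constants 4 and 2.\<close>

lemma nonlin_transport_dominated:
  assumes kin: "kinematic K w psi u" and g: "dft K g 0 = 0" "grid_fun K g"
  shows "transport_dominated K (\<lambda>\<kappa>. cmod (dft K w \<kappa>)) (\<lambda>\<kappa>. cmod (dft K g \<kappa>)) (\<lambda>\<kappa>. cmod (dft K (nonlin K u g) \<kappa>))"
proof -
  define a b where "a = (\<lambda>\<kappa>. cmod (dft K w \<kappa>))" and "b = (\<lambda>\<kappa>. cmod (dft K g \<kappa>))"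
  note kv = kinematic_velocity[OF kin]
  let ?c = "conv K (\<lambda>l. a l / rad l) (\<lambda>l. rad l * b l)"
  have "cmod (dft K (nonlin K u g) \<kappa>) \<le> 4 * ?c \<kappa> + 2 * conv K a b \<kappa>" if k: "\<kappa> \<in> modes K" for \<kappa>
  proof -
    let ?ad = "dft K (advect K u g) \<kappa>"
    let ?dv = "dft K (divN K (\<lambda>k l. fst u k l * g k l, \<lambda>k l. snd u k l * g k l)) \<kappa>"
    \<comment> \<open>The average only cancels the advective part at the zero mode, so it does not
      enlarge the bound.\<close>
    have "dft K (nonlin K u g) \<kappa> = ?ad + ?dv - (if \<kappa> = 0 then ?ad else 0)"
      using k by (auto simp: nonlin_def dft_diff dft_add dft_const red_id avgN_dft)
    then have 1: "cmod (dft K (nonlin K u g) \<kappa>) \<le> cmod ?ad + cmod ?dv"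
      by (auto intro: norm_triangle_ineq)
    have "cmod ?ad \<le> ?c \<kappa> + ?c \<kappa>"
      unfolding advect_def dft_add
      by (intro order_trans[OF norm_triangle_ineq] add_mono norm_dft_mult_le kv)
        (auto simp: a_def b_def intro: kv norm_dft_DN_le)
    moreover have "cmod ?dv \<le> 2 * (rad \<kappa> * conv K (\<lambda>l. a l / rad l) b \<kappa>)"
    proof -
      have "cmod (dft K (\<lambda>k l. fst u k l * g k l) \<kappa>) \<le> conv K (\<lambda>l. a l / rad l) b \<kappa>"
        "cmod (dft K (\<lambda>k l. snd u k l * g k l) \<kappa>) \<le> conv K (\<lambda>l. a l / rad l) b \<kappa>"
        by (intro norm_dft_mult_le kv; auto simp: a_def b_def intro: kv)+
      then have "rad \<kappa> * cmod (dft K (\<lambda>k l. fst u k l * g k l) \<kappa>) + rad \<kappa> * cmod (dft K (\<lambda>k l. snd u k l * g k l) \<kappa>)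
          \<le> rad \<kappa> * conv K (\<lambda>l. a l / rad l) b \<kappa> + rad \<kappa> * conv K (\<lambda>l. a l / rad l) b \<kappa>"
        by (intro add_mono mult_left_mono) auto
      moreover have "cmod ?dv \<le> rad \<kappa> * cmod (dft K (\<lambda>k l. fst u k l * g k l) \<kappa>) + rad \<kappa> * cmod (dft K (\<lambda>k l. snd u k l * g k l) \<kappa>)"
        unfolding divN_def dft_add fst_conv snd_conv
        by (intro order_trans[OF norm_triangle_ineq] add_mono norm_dft_DN_le k)
      ultimately show ?thesis by linarith
    qed
    moreover have "rad \<kappa> * conv K (\<lambda>l. a l / rad l) b \<kappa> \<le> conv K a b \<kappa> + ?c \<kappa>"
    proof -
      have "(\<lambda>l. rad l * (a l / rad l)) = a"
        using kinematic_dft_0[OF kin] by (auto simp: a_def fun_eq_iff)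
      then show ?thesis using rad_conv_le[of "\<lambda>l. a l / rad l" b \<kappa> K] k by (simp add: a_def b_def)
    qed
    ultimately show ?thesis using 1 by linarith
  qed
  then show ?thesis
    using g kinematic_dft_0[OF kin] by (simp add: transport_dominated_def a_def b_def)
qed

section \<open>Trigonometric polynomials on the unit square\<close>

lemma continuous_on_wave [continuous_intros]: "continuous_on S (wave \<kappa>)"
proof -
  have "wave \<kappa> = (\<lambda>p. cis (2 * pi * (of_int (fst \<kappa>) * fst p + of_int (snd \<kappa>) * snd p)))"
    by (simp add: wave_def fun_eq_iff)
  then show ?thesis by (auto intro!: continuous_intros)
qed

lemma integrable_continuous_Omega:
  fixes f :: "real \<times> real \<Rightarrow> 'a::euclidean_space"
  assumes "continuous_on UNIV f" shows "integrable (lebesgue_on Omega) f"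
  unfolding Omega_def by (rule continuous_imp_integrable) (rule continuous_on_subset[OF assms], simp)

lemma integral_cis_multiple:
  fixes k :: int
  shows "integral (cbox 0 1) (\<lambda>x. cis (2 * pi * (of_int k * x))) = (if k = 0 then 1 else 0)"
proof (cases "k = 0")
  case True then show ?thesis by simp
next
  case False
  define w where "w = 2 * pi * real_of_int k"
  have w: "w \<noteq> 0" using False by (simp add: w_def)
  have "((\<lambda>x. cis (w * x)) has_integral (- \<i> / w * cis (w * 1) - (- \<i> / w * cis (w * 0)))) {0..1}"
  proof (rule fundamental_theorem_of_calculus)
    fix x :: real assume "x \<in> {0..1}"
    show "((\<lambda>x. - \<i> / w * cis (w * x)) has_vector_derivative cis (w * x)) (at x within {0..1})"
      unfolding has_vector_derivative_complex_iff using w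
      by (auto intro!: derivative_eq_intros simp: Re_divide Im_divide power2_eq_square)
  qed simp
  moreover have "cis w = 1"
    using cis_multiple_2pi[of "of_int k"] by (simp add: w_def)
  ultimately have "((\<lambda>x. cis (w * x)) has_integral 0) {0..1}" by simp
  then have "integral (cbox 0 1) (\<lambda>x. cis (w * x)) = 0" by (simp add: integral_unique)
  then show ?thesis using False by (simp add: w_def mult.assoc)
qed

lemma integral_wave: "integral\<^sup>L (lebesgue_on Omega) (wave \<kappa>) = (if \<kappa> = 0 then 1 else 0)"
proof -
  let ?e = "\<lambda>k x. cis (2 * pi * (of_int k * x)) :: complex"
  have w: "wave \<kappa> (x, y) = ?e (fst \<kappa>) x * ?e (snd \<kappa>) y" for x y
    by (simp add: wave_def cis_mult algebra_simps)
  have "integral\<^sup>L (lebesgue_on Omega) (wave \<kappa>) = integral Omega (wave \<kappa>)"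
    by (intro lebesgue_integral_eq_integral integrable_continuous_Omega continuous_on_wave) (simp add: Omega_def)
  also have "\<dots> = integral (cbox 0 1) (\<lambda>x. integral (cbox 0 1) (\<lambda>y. wave \<kappa> (x, y)))"
    unfolding Omega_def by (intro integral_prod_continuous continuous_on_wave)
  also have "\<dots> = integral (cbox 0 1) (?e (fst \<kappa>)) * integral (cbox 0 1) (?e (snd \<kappa>))"
    unfolding w by simp
  finally show ?thesis unfolding integral_cis_multiple by (auto simp: zero_prod_def prod_eq_iff)
qed

lemma integrable_mult_wave:
  fixes f :: "real \<times> real \<Rightarrow> real"
  assumes "integrable (lebesgue_on Omega) f"
  shows "integrable (lebesgue_on Omega) (\<lambda>p. of_real (f p) * wave \<kappa> p)"
    "integrable (lebesgue_on Omega) (\<lambda>p. of_real (f p) * cnj (wave \<kappa> p))"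
proof -
  have m: "wave \<kappa> \<in> borel_measurable (lebesgue_on Omega)" for \<kappa>
    using integrable_continuous_Omega[OF continuous_on_wave] by (rule borel_measurable_integrable)
  have 1: "integrable (lebesgue_on Omega) (\<lambda>p. of_real (f p) * wave \<kappa> p)" for \<kappa>
  proof (rule Bochner_Integration.integrable_bound[OF assms])
    have "f \<in> borel_measurable (lebesgue_on Omega)" using assms by (rule borel_measurable_integrable)
    with m show "(\<lambda>p. of_real (f p) * wave \<kappa> p) \<in> borel_measurable (lebesgue_on Omega)"
      by measurable
  qed (simp add: norm_mult)
  show "integrable (lebesgue_on Omega) (\<lambda>p. of_real (f p) * wave \<kappa> p)" by (rule 1)
  show "integrable (lebesgue_on Omega) (\<lambda>p. of_real (f p) * cnj (wave \<kappa> p))"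
    using 1[of "- \<kappa>"] by (simp add: wave_minus)
qed

lemma fourier_minus: "fourier f (- \<kappa>) = cnj (fourier f \<kappa>)"
  unfolding fourier_def Bochner_Integration.integral_cnj[symmetric] by (simp add: wave_minus)

lemma csym_fourier [simp]: "csym K (fourier f)"
  by (simp add: csym_def fourier_minus)

lemma continuous_on_trig: "continuous_on S (trig K c)"
proof -
  have "trig K c = (\<lambda>p. Re (\<Sum>\<kappa>\<in>modes K. c \<kappa> * wave \<kappa> p))" by (simp add: trig_def fun_eq_iff)
  then show ?thesis by (auto intro!: continuous_intros)
qed

lemma integral_mult_trig:
  assumes "integrable (lebesgue_on Omega) f"
  shows "integral\<^sup>L (lebesgue_on Omega) (\<lambda>p. f p * trig K c p) = Re (\<Sum>\<kappa>\<in>modes K. c \<kappa> * cnj (fourier f \<kappa>))"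
    and "integrable (lebesgue_on Omega) (\<lambda>p. f p * trig K c p)"
proof -
  have e: "f p * trig K c p = Re (\<Sum>\<kappa>\<in>modes K. c \<kappa> * (of_real (f p) * wave \<kappa> p))" for p
  proof -
    have "f p * trig K c p = Re (of_real (f p) * (\<Sum>\<kappa>\<in>modes K. c \<kappa> * wave \<kappa> p))" by (simp add: trig_def)
    then show ?thesis by (simp only: sum_distrib_left mult.left_commute)
  qed
  have i: "integrable (lebesgue_on Omega) (\<lambda>p. \<Sum>\<kappa>\<in>modes K. c \<kappa> * (of_real (f p) * wave \<kappa> p))"
    using integrable_mult_wave[OF assms] by auto
  show "integrable (lebesgue_on Omega) (\<lambda>p. f p * trig K c p)"
    unfolding e using i by (rule integrable_Re)
  have "integral\<^sup>L (lebesgue_on Omega) (\<lambda>p. f p * trig K c p)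
      = Re (integral\<^sup>L (lebesgue_on Omega) (\<lambda>p. \<Sum>\<kappa>\<in>modes K. c \<kappa> * (of_real (f p) * wave \<kappa> p)))"
    unfolding e using i by (rule integral_Re)
  also have "integral\<^sup>L (lebesgue_on Omega) (\<lambda>p. \<Sum>\<kappa>\<in>modes K. c \<kappa> * (of_real (f p) * wave \<kappa> p))
      = (\<Sum>\<kappa>\<in>modes K. c \<kappa> * integral\<^sup>L (lebesgue_on Omega) (\<lambda>p. of_real (f p) * wave \<kappa> p))"
    using integrable_mult_wave[OF assms] by simp
  also have "\<dots> = (\<Sum>\<kappa>\<in>modes K. c \<kappa> * cnj (fourier f \<kappa>))"
    unfolding fourier_def Bochner_Integration.integral_cnj[symmetric] by simp
  finally show "integral\<^sup>L (lebesgue_on Omega) (\<lambda>p. f p * trig K c p) = Re (\<Sum>\<kappa>\<in>modes K. c \<kappa> * cnj (fourier f \<kappa>))" .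
qed

lemma fourier_trig:
  assumes "csym K c"
  shows "fourier (trig K c) \<kappa> = (if \<kappa> \<in> modes K then c \<kappa> else 0)"
proof -
  have "fourier (trig K c) \<kappa> = integral\<^sup>L (lebesgue_on Omega) (\<lambda>p. \<Sum>l\<in>modes K. c l * wave (l - \<kappa>) p)"
    unfolding fourier_def of_real_trig[OF assms] by (simp add: sum_distrib_right wave_diff mult.assoc)
  also have "\<dots> = (\<Sum>l\<in>modes K. c l * (if l = \<kappa> then 1 else 0))"
    using integrable_continuous_Omega[OF continuous_on_wave] by (simp add: integral_wave)
  also have "\<dots> = (if \<kappa> \<in> modes K then c \<kappa> else 0)"
    by (simp add: sum.delta if_distrib cong: if_cong)
  finally show ?thesis .
qed

lemma integral_trig_sq:
  assumes "csym K c"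
  shows "integral\<^sup>L (lebesgue_on Omega) (\<lambda>p. (trig K c p)\<^sup>2) = (\<Sum>\<kappa>\<in>modes K. (cmod (c \<kappa>))\<^sup>2)"
proof -
  have "integral\<^sup>L (lebesgue_on Omega) (\<lambda>p. trig K c p * trig K c p) = Re (\<Sum>\<kappa>\<in>modes K. c \<kappa> * cnj (fourier (trig K c) \<kappa>))"
    by (intro integral_mult_trig integrable_continuous_Omega continuous_on_trig)
  also have "\<dots> = (\<Sum>\<kappa>\<in>modes K. (cmod (c \<kappa>))\<^sup>2)"
    by (simp add: fourier_trig[OF assms] complex_mult_cnj cmod_power2 flip: power2_eq_square)
  finally show ?thesis by (simp add: power2_eq_square)
qed

section \<open>Derivatives of trigonometric polynomials\<close>

lemma dx_trig: "dx (trig K c) = trig K (\<lambda>\<kappa>. (2 * pi * \<i> * of_int (fst \<kappa>)) * c \<kappa>)"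
proof (rule ext, clarify)
  fix x y
  have "((\<lambda>r. \<Sum>\<kappa>\<in>modes K. Re (c \<kappa> * wave \<kappa> (r, y))) has_field_derivative
      (\<Sum>\<kappa>\<in>modes K. Re ((2 * pi * \<i> * of_int (fst \<kappa>)) * c \<kappa> * wave \<kappa> (x, y)))) (at x)"
    by (rule DERIV_sum) (auto simp: wave_def algebra_simps intro!: derivative_eq_intros)
  then have "deriv (\<lambda>r. trig K c (r, y)) x = trig K (\<lambda>\<kappa>. (2 * pi * \<i> * of_int (fst \<kappa>)) * c \<kappa>) (x, y)"
    unfolding trig_def Re_sum by (rule DERIV_imp_deriv)
  then show "dx (trig K c) (x, y) = trig K (\<lambda>\<kappa>. (2 * pi * \<i> * of_int (fst \<kappa>)) * c \<kappa>) (x, y)"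
    by (simp only: dx_def prod.case)
qed

lemma dy_trig: "dy (trig K c) = trig K (\<lambda>\<kappa>. (2 * pi * \<i> * of_int (snd \<kappa>)) * c \<kappa>)"
proof (rule ext, clarify)
  fix x y
  have "((\<lambda>r. \<Sum>\<kappa>\<in>modes K. Re (c \<kappa> * wave \<kappa> (x, r))) has_field_derivative
      (\<Sum>\<kappa>\<in>modes K. Re ((2 * pi * \<i> * of_int (snd \<kappa>)) * c \<kappa> * wave \<kappa> (x, y)))) (at y)"
    by (rule DERIV_sum) (auto simp: wave_def algebra_simps intro!: derivative_eq_intros)
  then have "deriv (\<lambda>r. trig K c (x, r)) y = trig K (\<lambda>\<kappa>. (2 * pi * \<i> * of_int (snd \<kappa>)) * c \<kappa>) (x, y)"
    unfolding trig_def Re_sum by (rule DERIV_imp_deriv)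
  then show "dy (trig K c) (x, y) = trig K (\<lambda>\<kappa>. (2 * pi * \<i> * of_int (snd \<kappa>)) * c \<kappa>) (x, y)"
    by (simp only: dy_def prod.case)
qed

lemma lap_trig: "lap (trig K c) = trig K (\<lambda>\<kappa>. - of_real ((rad \<kappa>)\<^sup>2) * c \<kappa>)"
proof
  fix p
  have "lap (trig K c) p = Re (\<Sum>\<kappa>\<in>modes K. (2 * pi * \<i> * of_int (fst \<kappa>)) * ((2 * pi * \<i> * of_int (fst \<kappa>)) * c \<kappa>) * wave \<kappa> p
      + (2 * pi * \<i> * of_int (snd \<kappa>)) * ((2 * pi * \<i> * of_int (snd \<kappa>)) * c \<kappa>) * wave \<kappa> p)"
    by (simp only: lap_def dx_trig dy_trig) (simp only: trig_def sum.distrib plus_complex.simps)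
  also have "\<dots> = trig K (\<lambda>\<kappa>. - of_real ((rad \<kappa>)\<^sup>2) * c \<kappa>) p"
    unfolding trig_def rad_sq
    by (intro arg_cong[where f = Re] sum.cong refl) (simp add: algebra_simps power2_eq_square)
  finally show "lap (trig K c) p = trig K (\<lambda>\<kappa>. - of_real ((rad \<kappa>)\<^sup>2) * c \<kappa>) p" .
qed

lemma lap_power_trig: "(lap ^^ m) (trig K c) = trig K (\<lambda>\<kappa>. (- of_real ((rad \<kappa>)\<^sup>2)) ^ m * c \<kappa>)"
  by (induction m) (simp_all add: lap_trig mult.assoc)

lemma normL2_nonneg [simp]: "normL2 fs \<ge> 0"
  unfolding normL2_def by (intro real_sqrt_ge_zero sum_list_nonneg) auto

lemma normL2_sq: "(normL2 fs)\<^sup>2 = (\<Sum>f\<leftarrow>fs. integral\<^sup>L (lebesgue_on Omega) (\<lambda>p. (f p)\<^sup>2))"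
  unfolding normL2_def by (intro real_sqrt_pow2 sum_list_nonneg) auto

lemma rad_minus [simp]: "rad (- \<kappa>) = rad \<kappa>"
  by (simp add: rad_def norm_Pair)

text \<open>No constant is lost between \<open>nabla\<close> and the weight \<open>rad\<close>: a
  Laplacian multiplies by minus the square of \<open>rad\<close>, and for odd \<open>s\<close> the
  squares of the two gradient components add up to one more such factor.\<close>

lemma normL2_nabla_trig:
  assumes "csym K c"
  shows "normL2 (nabla s (trig K c)) = hs K s (\<lambda>\<kappa>. cmod (c \<kappa>))"
proof -
  define d where "d = (\<lambda>\<kappa>. (- of_real ((rad \<kappa>)\<^sup>2)) ^ (s div 2) * c \<kappa>)"
  have d: "csym K d" using assms by (simp add: csym_def d_def)
  have nd: "(cmod (d \<kappa>))\<^sup>2 = rad \<kappa> ^ (4 * (s div 2)) * (cmod (c \<kappa>))\<^sup>2" for \<kappa>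
    by (simp add: d_def norm_mult norm_power power_mult_distrib flip: power_mult)
  have lp: "(lap ^^ (s div 2)) (trig K c) = trig K d" by (simp only: lap_power_trig d_def)
  have "(normL2 (nabla s (trig K c)))\<^sup>2 = (hs K s (\<lambda>\<kappa>. cmod (c \<kappa>)))\<^sup>2"
  proof (cases "even s")
    case True
    then have s: "4 * (s div 2) = 2 * s" by auto
    have "nabla s (trig K c) = [trig K d]" using True by (simp add: nabla_def lp)
    then show ?thesis by (simp only: normL2_sq integral_trig_sq[OF d] list.map sum_list.Cons sum_list.Nil hs_sq nd s add_0_right)
  next
    case False
    then have s: "2 * s = 4 * (s div 2) + 2" by presburger
    have "nabla s (trig K c) = [trig K (\<lambda>\<kappa>. (2 * pi * \<i> * of_int (fst \<kappa>)) * d \<kappa>), trig K (\<lambda>\<kappa>. (2 * pi * \<i> * of_int (snd \<kappa>)) * d \<kappa>)]"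
      using False by (simp only: nabla_def lp Let_def dx_trig dy_trig if_False)
    then have "(normL2 (nabla s (trig K c)))\<^sup>2
        = (\<Sum>\<kappa>\<in>modes K. (cmod ((2 * pi * \<i> * of_int (fst \<kappa>)) * d \<kappa>))\<^sup>2) + (\<Sum>\<kappa>\<in>modes K. (cmod ((2 * pi * \<i> * of_int (snd \<kappa>)) * d \<kappa>))\<^sup>2)"
      by (simp only: normL2_sq integral_trig_sq[OF csym_diff(1)[OF d]] integral_trig_sq[OF csym_diff(2)[OF d]]
          list.map sum_list.Cons sum_list.Nil add_0_right)
    also have "\<dots> = (\<Sum>\<kappa>\<in>modes K. (rad \<kappa>)\<^sup>2 * (cmod (d \<kappa>))\<^sup>2)"
      unfolding sum.distrib[symmetric]
      by (intro sum.cong refl) (simp add: norm_mult power_mult_distrib rad_sq algebra_simps)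
    also have "\<dots> = (hs K s (\<lambda>\<kappa>. cmod (c \<kappa>)))\<^sup>2"
      unfolding hs_sq nd s by (simp add: power_add power2_eq_square mult_ac)
    finally show ?thesis .
  qed
  then show ?thesis by (simp add: power2_eq_iff_nonneg)
qed

lemma cont_ext_trig: "cont_ext K f = trig K (dft K f)"
  by (simp add: cont_ext_def trig_def fun_eq_iff)

lemma fproj_trig: "fproj K f = trig K (fourier f)"
  by (simp add: fproj_def trig_def fun_eq_iff)

lemma dft_restrict_fproj: "\<kappa> \<in> modes K \<Longrightarrow> dft K (restrictN K (fproj K f)) \<kappa> = fourier f \<kappa>"
  unfolding restrictN_def fproj_trig by (rule dft_trig) auto

section \<open>Sobolev norms of periodic functions\<close>

lemma sob_term_eq: "sob_term m f \<kappa> = rad \<kappa> ^ (2 * m) * (cmod (fourier f \<kappa>))\<^sup>2"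
  by (simp add: sob_term_def rad_sq[symmetric] power_mult)

lemma sob_term_nonneg [simp]: "sob_term m f \<kappa> \<ge> 0"
  by (simp add: sob_term_eq)

lemma sob_term_summable_mono:
  assumes "sob_term m f summable_on UNIV" "1 \<le> j" "j \<le> m"
  shows "sob_term j f summable_on UNIV"
proof (rule summable_on_comparison_test[OF assms(1)])
  fix \<kappa> show "sob_term j f \<kappa> \<le> sob_term m f \<kappa>"
    using rad_ge_1[of \<kappa>] assms(2,3) unfolding sob_term_eq
    by (cases "\<kappa> = 0") (auto simp: power_0_left intro!: mult_right_mono power_increasing)
qed simp

lemma normH_sq: "(normH m f)\<^sup>2 = (normL2 [f])\<^sup>2 + (\<Sum>j = 1..m. infsum (sob_term j f) UNIV)"
  unfolding normH_def by (intro real_sqrt_pow2 add_nonneg_nonneg sum_nonneg infsum_nonneg) auto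

lemma normH_nonneg [simp]: "normH m f \<ge> 0"
  unfolding normH_def by (intro real_sqrt_ge_zero add_nonneg_nonneg sum_nonneg infsum_nonneg) auto

lemma normL2_le_normH: "normL2 [f] \<le> normH m f"
proof (rule power2_le_imp_le)
  show "(normL2 [f])\<^sup>2 \<le> (normH m f)\<^sup>2"
    unfolding normH_sq by (simp add: sum_nonneg infsum_nonneg)
qed simp

lemma hs_fourier_le_normH:
  assumes "sob_term j f summable_on UNIV" "1 \<le> j" "j \<le> m"
  shows "hs K j (\<lambda>\<kappa>. cmod (fourier f \<kappa>)) \<le> normH m f"
proof (rule power2_le_imp_le)
  have "(hs K j (\<lambda>\<kappa>. cmod (fourier f \<kappa>)))\<^sup>2 = sum (sob_term j f) (modes K)"
    by (simp add: hs_sq sob_term_eq)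
  also have "\<dots> \<le> infsum (sob_term j f) UNIV"
    by (rule finite_sum_le_infsum[OF assms(1)]) auto
  also have "\<dots> \<le> (\<Sum>j = 1..m. infsum (sob_term j f) UNIV)"
    using assms by (intro member_le_sum) (auto intro: infsum_nonneg)
  also have "\<dots> \<le> (normH m f)\<^sup>2" by (simp add: normH_sq)
  finally show "(hs K j (\<lambda>\<kappa>. cmod (fourier f \<kappa>)))\<^sup>2 \<le> (normH m f)\<^sup>2" .
qed simp

lemma hs_le_normHN:
  assumes "1 \<le> j" "j \<le> m"
  shows "hs K j (\<lambda>\<kappa>. cmod (dft K f \<kappa>)) \<le> normHN K m f"
proof -
  have "sob_term j (cont_ext K f) summable_on UNIV"
  proof (subst summable_on_cong_neutral[where S = UNIV and T = "modes K" and g = "sob_term j (cont_ext K f)"])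
    fix \<kappa> assume "\<kappa> \<in> UNIV - modes K"
    then show "sob_term j (cont_ext K f) \<kappa> = 0" by (simp add: cont_ext_trig sob_term_eq fourier_trig)
  qed (auto intro: summable_on_finite)
  then have "hs K j (\<lambda>\<kappa>. cmod (fourier (cont_ext K f) \<kappa>)) \<le> normHN K m f"
    unfolding normHN_def using assms by (rule hs_fourier_le_normH)
  also have "hs K j (\<lambda>\<kappa>. cmod (fourier (cont_ext K f) \<kappa>)) = hs K j (\<lambda>\<kappa>. cmod (dft K f \<kappa>))"
    unfolding hs_def by (intro L2_set_cong refl) (simp add: cont_ext_trig fourier_trig)
  finally show ?thesis .
qed

text \<open>Positivity of the integral of (f - p)^2, where p is the projection of f. The Fourier
  integrals ask for integrability of f itself, which follows from |x| <= 1 + x^2 on a set of finite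
  measure.\<close>

lemma bessel:
  assumes "f \<in> Hper m"
  shows "hs K 0 (\<lambda>\<kappa>. cmod (fourier f \<kappa>)) \<le> normL2 [f]"
proof -
  let ?L = "lebesgue_on Omega" and ?p = "trig K (fourier f)"
  have m: "f \<in> borel_measurable ?L" and f2: "integrable ?L (\<lambda>p. (f p)\<^sup>2)"
    using assms by (auto simp: Hper_def)
  have c1: "integrable ?L (\<lambda>p. 1 :: real)" by (intro integrable_continuous_Omega continuous_intros)
  have f1: "integrable ?L f"
  proof (rule Bochner_Integration.integrable_bound[OF Bochner_Integration.integrable_add[OF c1 f2] m])
    have "\<bar>x\<bar> \<le> 1 + x\<^sup>2" for x :: real
      using sum_squares_bound[of 1 "\<bar>x\<bar>"] by (simp add: algebra_simps)
    then show "AE p in ?L. norm (f p) \<le> norm (1 + (f p)\<^sup>2)" by auto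
  qed
  have S: "Re (\<Sum>\<kappa>\<in>modes K. fourier f \<kappa> * cnj (fourier f \<kappa>)) = (\<Sum>\<kappa>\<in>modes K. (cmod (fourier f \<kappa>))\<^sup>2)"
    by (simp add: complex_mult_cnj cmod_power2 flip: power2_eq_square)
  have p2: "integrable ?L (\<lambda>p. (?p p)\<^sup>2)" by (intro integrable_continuous_Omega continuous_intros continuous_on_trig)
  have "0 \<le> integral\<^sup>L ?L (\<lambda>p. (f p - ?p p)\<^sup>2)" by simp
  also have "(\<lambda>p. (f p - ?p p)\<^sup>2) = (\<lambda>p. (f p)\<^sup>2 - 2 * (f p * ?p p) + (?p p)\<^sup>2)"
    by (simp add: fun_eq_iff power2_diff)
  also have "integral\<^sup>L ?L \<dots> = integral\<^sup>L ?L (\<lambda>p. (f p)\<^sup>2) - 2 * integral\<^sup>L ?L (\<lambda>p. f p * ?p p) + integral\<^sup>L ?L (\<lambda>p. (?p p)\<^sup>2)"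
    using f2 p2 integral_mult_trig(2)[OF f1] by simp
  also have "\<dots> = integral\<^sup>L ?L (\<lambda>p. (f p)\<^sup>2) - (\<Sum>\<kappa>\<in>modes K. (cmod (fourier f \<kappa>))\<^sup>2)"
    unfolding integral_mult_trig(1)[OF f1] S integral_trig_sq[OF csym_fourier] by simp
  finally have "(hs K 0 (\<lambda>\<kappa>. cmod (fourier f \<kappa>)))\<^sup>2 \<le> (normL2 [f])\<^sup>2"
    by (simp add: hs_sq normL2_def)
  then show ?thesis by (rule power2_le_imp_le) simp
qed

section \<open>Energy estimates for the BDF3 stencil\<close>

text \<open>The squares of the stencil identity plus a quadratic form in the two increments. With
  the weights 11/12 and 1/4 the test by the newest increment telescopes and leaves at least 1/12 of
  each of three squared increments.\<close>

definition bdf3_energy_real :: "(nat \<Rightarrow> real) \<Rightarrow> real \<Rightarrow> real \<Rightarrow> real \<Rightarrow> real" where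
  "bdf3_energy_real \<alpha> x y z = (\<alpha> 1)\<^sup>2 * x\<^sup>2 + (\<alpha> 2 * x + \<alpha> 3 * y)\<^sup>2 + (\<alpha> 4 * x + \<alpha> 5 * y + \<alpha> 6 * z)\<^sup>2
     + 11/12 * (x - y)\<^sup>2 + 1/4 * (y - z)\<^sup>2"

definition bdf3_energy :: "(nat \<Rightarrow> real) \<Rightarrow> complex \<Rightarrow> complex \<Rightarrow> complex \<Rightarrow> real" where
  "bdf3_energy \<alpha> x y z = bdf3_energy_real \<alpha> (Re x) (Re y) (Re z) + bdf3_energy_real \<alpha> (Im x) (Im y) (Im z)"

text \<open>On the one-point grid \<open>K = 0\<close> the stencil identity is an identity between real numbers.\<close>

lemma bdf3_stencil_real:
  assumes "bdf3_stencil \<alpha>"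
  shows "(11/6 * x3 - 3 * x2 + 3/2 * x1 - 1/3 * x0) * (2 * x3 - x2) =
      (\<alpha> 1 * x3)\<^sup>2 - (\<alpha> 1 * x2)\<^sup>2 + (\<alpha> 2 * x3 + \<alpha> 3 * x2)\<^sup>2 - (\<alpha> 2 * x2 + \<alpha> 3 * x1)\<^sup>2
    + (\<alpha> 4 * x3 + \<alpha> 5 * x2 + \<alpha> 6 * x1)\<^sup>2 - (\<alpha> 4 * x2 + \<alpha> 5 * x1 + \<alpha> 6 * x0)\<^sup>2
    + (\<alpha> 7 * x3 + \<alpha> 8 * x2 + \<alpha> 9 * x1 + \<alpha> 10 * x0)\<^sup>2"
proof -
  have i: "innerN 0 f g = f 0 0 * g 0 0" for f g :: grid
  proof -
    have "{0..<1::int} = {0}" by auto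
    then show ?thesis by (simp add: innerN_def mesh_def npts_def)
  qed
  have n: "(norm2N 0 [f])\<^sup>2 = (f 0 0)\<^sup>2" for f
    by (simp add: norm2N_def i)
  have c: "grid_fun 0 (\<lambda>i j. x)" for x by (simp add: grid_fun_def)
  show ?thesis
    using assms[unfolded bdf3_stencil_def, THEN conjunct2, rule_format,
        of 0 "\<lambda>i j. x3" "\<lambda>i j. x2" "\<lambda>i j. x1" "\<lambda>i j. x0"]
    by (simp add: n i c)
qed

text \<open>Testing with \<open>3 x\<^sub>3 - 2 x\<^sub>2 = (2 x\<^sub>3 - x\<^sub>2) + (x\<^sub>3 - x\<^sub>2)\<close> also yields dissipation of the increments.\<close>

lemma bdf3_energy_real_step:
  assumes "bdf3_stencil \<alpha>"
  shows "bdf3_energy_real \<alpha> x3 x2 x1 + 1/12 * ((x3 - x2)\<^sup>2 + (x2 - x1)\<^sup>2 + (x1 - x0)\<^sup>2)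
    \<le> bdf3_energy_real \<alpha> x2 x1 x0 + (11/6 * x3 - 3 * x2 + 3/2 * x1 - 1/3 * x0) * (3 * x3 - 2 * x2)"
proof -
  define a b c where "a = x3 - x2" and "b = x2 - x1" and "c = x1 - x0"
  have "11/6 * x3 - 3 * x2 + 3/2 * x1 - 1/3 * x0 = 11/6 * a - 7/6 * b + 1/3 * c"
    by (simp add: a_def b_def c_def field_simps)
  then have "(11/6 * x3 - 3 * x2 + 3/2 * x1 - 1/3 * x0) * (x3 - x2) = (11/6 * a - 7/6 * b + 1/3 * c) * a"
    by (simp only: a_def)
  \<comment> \<open>Completes the squares of the mixed terms -7/6 a b and 1/3 a c.\<close>
  also have "\<dots> = 7/12 * (a - b)\<^sup>2 + 1/6 * (a + c)\<^sup>2 + 13/12 * a\<^sup>2 - 7/12 * b\<^sup>2 - 1/6 * c\<^sup>2"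
    by (simp add: field_simps power2_eq_square)
  finally have "(11/6 * x3 - 3 * x2 + 3/2 * x1 - 1/3 * x0) * (x3 - x2)
      = 7/12 * (a - b)\<^sup>2 + 1/6 * (a + c)\<^sup>2 + 13/12 * a\<^sup>2 - 7/12 * b\<^sup>2 - 1/6 * c\<^sup>2" .
  then have 1: "13/12 * a\<^sup>2 - 7/12 * b\<^sup>2 - 1/6 * c\<^sup>2 \<le> (11/6 * x3 - 3 * x2 + 3/2 * x1 - 1/3 * x0) * (x3 - x2)"
    by simp
  have "D * (3 * x3 - 2 * x2) = D * (2 * x3 - x2) + D * (x3 - x2)" for D
    by (simp add: algebra_simps)
  then have "(11/6 * x3 - 3 * x2 + 3/2 * x1 - 1/3 * x0) * (3 * x3 - 2 * x2)
      = (11/6 * x3 - 3 * x2 + 3/2 * x1 - 1/3 * x0) * (2 * x3 - x2) + (11/6 * x3 - 3 * x2 + 3/2 * x1 - 1/3 * x0) * (x3 - x2)" .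
  moreover have "0 \<le> (\<alpha> 7 * x3 + \<alpha> 8 * x2 + \<alpha> 9 * x1 + \<alpha> 10 * x0)\<^sup>2" by simp
  moreover have "0 \<le> a\<^sup>2" by simp
  moreover have "p1 + p2 + p3 + 11/12 * u + 1/4 * v + 1/12 * (u + v + z) \<le> q1 + q2 + q3 + 11/12 * v + 1/4 * z + P"
    if "P = p1 - q1 + p2 - q2 + p3 - q3 + r + S" "0 \<le> r" "0 \<le> u" "13/12 * u - 7/12 * v - 1/6 * z \<le> S"
    for p1 p2 p3 q1 q2 q3 u v z P r S :: real
    using that unfolding distrib_left by linarith
  ultimately show ?thesis
    using 1 unfolding bdf3_energy_real_def bdf3_stencil_real[OF assms] power_mult_distrib a_def b_def c_def
    by blast
qed

text \<open>A single mode, with \<open>\<mu>\<close> in the role of \<nu> dt times the square of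
  \<open>rad\<close>. The tested viscous term is at least \<open>\<mu>\<close> times 2 |x3|^2 -
  |x2|^2. The weights 3/2, 1/4, 1/8 store part of it in the energy so that 1/8 of the dissipation
  remains on each of four levels, as the explicit nonlinear terms read old ones.\<close>

lemma bdf3_energy_step:
  assumes "bdf3_stencil \<alpha>" "\<mu> \<ge> 0"
    and eq: "11/6 * x3 - 3 * x2 + 3/2 * x1 - 1/3 * x0 + of_real \<mu> * x3 = F"
  shows "bdf3_energy \<alpha> x3 x2 x1 + \<mu> * (3/2 * (cmod x3)\<^sup>2 + 1/4 * (cmod x2)\<^sup>2 + 1/8 * (cmod x1)\<^sup>2)
      + 1/12 * ((cmod (x3 - x2))\<^sup>2 + (cmod (x2 - x1))\<^sup>2 + (cmod (x1 - x0))\<^sup>2)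
      + \<mu> / 8 * ((cmod x3)\<^sup>2 + (cmod x2)\<^sup>2 + (cmod x1)\<^sup>2 + (cmod x0)\<^sup>2)
    \<le> bdf3_energy \<alpha> x2 x1 x0 + \<mu> * (3/2 * (cmod x2)\<^sup>2 + 1/4 * (cmod x1)\<^sup>2 + 1/8 * (cmod x0)\<^sup>2)
      + Re (F * cnj (3 * x3 - 2 * x2))"
proof -
  let ?d = "11/6 * x3 - 3 * x2 + 3/2 * x1 - 1/3 * x0"
  have "Re (u * cnj v) = Re u * Re v + Im u * Im v" for u v :: complex by simp
  moreover have "Re ?d = 11/6 * Re x3 - 3 * Re x2 + 3/2 * Re x1 - 1/3 * Re x0"
    "Im ?d = 11/6 * Im x3 - 3 * Im x2 + 3/2 * Im x1 - 1/3 * Im x0"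
    "Re (3 * x3 - 2 * x2) = 3 * Re x3 - 2 * Re x2" "Im (3 * x3 - 2 * x2) = 3 * Im x3 - 2 * Im x2" by simp_all
  ultimately have d: "Re (?d * cnj (3 * x3 - 2 * x2))
      = (11/6 * Re x3 - 3 * Re x2 + 3/2 * Re x1 - 1/3 * Re x0) * (3 * Re x3 - 2 * Re x2)
      + (11/6 * Im x3 - 3 * Im x2 + 3/2 * Im x1 - 1/3 * Im x0) * (3 * Im x3 - 2 * Im x2)"
    by presburger
  have 1: "bdf3_energy \<alpha> x3 x2 x1 + 1/12 * ((cmod (x3 - x2))\<^sup>2 + (cmod (x2 - x1))\<^sup>2 + (cmod (x1 - x0))\<^sup>2)
      \<le> bdf3_energy \<alpha> x2 x1 x0 + Re (?d * cnj (3 * x3 - 2 * x2))"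
  proof -
    have "A + A' + 1/12 * ((a + a') + (b + b') + (c + c')) \<le> B + B' + (P + P')"
      if "A + 1/12 * (a + b + c) \<le> B + P" "A' + 1/12 * (a' + b' + c') \<le> B' + P'"
      for A A' a a' b b' c c' B B' P P' :: real using that unfolding distrib_left by linarith
    from this[OF bdf3_energy_real_step[OF assms(1), of "Re x3" "Re x2" "Re x1" "Re x0"]
      bdf3_energy_real_step[OF assms(1), of "Im x3" "Im x2" "Im x1" "Im x0"]]
    show ?thesis unfolding d bdf3_energy_def cmod_power2 minus_complex.simps .
  qed
  have "3 * x\<^sup>2 - 2 * (x * y) \<ge> 2 * x\<^sup>2 - y\<^sup>2" for x y :: real
    using sum_squares_bound[of x y] by simp
  from this[of "Re x3" "Re x2"] this[of "Im x3" "Im x2"]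
  have 2: "2 * (cmod x3)\<^sup>2 - (cmod x2)\<^sup>2 \<le> Re (x3 * cnj (3 * x3 - 2 * x2))"
    unfolding cmod_power2 by (simp add: algebra_simps power2_eq_square)
  have "\<mu> * (3/2 * (cmod x3)\<^sup>2 + 1/4 * (cmod x2)\<^sup>2 + 1/8 * (cmod x1)\<^sup>2)
      + \<mu> / 8 * ((cmod x3)\<^sup>2 + (cmod x2)\<^sup>2 + (cmod x1)\<^sup>2 + (cmod x0)\<^sup>2)
      = \<mu> * (13/8 * (cmod x3)\<^sup>2 + 3/8 * (cmod x2)\<^sup>2 + 1/4 * (cmod x1)\<^sup>2 + 1/8 * (cmod x0)\<^sup>2)"
    by (simp add: field_simps)
  also have "\<dots> \<le> \<mu> * ((3/2 * (cmod x2)\<^sup>2 + 1/4 * (cmod x1)\<^sup>2 + 1/8 * (cmod x0)\<^sup>2) + Re (x3 * cnj (3 * x3 - 2 * x2)))"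
    using 2 zero_le_power2[of "cmod x3"] zero_le_power2[of "cmod x2"] by (intro mult_left_mono assms(2)) linarith
  finally have 3: "\<mu> * (3/2 * (cmod x3)\<^sup>2 + 1/4 * (cmod x2)\<^sup>2 + 1/8 * (cmod x1)\<^sup>2)
      + \<mu> / 8 * ((cmod x3)\<^sup>2 + (cmod x2)\<^sup>2 + (cmod x1)\<^sup>2 + (cmod x0)\<^sup>2)
      \<le> \<mu> * (3/2 * (cmod x2)\<^sup>2 + 1/4 * (cmod x1)\<^sup>2 + 1/8 * (cmod x0)\<^sup>2) + \<mu> * Re (x3 * cnj (3 * x3 - 2 * x2))"
    by (simp only: distrib_left)
  have "Re (F * cnj (3 * x3 - 2 * x2)) = Re (?d * cnj (3 * x3 - 2 * x2)) + \<mu> * Re (x3 * cnj (3 * x3 - 2 * x2))"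
    unfolding eq[symmetric] by (simp only: distrib_right mult.assoc plus_complex.simps Re_complex_of_real Im_complex_of_real times_complex.simps)
  then show ?thesis using 1 3 by linarith
qed

text \<open>The factors 2 and 3 come from squaring sums of two and three terms; 5 = 3 + 2 pays for
  the increments and, when \<nu> dt <= 1, for the viscous weights of the energy.\<close>

definition bdf3_const :: "(nat \<Rightarrow> real) \<Rightarrow> real" where
  "bdf3_const \<alpha> = (\<alpha> 1)\<^sup>2 + 2 * (\<alpha> 2)\<^sup>2 + 2 * (\<alpha> 3)\<^sup>2 + 3 * (\<alpha> 4)\<^sup>2 + 3 * (\<alpha> 5)\<^sup>2 + 3 * (\<alpha> 6)\<^sup>2 + 5"

lemma bdf3_const_ge: "bdf3_const \<alpha> \<ge> 5"
  by (simp add: bdf3_const_def)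

lemma bdf3_energy_real_bounds:
  "(\<alpha> 1)\<^sup>2 * x\<^sup>2 \<le> bdf3_energy_real \<alpha> x y z"
  "bdf3_energy_real \<alpha> x y z \<le> (bdf3_const \<alpha> - 2) * (x\<^sup>2 + y\<^sup>2 + z\<^sup>2)"
proof -
  show "(\<alpha> 1)\<^sup>2 * x\<^sup>2 \<le> bdf3_energy_real \<alpha> x y z" by (simp add: bdf3_energy_real_def)
  have two: "(p + q)\<^sup>2 \<le> 2 * p\<^sup>2 + 2 * q\<^sup>2" for p q :: real
    using sum_squares_bound[of p q] by (simp add: power2_sum)
  have three: "(p + q + r)\<^sup>2 \<le> 3 * p\<^sup>2 + 3 * q\<^sup>2 + 3 * r\<^sup>2" for p q r :: real
    using sum_squares_bound[of p q] sum_squares_bound[of p r] sum_squares_bound[of q r]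
    by (simp add: power2_sum algebra_simps)
  have "0 \<le> (c * v)\<^sup>2" for c v :: real by simp
  then have nn: "0 \<le> c\<^sup>2 * v\<^sup>2" for c v :: real by simp
  have "(\<alpha> 2 * x + \<alpha> 3 * y)\<^sup>2 \<le> 2 * ((\<alpha> 2)\<^sup>2 * x\<^sup>2) + 2 * ((\<alpha> 3)\<^sup>2 * y\<^sup>2)"
    using two[of "\<alpha> 2 * x" "\<alpha> 3 * y"] by (simp add: power_mult_distrib)
  moreover have "(\<alpha> 4 * x + \<alpha> 5 * y + \<alpha> 6 * z)\<^sup>2 \<le> 3 * ((\<alpha> 4)\<^sup>2 * x\<^sup>2) + 3 * ((\<alpha> 5)\<^sup>2 * y\<^sup>2) + 3 * ((\<alpha> 6)\<^sup>2 * z\<^sup>2)"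
    using three[of "\<alpha> 4 * x" "\<alpha> 5 * y" "\<alpha> 6 * z"] by (simp add: power_mult_distrib)
  moreover have "(x - y)\<^sup>2 \<le> 2 * x\<^sup>2 + 2 * y\<^sup>2" "(y - z)\<^sup>2 \<le> 2 * y\<^sup>2 + 2 * z\<^sup>2"
    using two[of x "- y"] two[of y "- z"] by simp_all
  ultimately have "bdf3_energy_real \<alpha> x y z \<le> (\<alpha> 1)\<^sup>2 * x\<^sup>2 + (2 * ((\<alpha> 2)\<^sup>2 * x\<^sup>2) + 2 * ((\<alpha> 3)\<^sup>2 * y\<^sup>2))
      + (3 * ((\<alpha> 4)\<^sup>2 * x\<^sup>2) + 3 * ((\<alpha> 5)\<^sup>2 * y\<^sup>2) + 3 * ((\<alpha> 6)\<^sup>2 * z\<^sup>2))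
      + 11/12 * (2 * x\<^sup>2 + 2 * y\<^sup>2) + 1/4 * (2 * y\<^sup>2 + 2 * z\<^sup>2)"
    unfolding bdf3_energy_real_def by (intro add_mono mult_left_mono) auto
  also have "\<dots> \<le>
      ((\<alpha> 1)\<^sup>2 * x\<^sup>2 + (\<alpha> 1)\<^sup>2 * y\<^sup>2 + (\<alpha> 1)\<^sup>2 * z\<^sup>2)
      + 2 * ((\<alpha> 2)\<^sup>2 * x\<^sup>2 + (\<alpha> 2)\<^sup>2 * y\<^sup>2 + (\<alpha> 2)\<^sup>2 * z\<^sup>2) + 2 * ((\<alpha> 3)\<^sup>2 * x\<^sup>2 + (\<alpha> 3)\<^sup>2 * y\<^sup>2 + (\<alpha> 3)\<^sup>2 * z\<^sup>2)
      + 3 * ((\<alpha> 4)\<^sup>2 * x\<^sup>2 + (\<alpha> 4)\<^sup>2 * y\<^sup>2 + (\<alpha> 4)\<^sup>2 * z\<^sup>2) + 3 * ((\<alpha> 5)\<^sup>2 * x\<^sup>2 + (\<alpha> 5)\<^sup>2 * y\<^sup>2 + (\<alpha> 5)\<^sup>2 * z\<^sup>2)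
      + 3 * ((\<alpha> 6)\<^sup>2 * x\<^sup>2 + (\<alpha> 6)\<^sup>2 * y\<^sup>2 + (\<alpha> 6)\<^sup>2 * z\<^sup>2) + 3 * (x\<^sup>2 + y\<^sup>2 + z\<^sup>2)"
  proof -
    have 1: "A \<le> A + B + C" if "0 \<le> B" "0 \<le> C" for A B C :: real using that by simp
    have 2: "2 * A + 2 * E \<le> 2 * (A + B + C) + 2 * (D + E + F)" if "0 \<le> B" "0 \<le> C" "0 \<le> D" "0 \<le> F" for A B C D E F :: real
      using that by simp
    have 3: "3 * A + 3 * E + 3 * I \<le> 3 * (A + B + C) + 3 * (D + E + F) + 3 * (G + H + I)"
      if "0 \<le> B" "0 \<le> C" "0 \<le> D" "0 \<le> F" "0 \<le> G" "0 \<le> H" for A B C D E F G H I :: real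
      using that by simp
    have 4: "11/12 * (2 * x\<^sup>2 + 2 * y\<^sup>2) + 1/4 * (2 * y\<^sup>2 + 2 * z\<^sup>2) \<le> 3 * (x\<^sup>2 + y\<^sup>2 + z\<^sup>2)"
      using zero_le_power2[of x] zero_le_power2[of y] zero_le_power2[of z] unfolding distrib_left by linarith
    show ?thesis
      using 1[OF nn nn, of "(\<alpha> 1)\<^sup>2 * x\<^sup>2" "\<alpha> 1" y "\<alpha> 1" z]
        2[OF nn nn nn nn, of "(\<alpha> 2)\<^sup>2 * x\<^sup>2" "(\<alpha> 3)\<^sup>2 * y\<^sup>2" "\<alpha> 2" y "\<alpha> 2" z "\<alpha> 3" x "\<alpha> 3" z]
        3[OF nn nn nn nn nn nn, of "(\<alpha> 4)\<^sup>2 * x\<^sup>2" "(\<alpha> 5)\<^sup>2 * y\<^sup>2" "(\<alpha> 6)\<^sup>2 * z\<^sup>2" "\<alpha> 4" y "\<alpha> 4" z "\<alpha> 5" x "\<alpha> 5" z "\<alpha> 6" x "\<alpha> 6" y] 4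
      by linarith
  qed
  also have "\<dots> = (bdf3_const \<alpha> - 2) * (x\<^sup>2 + y\<^sup>2 + z\<^sup>2)"
    by (simp add: bdf3_const_def algebra_simps)
  finally show "bdf3_energy_real \<alpha> x y z \<le> (bdf3_const \<alpha> - 2) * (x\<^sup>2 + y\<^sup>2 + z\<^sup>2)" .
qed

lemma bdf3_energy_bounds:
  "(\<alpha> 1)\<^sup>2 * (cmod x)\<^sup>2 \<le> bdf3_energy \<alpha> x y z"
  "bdf3_energy \<alpha> x y z \<le> (bdf3_const \<alpha> - 2) * ((cmod x)\<^sup>2 + (cmod y)\<^sup>2 + (cmod z)\<^sup>2)"
  using bdf3_energy_real_bounds[of \<alpha> "Re x" "Re y" "Re z"] bdf3_energy_real_bounds[of \<alpha> "Im x" "Im y" "Im z"]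
  unfolding bdf3_energy_def cmod_power2 by (simp_all add: algebra_simps)

section \<open>Sobolev norms of complex coefficient families\<close>

definition hc :: "nat \<Rightarrow> nat \<Rightarrow> (int \<times> int \<Rightarrow> complex) \<Rightarrow> real" where
  "hc K s c = hs K s (\<lambda>\<kappa>. cmod (c \<kappa>))"

lemma hc_nonneg [simp]: "hc K s c \<ge> 0"
  by (simp add: hc_def)

lemma hc_sq: "(hc K s c)\<^sup>2 = (\<Sum>\<kappa>\<in>modes K. rad \<kappa> ^ (2 * s) * (cmod (c \<kappa>))\<^sup>2)"
  by (simp add: hc_def hs_sq)

lemma hc_mono_order: "s \<le> t \<Longrightarrow> c 0 = 0 \<or> s \<ge> 1 \<Longrightarrow> hc K s c \<le> hc K t c"
  unfolding hc_def by (rule hs_mono_order) auto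

lemma hc_cmult: "hc K s (\<lambda>\<kappa>. a * c \<kappa>) = cmod a * hc K s c"
  unfolding hc_def hs_def by (simp add: L2_set_cmult[symmetric] norm_mult mult.left_commute)

lemma hc_add: "hc K s (\<lambda>\<kappa>. c \<kappa> + d \<kappa>) \<le> hc K s c + hc K s d"
proof -
  have "hc K s (\<lambda>\<kappa>. c \<kappa> + d \<kappa>) \<le> L2_set (\<lambda>\<kappa>. rad \<kappa> ^ s * cmod (c \<kappa>) + rad \<kappa> ^ s * cmod (d \<kappa>)) (modes K)"
    unfolding hc_def hs_def
    by (intro L2_set_mono) (auto simp flip: distrib_left intro!: mult_left_mono norm_triangle_ineq)
  also have "\<dots> \<le> hc K s c + hc K s d"
    unfolding hc_def hs_def by (rule L2_set_triangle_ineq)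
  finally show ?thesis .
qed

lemma hc_uminus: "hc K s (\<lambda>\<kappa>. - c \<kappa>) = hc K s c"
  by (simp add: hc_def)

lemma hc_diff: "hc K s (\<lambda>\<kappa>. c \<kappa> - d \<kappa>) \<le> hc K s c + hc K s d"
  using hc_add[of K s c "\<lambda>\<kappa>. - d \<kappa>"] by (simp add: hc_uminus)

text \<open>Cauchy-Schwarz with the derivatives shared unequally, so that the right-hand side of the
  scheme can be measured two orders below the test function.\<close>

lemma sum_Re_mult_cnj_le:
  "\<bar>\<Sum>\<kappa>\<in>modes K. rad \<kappa> ^ (s + t) * Re (c \<kappa> * cnj (d \<kappa>))\<bar> \<le> hc K s c * hc K t d"
proof -
  have "\<bar>\<Sum>\<kappa>\<in>modes K. rad \<kappa> ^ (s + t) * Re (c \<kappa> * cnj (d \<kappa>))\<bar>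
      \<le> (\<Sum>\<kappa>\<in>modes K. \<bar>rad \<kappa> ^ s * cmod (c \<kappa>)\<bar> * \<bar>rad \<kappa> ^ t * cmod (d \<kappa>)\<bar>)"
  proof (rule order_trans[OF sum_abs sum_mono])
    fix \<kappa>
    have "\<bar>Re (c \<kappa> * cnj (d \<kappa>))\<bar> \<le> cmod (c \<kappa>) * cmod (d \<kappa>)"
      using abs_Re_le_cmod[of "c \<kappa> * cnj (d \<kappa>)"] by (simp only: norm_mult complex_mod_cnj)
    then have "rad \<kappa> ^ (s + t) * \<bar>Re (c \<kappa> * cnj (d \<kappa>))\<bar> \<le> rad \<kappa> ^ (s + t) * (cmod (c \<kappa>) * cmod (d \<kappa>))"
      by (rule mult_left_mono) simp
    moreover have "\<bar>rad \<kappa> ^ (s + t) * Re (c \<kappa> * cnj (d \<kappa>))\<bar> = rad \<kappa> ^ (s + t) * \<bar>Re (c \<kappa> * cnj (d \<kappa>))\<bar>"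
      by (simp only: abs_mult) simp
    ultimately show "\<bar>rad \<kappa> ^ (s + t) * Re (c \<kappa> * cnj (d \<kappa>))\<bar> \<le> \<bar>rad \<kappa> ^ s * cmod (c \<kappa>)\<bar> * \<bar>rad \<kappa> ^ t * cmod (d \<kappa>)\<bar>"
      by (simp add: power_add mult_ac)
  qed
  also have "\<dots> \<le> hc K s c * hc K t d"
    unfolding hc_def hs_def by (rule L2_set_mult_ineq)
  finally show ?thesis .
qed

lemma sq_sum3_le: "(a + b + c)\<^sup>2 \<le> 3 * (a\<^sup>2 + b\<^sup>2 + c\<^sup>2)" for a b c :: real
  using sum_squares_bound[of a b] sum_squares_bound[of a c] sum_squares_bound[of b c]
  by (simp add: power2_sum algebra_simps)

text \<open>576 = 18 * 32: after \<open>test_bound\<close> the last term becomes \<nu> / 32 of the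
  dissipation on two levels.\<close>

lemma young_viscous:
  fixes \<nu> :: real
  assumes "\<nu> > 0" shows "x * y \<le> 144 / \<nu> * x\<^sup>2 + \<nu> / 576 * y\<^sup>2"
proof -
  have "\<nu> * (x * y) = 2 * (12 * x) * (\<nu> * y / 24)" by simp
  also have "\<dots> \<le> (12 * x)\<^sup>2 + (\<nu> * y / 24)\<^sup>2" by (rule sum_squares_bound)
  also have "\<dots> = \<nu> * (144 / \<nu> * x\<^sup>2 + \<nu> / 576 * y\<^sup>2)"
    using assms by (simp add: field_simps power2_eq_square)
  finally have "\<nu> * (x * y) \<le> \<nu> * (144 / \<nu> * x\<^sup>2 + \<nu> / 576 * y\<^sup>2)" .
  then show ?thesis using assms by simp
qed

text \<open>The scheme as seen by Fourier coefficients: \<open>w\<close>, \<open>N\<close> and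
  \<open>g\<close> belong to vorticity, nonlinear term and force. The velocity and the grid products
  enter through the last two assumptions alone.\<close>

locale bdf3_modes =
  fixes \<alpha> :: "nat \<Rightarrow> real" and K :: nat and \<nu> dt :: real
    and w N g :: "int \<Rightarrow> int \<times> int \<Rightarrow> complex"
  assumes stencil: "bdf3_stencil \<alpha>"
    and nu_pos: "\<nu> > 0" and dt_pos: "dt > 0" and nu_dt: "\<nu> * dt \<le> 1"
    and w_0: "n \<ge> - 2 \<Longrightarrow> w n 0 = 0"
    and step: "n \<ge> 0 \<Longrightarrow> \<kappa> \<in> modes K \<Longrightarrow>
      11/6 * w (n + 1) \<kappa> - 3 * w n \<kappa> + 3/2 * w (n - 1) \<kappa> - 1/3 * w (n - 2) \<kappa>
        + of_real (\<nu> * dt * (rad \<kappa>)\<^sup>2) * w (n + 1) \<kappa>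
      = of_real dt * (g (n + 1) \<kappa> - (3/2 * N n \<kappa> - 3/2 * N (n - 1) \<kappa> + 1/2 * N (n - 2) \<kappa>))"
    and transport: "n \<ge> - 2 \<Longrightarrow>
      transport_dominated K (\<lambda>\<kappa>. cmod (w n \<kappa>)) (\<lambda>\<kappa>. cmod (w n \<kappa>)) (\<lambda>\<kappa>. cmod (N n \<kappa>))"
    and skew: "n \<ge> 0 \<Longrightarrow> l \<in> {n, n - 1, n - 2} \<Longrightarrow>
      \<bar>\<Sum>\<kappa>\<in>modes K. Re (N l \<kappa> * cnj (3 * w (n + 1) \<kappa> - 2 * w n \<kappa>))\<bar>
        \<le> 6 * sqrt lattice_bound * (hc K 1 (w l) * hc K 1 (\<lambda>\<kappa>. 3 * w (n + 1) \<kappa> - 2 * w n \<kappa>))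
          * hc K 0 (\<lambda>\<kappa>. w l \<kappa> - (3 * w (n + 1) \<kappa> - 2 * w n \<kappa>))"
begin

abbreviation test :: "int \<Rightarrow> int \<times> int \<Rightarrow> complex" where
  "test n \<equiv> \<lambda>\<kappa>. 3 * w (n + 1) \<kappa> - 2 * w n \<kappa>"

definition rhs :: "int \<Rightarrow> int \<times> int \<Rightarrow> complex" where
  "rhs n = (\<lambda>\<kappa>. g (n + 1) \<kappa> - (3/2 * N n \<kappa> - 3/2 * N (n - 1) \<kappa> + 1/2 * N (n - 2) \<kappa>))"

abbreviation incr :: "nat \<Rightarrow> int \<Rightarrow> real" where
  "incr s n \<equiv> hc K s (\<lambda>\<kappa>. w n \<kappa> - w (n - 1) \<kappa>)"

abbreviation diss :: "nat \<Rightarrow> int \<Rightarrow> real" where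
  "diss s n \<equiv> (hc K (Suc s) (w n))\<^sup>2"

definition energy :: "nat \<Rightarrow> int \<Rightarrow> real" where
  "energy s n = (\<Sum>\<kappa>\<in>modes K. rad \<kappa> ^ (2 * s) * (bdf3_energy \<alpha> (w n \<kappa>) (w (n - 1) \<kappa>) (w (n - 2) \<kappa>)
     + \<nu> * dt * (rad \<kappa>)\<^sup>2 * (3/2 * (cmod (w n \<kappa>))\<^sup>2 + 1/4 * (cmod (w (n - 1) \<kappa>))\<^sup>2 + 1/8 * (cmod (w (n - 2) \<kappa>))\<^sup>2)))"

lemma step':
  assumes "n \<ge> 0" "\<kappa> \<in> modes K"
  shows "11/6 * w (n + 1) \<kappa> - 3 * w n \<kappa> + 3/2 * w (n - 1) \<kappa> - 1/3 * w (n - 2) \<kappa>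
      + of_real (\<nu> * dt * (rad \<kappa>)\<^sup>2) * w (n + 1) \<kappa> = of_real dt * rhs n \<kappa>"
  unfolding rhs_def by (rule step[OF assms])

lemma energy_step:
  assumes "n \<ge> 0"
  shows "energy s (n + 1) + 1/12 * ((incr s (n + 1))\<^sup>2 + (incr s n)\<^sup>2 + (incr s (n - 1))\<^sup>2)
      + \<nu> * dt / 8 * (diss s (n + 1) + diss s n + diss s (n - 1) + diss s (n - 2))
    \<le> energy s n + dt * (\<Sum>\<kappa>\<in>modes K. rad \<kappa> ^ (2 * s) * Re (rhs n \<kappa> * cnj (test n \<kappa>)))"
proof -
  let ?h = "\<lambda>n \<kappa>. bdf3_energy \<alpha> (w n \<kappa>) (w (n - 1) \<kappa>) (w (n - 2) \<kappa>)
     + \<nu> * dt * (rad \<kappa>)\<^sup>2 * (3/2 * (cmod (w n \<kappa>))\<^sup>2 + 1/4 * (cmod (w (n - 1) \<kappa>))\<^sup>2 + 1/8 * (cmod (w (n - 2) \<kappa>))\<^sup>2)"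
  let ?i = "\<lambda>\<kappa>. 1/12 * ((cmod (w (n + 1) \<kappa> - w n \<kappa>))\<^sup>2 + (cmod (w n \<kappa> - w (n - 1) \<kappa>))\<^sup>2 + (cmod (w (n - 1) \<kappa> - w (n - 2) \<kappa>))\<^sup>2)"
  let ?d = "\<lambda>\<kappa>. \<nu> * dt * (rad \<kappa>)\<^sup>2 / 8 * ((cmod (w (n + 1) \<kappa>))\<^sup>2 + (cmod (w n \<kappa>))\<^sup>2 + (cmod (w (n - 1) \<kappa>))\<^sup>2 + (cmod (w (n - 2) \<kappa>))\<^sup>2)"
  have "rad \<kappa> ^ (2 * s) * ?h (n + 1) \<kappa> + rad \<kappa> ^ (2 * s) * ?i \<kappa> + rad \<kappa> ^ (2 * s) * ?d \<kappa>
      \<le> rad \<kappa> ^ (2 * s) * ?h n \<kappa> + dt * (rad \<kappa> ^ (2 * s) * Re (rhs n \<kappa> * cnj (test n \<kappa>)))" if "\<kappa> \<in> modes K" for \<kappa>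
  proof -
    have mu: "\<nu> * dt * (rad \<kappa>)\<^sup>2 \<ge> 0" using nu_pos dt_pos by simp
    have "?h (n + 1) \<kappa> + ?i \<kappa> + ?d \<kappa> \<le> ?h n \<kappa> + dt * Re (rhs n \<kappa> * cnj (test n \<kappa>))"
    proof -
      have "Re (of_real r * z * v) = r * Re (z * v)" for r z v
        by (simp add: right_diff_distrib mult.assoc)
      moreover have "n + 1 - 1 = n" "n + 1 - 2 = n - 1" by simp_all
      ultimately show ?thesis
        using bdf3_energy_step[OF stencil mu step'[OF assms that]]
        by (simp only:)
    qed
    then have "rad \<kappa> ^ (2 * s) * (?h (n + 1) \<kappa> + ?i \<kappa> + ?d \<kappa>) \<le> rad \<kappa> ^ (2 * s) * (?h n \<kappa> + dt * Re (rhs n \<kappa> * cnj (test n \<kappa>)))"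
      by (rule mult_left_mono) simp
    then show ?thesis by (simp only: distrib_left mult.left_commute)
  qed
  then have "(\<Sum>\<kappa>\<in>modes K. rad \<kappa> ^ (2 * s) * ?h (n + 1) \<kappa> + rad \<kappa> ^ (2 * s) * ?i \<kappa> + rad \<kappa> ^ (2 * s) * ?d \<kappa>)
      \<le> (\<Sum>\<kappa>\<in>modes K. rad \<kappa> ^ (2 * s) * ?h n \<kappa> + dt * (rad \<kappa> ^ (2 * s) * Re (rhs n \<kappa> * cnj (test n \<kappa>))))"
    by (rule sum_mono)
  moreover have "(\<Sum>\<kappa>\<in>modes K. rad \<kappa> ^ (2 * s) * ?i \<kappa>) = 1/12 * ((incr s (n + 1))\<^sup>2 + (incr s n)\<^sup>2 + (incr s (n - 1))\<^sup>2)"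
    unfolding hc_sq sum_distrib_left sum.distrib[symmetric] by (intro sum.cong refl) (simp add: algebra_simps)
  moreover have "(\<Sum>\<kappa>\<in>modes K. rad \<kappa> ^ (2 * s) * ?d \<kappa>) = \<nu> * dt / 8 * (diss s (n + 1) + diss s n + diss s (n - 1) + diss s (n - 2))"
    unfolding hc_sq sum_distrib_left sum.distrib[symmetric]
    by (intro sum.cong refl) (simp add: algebra_simps power2_eq_square)
  ultimately show ?thesis
    unfolding energy_def sum.distrib sum_distrib_left[symmetric] by linarith
qed

lemma energy_lower: "(\<alpha> 1)\<^sup>2 * (hc K s (w n))\<^sup>2 \<le> energy s n"
proof -
  have "(\<alpha> 1)\<^sup>2 * (hc K s (w n))\<^sup>2 = (\<Sum>\<kappa>\<in>modes K. rad \<kappa> ^ (2 * s) * ((\<alpha> 1)\<^sup>2 * (cmod (w n \<kappa>))\<^sup>2))"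
    unfolding hc_sq sum_distrib_left by (simp only: mult_ac)
  also have "\<dots> \<le> energy s n"
    unfolding energy_def
  proof (intro sum_mono mult_left_mono)
    fix \<kappa>
    have "0 \<le> \<nu> * dt * (rad \<kappa>)\<^sup>2 * (3/2 * (cmod (w n \<kappa>))\<^sup>2 + 1/4 * (cmod (w (n - 1) \<kappa>))\<^sup>2 + 1/8 * (cmod (w (n - 2) \<kappa>))\<^sup>2)"
      using nu_pos dt_pos by simp
    then show "(\<alpha> 1)\<^sup>2 * (cmod (w n \<kappa>))\<^sup>2 \<le> bdf3_energy \<alpha> (w n \<kappa>) (w (n - 1) \<kappa>) (w (n - 2) \<kappa>)
        + \<nu> * dt * (rad \<kappa>)\<^sup>2 * (3/2 * (cmod (w n \<kappa>))\<^sup>2 + 1/4 * (cmod (w (n - 1) \<kappa>))\<^sup>2 + 1/8 * (cmod (w (n - 2) \<kappa>))\<^sup>2)"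
      using bdf3_energy_bounds(1)[of \<alpha> "w n \<kappa>" "w (n - 1) \<kappa>" "w (n - 2) \<kappa>"] by linarith
  qed simp
  finally show ?thesis .
qed

text \<open>A Poincare inequality: \<open>w\<close> has no zero mode and all other frequencies are
  at least 1, so the dissipation dominates the energy. The viscous part already carries the square
  of \<open>rad\<close> and only uses \<nu> dt <= 1.\<close>

lemma energy_upper:
  assumes "n \<ge> 0"
  shows "energy s n \<le> bdf3_const \<alpha> * (diss s n + diss s (n - 1) + diss s (n - 2))"
proof -
  let ?S = "\<lambda>\<kappa>. (cmod (w n \<kappa>))\<^sup>2 + (cmod (w (n - 1) \<kappa>))\<^sup>2 + (cmod (w (n - 2) \<kappa>))\<^sup>2"
  have "energy s n \<le> (\<Sum>\<kappa>\<in>modes K. rad \<kappa> ^ (2 * s) * ((rad \<kappa>)\<^sup>2 * (bdf3_const \<alpha> * ?S \<kappa>)))"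
    unfolding energy_def
  proof (intro sum_mono mult_left_mono)
    fix \<kappa>
    show "bdf3_energy \<alpha> (w n \<kappa>) (w (n - 1) \<kappa>) (w (n - 2) \<kappa>)
        + \<nu> * dt * (rad \<kappa>)\<^sup>2 * (3/2 * (cmod (w n \<kappa>))\<^sup>2 + 1/4 * (cmod (w (n - 1) \<kappa>))\<^sup>2 + 1/8 * (cmod (w (n - 2) \<kappa>))\<^sup>2)
        \<le> (rad \<kappa>)\<^sup>2 * (bdf3_const \<alpha> * ?S \<kappa>)" (is "?h + ?m \<le> _")
    proof (cases "\<kappa> = 0")
      case True
      then show ?thesis using assms by (simp add: w_0 bdf3_energy_def bdf3_energy_real_def)
    next
      case False
      then have r: "1 \<le> (rad \<kappa>)\<^sup>2" using rad_ge_1[of \<kappa>] by (simp add: one_le_power)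
      have S: "0 \<le> ?S \<kappa>" by simp
      have "?h \<le> (bdf3_const \<alpha> - 2) * ?S \<kappa>" by (rule bdf3_energy_bounds)
      also have "\<dots> \<le> (rad \<kappa>)\<^sup>2 * ((bdf3_const \<alpha> - 2) * ?S \<kappa>)"
        using mult_right_mono[OF r, of "(bdf3_const \<alpha> - 2) * ?S \<kappa>"] bdf3_const_ge[of \<alpha>] S by simp
      finally have h: "?h \<le> (rad \<kappa>)\<^sup>2 * ((bdf3_const \<alpha> - 2) * ?S \<kappa>)" .
      have "?m \<le> (1 * (rad \<kappa>)\<^sup>2) * (2 * ?S \<kappa>)"
      proof (rule mult_mono)
        show "\<nu> * dt * (rad \<kappa>)\<^sup>2 \<le> 1 * (rad \<kappa>)\<^sup>2" by (rule mult_right_mono[OF nu_dt]) simp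
        show "3/2 * (cmod (w n \<kappa>))\<^sup>2 + 1/4 * (cmod (w (n - 1) \<kappa>))\<^sup>2 + 1/8 * (cmod (w (n - 2) \<kappa>))\<^sup>2 \<le> 2 * ?S \<kappa>"
          using zero_le_power2[of "cmod (w n \<kappa>)"] zero_le_power2[of "cmod (w (n - 1) \<kappa>)"]
            zero_le_power2[of "cmod (w (n - 2) \<kappa>)"] unfolding distrib_left by linarith
      qed auto
      then show ?thesis using h by (simp add: algebra_simps)
    qed
  qed simp
  also have "\<dots> = bdf3_const \<alpha> * (diss s n + diss s (n - 1) + diss s (n - 2))"
    unfolding hc_sq sum_distrib_left sum.distrib[symmetric]
    by (intro sum.cong refl) (simp add: algebra_simps power2_eq_square)
  finally show ?thesis .
qed

text \<open>Force and nonlinearity may use up the increments and half of the dissipation. By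
  \<open>energy_upper\<close> the other half is at least \<open>k\<close> times the new energy, so 1
  + \<open>k\<close> times the new energy is at most the old energy plus \<open>dt * Q\<close>, and
  every level \<open>X\<close> with \<open>dt * Q\<close> below \<open>k * X\<close> is
  invariant.\<close>

lemma energy_decay:
  assumes n: "n \<ge> 0"
    and r: "dt * (\<Sum>\<kappa>\<in>modes K. rad \<kappa> ^ (2 * s) * Re (rhs n \<kappa> * cnj (test n \<kappa>)))
      \<le> 1/12 * ((incr s (n + 1))\<^sup>2 + (incr s n)\<^sup>2 + (incr s (n - 1))\<^sup>2)
        + \<nu> * dt / 16 * (diss s (n + 1) + diss s n + diss s (n - 1) + diss s (n - 2)) + dt * Q"
    and X: "energy s n \<le> X" "16 * bdf3_const \<alpha> * Q / \<nu> \<le> X"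
  shows "energy s (n + 1) \<le> X"
proof -
  let ?C = "bdf3_const \<alpha>"
  have C: "?C > 0" using bdf3_const_ge[of \<alpha>] by linarith
  define k where "k = \<nu> * dt / (16 * ?C)"
  have k: "k \<ge> 0" using nu_pos dt_pos C by (simp add: k_def)
  let ?D = "diss s (n + 1) + diss s n + diss s (n - 1)"
  have "energy s (n + 1) + \<nu> * dt / 16 * ?D \<le> energy s n + dt * Q"
  proof -
    have "0 \<le> \<nu> * dt / 16 * diss s (n - 2)" using nu_pos dt_pos by simp
    moreover have "\<nu> * dt / 8 * D = 2 * (\<nu> * dt / 16 * D)" for D by simp
    ultimately show ?thesis using energy_step[OF n, of s] r by (simp only: distrib_left)
  qed
  moreover have "k * energy s (n + 1) \<le> \<nu> * dt / 16 * ?D"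
  proof -
    have "energy s (n + 1) \<le> ?C * ?D"
      using energy_upper[of "n + 1" s] n by simp
    then have "k * energy s (n + 1) \<le> k * (?C * ?D)"
      using k by (rule mult_left_mono)
    then show ?thesis using C by (simp add: k_def)
  qed
  moreover have "dt * Q \<le> k * X"
  proof -
    have "k * (16 * ?C * Q / \<nu>) \<le> k * X" using X(2) k by (rule mult_left_mono)
    then show ?thesis using nu_pos C by (simp add: k_def)
  qed
  ultimately have "(1 + k) * energy s (n + 1) \<le> (1 + k) * X"
    using X(1) unfolding distrib_right mult_1 by linarith
  then show ?thesis using k by (simp add: mult_le_cancel_left)
qed

lemma test_bound: "(hc K s (test n))\<^sup>2 \<le> 18 * ((hc K s (w (n + 1)))\<^sup>2 + (hc K s (w n))\<^sup>2)"
proof -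
  let ?p = "hc K s (w (n + 1))" and ?q = "hc K s (w n)"
  have "hc K s (test n) \<le> 3 * ?p + 2 * ?q"
    using hc_diff[of K s "\<lambda>\<kappa>. 3 * w (n + 1) \<kappa>" "\<lambda>\<kappa>. 2 * w n \<kappa>"] by (simp add: hc_cmult)
  then have "(hc K s (test n))\<^sup>2 \<le> (3 * ?p + 2 * ?q)\<^sup>2" by (rule power_mono) simp
  also have "\<dots> \<le> 18 * (?p\<^sup>2 + ?q\<^sup>2)"
  proof -
    have "(3 * ?p + 2 * ?q)\<^sup>2 = 9 * ?p\<^sup>2 + 6 * (2 * ?p * ?q) + 4 * ?q\<^sup>2"
      by (simp add: power2_sum power_mult_distrib)
    then show ?thesis
      using sum_squares_bound[of ?p ?q] zero_le_power2[of ?p] zero_le_power2[of ?q] unfolding distrib_left by linarith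
  qed
  finally show ?thesis .
qed

text \<open>The weight is split so that the right-hand side keeps order \<open>s\<close> and the
  test function takes order \<open>s + 2\<close>, that of the dissipation. Since 41472 = 144 * 9 *
  32, the nonlinear terms take \<nu> / 32 of the dissipation and the test function another \<nu> /
  32, together the \<nu> / 16 that \<open>energy_decay\<close> admits.\<close>

lemma energy_bound_Suc:
  assumes n: "n \<ge> 0"
    and G: "hc K s (g (n + 1)) \<le> G"
    and N: "\<And>l. l \<in> {n, n - 1, n - 2} \<Longrightarrow> (hc K s (N l))\<^sup>2 \<le> \<nu>\<^sup>2 / 41472 * diss (Suc s) l + B"
    and X: "energy (Suc s) n \<le> X" "16 * bdf3_const \<alpha> * (576 * G\<^sup>2 / \<nu> + 3888 * B / \<nu>) / \<nu> \<le> X"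
  shows "energy (Suc s) (n + 1) \<le> X"
proof (rule energy_decay[OF n _ X])
  let ?Y = "hc K (s + 2) (test n)" and ?R = "hc K s (rhs n)"
  let ?n2 = "hc K s (N n)" and ?n1 = "hc K s (N (n - 1))" and ?n0 = "hc K s (N (n - 2))"
  define D3 D2 D1 D0 where "D3 = diss (Suc s) (n + 1)" and "D2 = diss (Suc s) n"
    and "D1 = diss (Suc s) (n - 1)" and "D0 = diss (Suc s) (n - 2)"
  have Dnn: "D3 \<ge> 0" "D2 \<ge> 0" "D1 \<ge> 0" "D0 \<ge> 0" by (simp_all add: D3_def D2_def D1_def D0_def)
  have "(\<Sum>\<kappa>\<in>modes K. rad \<kappa> ^ (2 * Suc s) * Re (rhs n \<kappa> * cnj (test n \<kappa>))) \<le> ?R * ?Y"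
  proof -
    have "2 * Suc s = s + (s + 2)" by simp
    then show ?thesis
      using sum_Re_mult_cnj_le[where s = s and t = "s + 2" and c = "rhs n" and d = "test n" and K = K]
      by (simp only:)
  qed
  also have "\<dots> \<le> 144 / \<nu> * ?R\<^sup>2 + \<nu> / 576 * ?Y\<^sup>2" by (rule young_viscous[OF nu_pos])
  also have "\<dots> \<le> 144 / \<nu> * (4 * G\<^sup>2 + 9 * (\<nu>\<^sup>2 / 41472 * (D2 + D1 + D0) + 3 * B)) + \<nu> / 576 * (18 * (D3 + D2))"
  proof (intro add_mono mult_left_mono)
    have "?R \<le> hc K s (g (n + 1)) + ((3/2 * ?n2 + 3/2 * ?n1) + 1/2 * ?n0)"
      unfolding rhs_def
      by (intro order_trans[OF hc_diff] add_mono order_trans[OF hc_add]) (unfold hc_cmult, simp_all add: norm_divide)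
    then have "?R \<le> G + 3/2 * ?n2 + 3/2 * ?n1 + 1/2 * ?n0" using G by linarith
    then have "?R\<^sup>2 \<le> (G + 3/2 * ?n2 + 3/2 * ?n1 + 1/2 * ?n0)\<^sup>2" by (rule power_mono) simp
    \<comment> \<open>Squaring a sum of four terms costs a factor 4, and 4 (3/2)^2 = 9.\<close>
    also have "\<dots> \<le> 4 * G\<^sup>2 + 9 * (?n2\<^sup>2 + ?n1\<^sup>2 + ?n0\<^sup>2)"
    proof -
      have "(p + q + r + t)\<^sup>2 \<le> 4 * p\<^sup>2 + 4 * q\<^sup>2 + 4 * r\<^sup>2 + 4 * t\<^sup>2" for p q r t :: real
        using sum_squares_bound[of p q] sum_squares_bound[of p r] sum_squares_bound[of p t]
          sum_squares_bound[of q r] sum_squares_bound[of q t] sum_squares_bound[of r t]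
        by (simp add: power2_sum algebra_simps)
      from this[of G "3/2 * ?n2" "3/2 * ?n1" "1/2 * ?n0"]
      have "(G + 3/2 * ?n2 + 3/2 * ?n1 + 1/2 * ?n0)\<^sup>2 \<le> 4 * G\<^sup>2 + 9 * ?n2\<^sup>2 + 9 * ?n1\<^sup>2 + ?n0\<^sup>2"
        by (simp add: power_mult_distrib power_divide)
      then show ?thesis using zero_le_power2[of ?n0] unfolding distrib_left by linarith
    qed
    also have "\<dots> \<le> 4 * G\<^sup>2 + 9 * (\<nu>\<^sup>2 / 41472 * (D2 + D1 + D0) + 3 * B)"
      using N[of n] N[of "n - 1"] N[of "n - 2"] by (simp add: D2_def D1_def D0_def distrib_left)
    finally show "?R\<^sup>2 \<le> 4 * G\<^sup>2 + 9 * (\<nu>\<^sup>2 / 41472 * (D2 + D1 + D0) + 3 * B)" .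
    show "?Y\<^sup>2 \<le> 18 * (D3 + D2)"
      using test_bound[of "s + 2" n] by (simp add: D3_def D2_def)
  qed (use nu_pos in auto)
  also have "\<dots> = \<nu> / 32 * (D2 + D1 + D0) + \<nu> / 32 * (D3 + D2) + (576 * G\<^sup>2 / \<nu> + 3888 * B / \<nu>)"
    using nu_pos by (simp add: field_simps power2_eq_square)
  also have "\<dots> \<le> \<nu> / 16 * (D3 + D2 + D1 + D0) + (576 * G\<^sup>2 / \<nu> + 3888 * B / \<nu>)"
  proof -
    have "0 \<le> \<nu> / 32 * (D3 + D1 + D0)" using nu_pos Dnn by simp
    then show ?thesis by (simp add: field_simps)
  qed
  finally have "dt * (\<Sum>\<kappa>\<in>modes K. rad \<kappa> ^ (2 * Suc s) * Re (rhs n \<kappa> * cnj (test n \<kappa>)))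
      \<le> dt * (\<nu> / 16 * (D3 + D2 + D1 + D0) + (576 * G\<^sup>2 / \<nu> + 3888 * B / \<nu>))"
    using dt_pos by (intro mult_left_mono) auto
  also have "\<dots> = \<nu> * dt / 16 * (D3 + D2 + D1 + D0) + dt * (576 * G\<^sup>2 / \<nu> + 3888 * B / \<nu>)"
    by (simp add: algebra_simps)
  finally show "dt * (\<Sum>\<kappa>\<in>modes K. rad \<kappa> ^ (2 * Suc s) * Re (rhs n \<kappa> * cnj (test n \<kappa>)))
      \<le> 1/12 * ((incr (Suc s) (n + 1))\<^sup>2 + (incr (Suc s) n)\<^sup>2 + (incr (Suc s) (n - 1))\<^sup>2)
        + \<nu> * dt / 16 * (diss (Suc s) (n + 1) + diss (Suc s) n + diss (Suc s) (n - 1) + diss (Suc s) (n - 2))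
        + dt * (576 * G\<^sup>2 / \<nu> + 3888 * B / \<nu>)"
    unfolding D3_def D2_def D1_def D0_def
    by (rule order_trans) (intro add_mono order_refl; simp)
qed

text \<open>
  In the condition on \<open>dt\<close>, \<open>627264 = 9 * 11\<^sup>2 * 576\<close>: the nonlinear terms leave \<open>9 (11 C M dt P)\<^sup>2\<close>, where
  \<open>C = 6 * sqrt lattice_bound\<close> is the constant of the skew estimate and \<open>P\<close> the \<open>H\<^sup>1\<close> norm of the test
  function, and this is to be at most \<open>dt \<nu> / 576 P\<^sup>2\<close>.
\<close>

lemma energy_bound_0:
  assumes n: "n \<ge> 0"
    and G: "hc K 0 (g (n + 1)) \<le> G"
    and M: "\<And>l. l \<in> {n, n - 1, n - 2} \<Longrightarrow> (hc K 1 (w l))\<^sup>2 \<le> M\<^sup>2" "M \<ge> 0"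
    and small: "dt * M\<^sup>2 * (627264 * (36 * lattice_bound)) \<le> \<nu>"
    and X: "energy 0 n \<le> X" "16 * bdf3_const \<alpha> * (144 * G\<^sup>2 / \<nu>) / \<nu> \<le> X"
  shows "energy 0 (n + 1) \<le> X"
proof (rule energy_decay[OF n _ X])
  define C where "C = 6 * sqrt lattice_bound"
  have C: "C \<ge> 0" "C\<^sup>2 = 36 * lattice_bound" by (simp_all add: C_def power_mult_distrib)
  define P where "P = hc K 1 (test n)"
  define \<delta>3 \<delta>2 \<delta>1 where "\<delta>3 = incr 0 (n + 1)" and "\<delta>2 = incr 0 n" and "\<delta>1 = incr 0 (n - 1)"
  define T where "T = (\<lambda>l. \<Sum>\<kappa>\<in>modes K. Re (N l \<kappa> * cnj (test n \<kappa>)))"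
  \<comment> \<open>Distance of \<open>w l\<close> from the test function. Skew-symmetry puts it in
    place of \<open>w l\<close>, and it consists of increments.\<close>
  define e where "e = (\<lambda>l. hc K 0 (\<lambda>\<kappa>. w l \<kappa> - test n \<kappa>))"
  have P: "P \<ge> 0" by (simp add: P_def)
  have T: "\<bar>T l\<bar> \<le> C * M * P * e l" if "l \<in> {n, n - 1, n - 2}" for l
  proof -
    have "hc K 1 (w l) \<le> M" using M(1)[OF that] M(2) by (rule power2_le_imp_le)
    then have "C * (hc K 1 (w l) * P) * e l \<le> C * (M * P) * e l"
      using C P by (intro mult_right_mono mult_left_mono) (auto simp: e_def)
    then show ?thesis using skew[OF n that] by (simp add: T_def C_def P_def e_def mult.assoc)
  qed
  have e2: "e n \<le> 3 * \<delta>3"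
  proof -
    have "(\<lambda>\<kappa>. w n \<kappa> - test n \<kappa>) = (\<lambda>\<kappa>. - 3 * (w (n + 1) \<kappa> - w (n + 1 - 1) \<kappa>))"
      by (simp add: fun_eq_iff algebra_simps)
    then have "e n = hc K 0 (\<lambda>\<kappa>. - 3 * (w (n + 1) \<kappa> - w (n + 1 - 1) \<kappa>))" by (simp only: e_def)
    then show ?thesis unfolding hc_cmult \<delta>3_def by simp
  qed
  have e1: "e (n - 1) \<le> e n + \<delta>2"
  proof -
    have "(\<lambda>\<kappa>. w (n - 1) \<kappa> - test n \<kappa>) = (\<lambda>\<kappa>. (w n \<kappa> - test n \<kappa>) - (w n \<kappa> - w (n - 1) \<kappa>))"
      by (simp add: fun_eq_iff)
    then have "e (n - 1) = hc K 0 (\<lambda>\<kappa>. (w n \<kappa> - test n \<kappa>) - (w n \<kappa> - w (n - 1) \<kappa>))" by (simp only: e_def)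
    also have "\<dots> \<le> e n + \<delta>2" unfolding e_def \<delta>2_def by (rule hc_diff)
    finally show ?thesis .
  qed
  have e0: "e (n - 2) \<le> e (n - 1) + \<delta>1"
  proof -
    have "(\<lambda>\<kappa>. w (n - 2) \<kappa> - test n \<kappa>) = (\<lambda>\<kappa>. (w (n - 1) \<kappa> - test n \<kappa>) - (w (n - 1) \<kappa> - w (n - 1 - 1) \<kappa>))"
      by (simp add: fun_eq_iff)
    then have "e (n - 2) = hc K 0 (\<lambda>\<kappa>. (w (n - 1) \<kappa> - test n \<kappa>) - (w (n - 1) \<kappa> - w (n - 1 - 1) \<kappa>))" by (simp only: e_def)
    also have "\<dots> \<le> e (n - 1) + \<delta>1" unfolding e_def \<delta>1_def by (rule hc_diff)
    finally show ?thesis .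
  qed
  have \<delta>: "\<delta>3 \<ge> 0" "\<delta>2 \<ge> 0" "\<delta>1 \<ge> 0" by (simp_all add: \<delta>3_def \<delta>2_def \<delta>1_def)
  have "(\<Sum>\<kappa>\<in>modes K. rad \<kappa> ^ (2 * 0) * Re (rhs n \<kappa> * cnj (test n \<kappa>)))
      = (\<Sum>\<kappa>\<in>modes K. Re (g (n + 1) \<kappa> * cnj (test n \<kappa>))) - (3/2 * T n - 3/2 * T (n - 1) + 1/2 * T (n - 2))"
  proof -
    have "Re ((a - (3/2 * b - 3/2 * c + 1/2 * d)) * z) = Re (a * z) - (3/2 * Re (b * z) - 3/2 * Re (c * z) + 1/2 * Re (d * z))"
      for a b c d z :: complex by (simp add: field_simps)
    then show ?thesis
      by (simp only: rhs_def T_def sum_subtractf sum.distrib sum_distrib_left mult_0_right power_0 mult_1)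
  qed
  also have "\<dots> \<le> G * P + 3/2 * \<bar>T n\<bar> + 3/2 * \<bar>T (n - 1)\<bar> + 1/2 * \<bar>T (n - 2)\<bar>"
  proof -
    have "(\<Sum>\<kappa>\<in>modes K. Re (g (n + 1) \<kappa> * cnj (test n \<kappa>))) \<le> hc K 0 (g (n + 1)) * hc K 0 (test n)"
      using sum_Re_mult_cnj_le[where s = 0 and t = 0 and c = "g (n + 1)" and d = "test n" and K = K] by simp
    also have "\<dots> \<le> G * P"
      unfolding P_def using G n by (intro mult_mono hc_mono_order) (auto simp: w_0 intro: order_trans[OF hc_nonneg])
    finally show ?thesis by (simp add: abs_if)
  qed
  also have "\<dots> \<le> G * P + 11 * C * M * P * (\<delta>3 + \<delta>2 + \<delta>1)"
  proof -
    have "3/2 * \<bar>T n\<bar> + 3/2 * \<bar>T (n - 1)\<bar> + 1/2 * \<bar>T (n - 2)\<bar>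
        \<le> 3/2 * (C * M * P * e n) + 3/2 * (C * M * P * e (n - 1)) + 1/2 * (C * M * P * e (n - 2))"
      using T by (intro add_mono mult_left_mono) auto
    also have "\<dots> = C * M * P * (3/2 * e n + 3/2 * e (n - 1) + 1/2 * e (n - 2))"
      by (simp add: algebra_simps)
    also have "\<dots> \<le> C * M * P * (11 * (\<delta>3 + \<delta>2 + \<delta>1))"
    proof (rule mult_left_mono)
      \<comment> \<open>The largest coefficient of an increment is 3 (3/2 + 3/2 + 1/2) = 21/2,
        rounded up to 11.\<close>
      show "3/2 * e n + 3/2 * e (n - 1) + 1/2 * e (n - 2) \<le> 11 * (\<delta>3 + \<delta>2 + \<delta>1)"
        using e0 e1 e2 \<delta> unfolding distrib_left by linarith
    qed (use C M P in simp)
    finally show ?thesis by (simp add: mult_ac)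
  qed
  finally have "dt * (\<Sum>\<kappa>\<in>modes K. rad \<kappa> ^ (2 * 0) * Re (rhs n \<kappa> * cnj (test n \<kappa>)))
      \<le> dt * (G * P + 11 * C * M * P * (\<delta>3 + \<delta>2 + \<delta>1))"
    using dt_pos by (intro mult_left_mono) auto
  also have "\<dots> = dt * (G * P) + (\<delta>3 + \<delta>2 + \<delta>1) * (11 * C * M * dt * P)"
    by (simp add: algebra_simps)
  also have "\<dots> \<le> dt * (144 / \<nu> * G\<^sup>2 + \<nu> / 576 * P\<^sup>2) + (1/12 * (\<delta>3\<^sup>2 + \<delta>2\<^sup>2 + \<delta>1\<^sup>2) + dt * (\<nu> / 576 * P\<^sup>2))"
  proof (rule add_mono)
    show "dt * (G * P) \<le> dt * (144 / \<nu> * G\<^sup>2 + \<nu> / 576 * P\<^sup>2)"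
      using young_viscous[OF nu_pos] dt_pos by (intro mult_left_mono) auto
    have q: "1/36 * (3 * S) = 1/12 * S" for S :: real by simp
    \<comment> \<open>The weight 1/36 is a third of 1/12: squaring the sum of three increments costs
      a factor 3, and exactly the available 1/12 is spent.\<close>
    have "x * y \<le> 1/36 * x\<^sup>2 + 9 * y\<^sup>2" for x y :: real
      using sum_squares_bound[of "x / 6" "3 * y"] by (simp add: power_divide power_mult_distrib)
    then have "(\<delta>3 + \<delta>2 + \<delta>1) * (11 * C * M * dt * P)
        \<le> 1/36 * (\<delta>3 + \<delta>2 + \<delta>1)\<^sup>2 + 9 * (11 * C * M * dt * P)\<^sup>2" .
    also have "\<dots> \<le> 1/36 * (3 * (\<delta>3\<^sup>2 + \<delta>2\<^sup>2 + \<delta>1\<^sup>2)) + dt * (\<nu> / 576 * P\<^sup>2)"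
    proof (rule add_mono)
      show "1/36 * (\<delta>3 + \<delta>2 + \<delta>1)\<^sup>2 \<le> 1/36 * (3 * (\<delta>3\<^sup>2 + \<delta>2\<^sup>2 + \<delta>1\<^sup>2))"
        using sq_sum3_le[of \<delta>3 \<delta>2 \<delta>1] by simp
      have "9 * (11 * C * M * dt * P)\<^sup>2 = (dt * M\<^sup>2 * (627264 * C\<^sup>2)) * (dt * P\<^sup>2 / 576)"
        by (simp add: power2_eq_square)
      also have "\<dots> \<le> \<nu> * (dt * P\<^sup>2 / 576)"
        using small dt_pos unfolding C(2) by (intro mult_right_mono) auto
      finally show "9 * (11 * C * M * dt * P)\<^sup>2 \<le> dt * (\<nu> / 576 * P\<^sup>2)" by (simp add: mult_ac)
    qed
    finally show "(\<delta>3 + \<delta>2 + \<delta>1) * (11 * C * M * dt * P)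
        \<le> 1/12 * (\<delta>3\<^sup>2 + \<delta>2\<^sup>2 + \<delta>1\<^sup>2) + dt * (\<nu> / 576 * P\<^sup>2)" unfolding q .
  qed
  also have "\<dots> = 1/12 * (\<delta>3\<^sup>2 + \<delta>2\<^sup>2 + \<delta>1\<^sup>2) + \<nu> * dt / 288 * P\<^sup>2 + dt * (144 * G\<^sup>2 / \<nu>)"
    by (simp add: field_simps)
  also have "\<dots> \<le> 1/12 * (\<delta>3\<^sup>2 + \<delta>2\<^sup>2 + \<delta>1\<^sup>2)
      + \<nu> * dt / 16 * (diss 0 (n + 1) + diss 0 n + diss 0 (n - 1) + diss 0 (n - 2)) + dt * (144 * G\<^sup>2 / \<nu>)"
  proof (intro add_mono order_refl)
    \<comment> \<open>The two shares \<nu> / 576 add up to \<nu> / 288, and 18 / 288 = 1/16.\<close>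
    have "\<nu> * dt / 288 * P\<^sup>2 \<le> \<nu> * dt / 288 * (18 * (diss 0 (n + 1) + diss 0 n))"
      using test_bound[of 1 n] nu_pos dt_pos by (intro mult_left_mono) (auto simp: P_def)
    also have "\<dots> = \<nu> * dt / 16 * (diss 0 (n + 1) + diss 0 n)" by simp
    also have "\<dots> \<le> \<nu> * dt / 16 * (diss 0 (n + 1) + diss 0 n + diss 0 (n - 1) + diss 0 (n - 2))"
      using nu_pos dt_pos by (intro mult_left_mono) auto
    finally show "\<nu> * dt / 288 * P\<^sup>2 \<le> \<nu> * dt / 16 * (diss 0 (n + 1) + diss 0 n + diss 0 (n - 1) + diss 0 (n - 2))" .
  qed
  finally show "dt * (\<Sum>\<kappa>\<in>modes K. rad \<kappa> ^ (2 * 0) * Re (rhs n \<kappa> * cnj (test n \<kappa>)))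
      \<le> 1/12 * ((incr 0 (n + 1))\<^sup>2 + (incr 0 n)\<^sup>2 + (incr 0 (n - 1))\<^sup>2)
        + \<nu> * dt / 16 * (diss 0 (n + 1) + diss 0 n + diss 0 (n - 1) + diss 0 (n - 2)) + dt * (144 * G\<^sup>2 / \<nu>)"
    unfolding \<delta>3_def \<delta>2_def \<delta>1_def .
qed

end

section \<open>Uniform bounds for the Fourier coefficients\<close>

text \<open>An invariant level of the energy. The first summand bounds the initial energy when
  \<open>diss\<close> is at most \<open>Y\<close> on the three initial levels; the second is the
  threshold demanded by \<open>energy_decay\<close>.\<close>

definition level_bound :: "(nat \<Rightarrow> real) \<Rightarrow> real \<Rightarrow> real \<Rightarrow> real \<Rightarrow> real \<Rightarrow> real" where
  "level_bound \<alpha> \<nu> Y G B =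
     3 * bdf3_const \<alpha> * Y + 16 * bdf3_const \<alpha> * (576 * G\<^sup>2 / \<nu> + 3888 * B / \<nu>) / \<nu>"

text \<open>Division by the square of \<open>\<alpha> 1\<close> passes from energy to norm; the
  summand \<open>Y\<close> covers the levels -1 and -2, which are controlled by the data instead of
  the energy.\<close>

definition norm_bound :: "(nat \<Rightarrow> real) \<Rightarrow> real \<Rightarrow> real \<Rightarrow> real \<Rightarrow> real \<Rightarrow> real" where
  "norm_bound \<alpha> \<nu> Y G B = level_bound \<alpha> \<nu> Y G B / (\<alpha> 1)\<^sup>2 + Y"

text \<open>
  The fraction of the dissipation that the nonlinear term may consume is \<open>\<nu>\<^sup>2 / 41472\<close>;
  \<open>B\<close> above is what remains of the nonlinear term after this absorption.
\<close>

definition H1_bound :: "(nat \<Rightarrow> real) \<Rightarrow> real \<Rightarrow> real \<Rightarrow> real \<Rightarrow> real" where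
  "H1_bound \<alpha> \<nu> Y G = norm_bound \<alpha> \<nu> Y G
     (6 ^ 8 * lattice_bound ^ 4 * norm_bound \<alpha> \<nu> Y G 0 ^ 5 / (\<nu>\<^sup>2 / 41472) ^ 3)"

text \<open>The index is shifted: the value at \<open>s\<close> bounds the squared H^(s+1) norm, so
  the recursion starts at H1.\<close>

primrec sob_bound :: "(nat \<Rightarrow> real) \<Rightarrow> real \<Rightarrow> real \<Rightarrow> real \<Rightarrow> nat \<Rightarrow> real" where
  "sob_bound \<alpha> \<nu> Y G 0 = H1_bound \<alpha> \<nu> Y G"
| "sob_bound \<alpha> \<nu> Y G (Suc s) = norm_bound \<alpha> \<nu> Y G
     ((12 * 2 ^ Suc s * sqrt lattice_bound) ^ 4 * sob_bound \<alpha> \<nu> Y G s ^ 3 / (\<nu>\<^sup>2 / 41472))"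

lemma bdf3_const_pos: "bdf3_const \<alpha> > 0"
  using bdf3_const_ge[of \<alpha>] by linarith

lemma level_bound_mono:
  assumes "\<nu> > 0" "Y \<le> Y'" "0 \<le> G" "G \<le> G'" "B \<le> B'"
  shows "level_bound \<alpha> \<nu> Y G B \<le> level_bound \<alpha> \<nu> Y' G' B'"
  unfolding level_bound_def using assms bdf3_const_pos[of \<alpha>]
  by (intro add_mono mult_left_mono divide_right_mono power_mono) auto

lemma norm_bound_mono:
  assumes "\<nu> > 0" "Y \<le> Y'" "0 \<le> G" "G \<le> G'" "B \<le> B'"
  shows "norm_bound \<alpha> \<nu> Y G B \<le> norm_bound \<alpha> \<nu> Y' G' B'"
  unfolding norm_bound_def using level_bound_mono[OF assms] assms(2)
  by (intro add_mono divide_right_mono) auto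

lemma level_bound_nonneg: "\<nu> > 0 \<Longrightarrow> 0 \<le> Y \<Longrightarrow> 0 \<le> B \<Longrightarrow> 0 \<le> level_bound \<alpha> \<nu> Y G B"
  unfolding level_bound_def using bdf3_const_pos[of \<alpha>] by simp

lemma norm_bound_nonneg: "\<nu> > 0 \<Longrightarrow> 0 \<le> Y \<Longrightarrow> 0 \<le> B \<Longrightarrow> 0 \<le> norm_bound \<alpha> \<nu> Y G B"
  unfolding norm_bound_def using level_bound_nonneg by simp

lemma H1_bound_nonneg: "\<nu> > 0 \<Longrightarrow> 0 \<le> Y \<Longrightarrow> 0 \<le> H1_bound \<alpha> \<nu> Y G"
  unfolding H1_bound_def
  by (intro norm_bound_nonneg divide_nonneg_nonneg mult_nonneg_nonneg zero_le_power) auto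

lemma H1_bound_mono:
  assumes "\<nu> > 0" "0 \<le> Y" "Y \<le> Y'" "0 \<le> G" "G \<le> G'"
  shows "H1_bound \<alpha> \<nu> Y G \<le> H1_bound \<alpha> \<nu> Y' G'"
  unfolding H1_bound_def using assms
  by (intro norm_bound_mono divide_right_mono mult_left_mono power_mono norm_bound_nonneg zero_le_power) auto

lemma sob_bound_nonneg: "\<nu> > 0 \<Longrightarrow> 0 \<le> Y \<Longrightarrow> 0 \<le> sob_bound \<alpha> \<nu> Y G s"
proof (induction s)
  case 0 then show ?case by (simp add: H1_bound_nonneg)
next
  case (Suc s)
  then show ?case unfolding sob_bound.simps
    by (intro norm_bound_nonneg divide_nonneg_nonneg mult_nonneg_nonneg zero_le_power) auto
qed

text \<open>Young's inequality with exponents 4/3 and 4, without fractional powers: if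
  \<open>y\<close> exceeds \<open>\<epsilon> * D\<close>, then \<open>D\<close> is at most
  \<open>y / \<epsilon>\<close>, and the hypothesis bounds y^4 by a constant times y^3.\<close>

lemma absorb_cubic:
  fixes y :: real
  assumes "y ^ 4 \<le> A * D ^ 3" "0 \<le> y" "0 \<le> A" "0 \<le> D" "\<epsilon> > 0"
  shows "y \<le> \<epsilon> * D + A / \<epsilon> ^ 3"
proof (cases "y \<le> \<epsilon> * D")
  case True then show ?thesis using assms by (simp add: add_increasing2)
next
  case False
  moreover have "0 \<le> \<epsilon> * D" using assms by simp
  ultimately have y: "y > 0" by linarith
  have D: "D \<le> y / \<epsilon>" using False assms by (simp add: field_simps)
  have "y * y ^ 3 = y ^ 4" by (simp add: eval_nat_numeral)
  also have "\<dots> \<le> A * (y / \<epsilon>) ^ 3"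
    by (rule order_trans[OF assms(1)]) (intro mult_left_mono power_mono D assms)
  also have "\<dots> = A / \<epsilon> ^ 3 * y ^ 3" by (simp add: power_divide)
  finally have "y \<le> A / \<epsilon> ^ 3" by (rule mult_right_le_imp_le) (use y in simp)
  then show ?thesis using assms by (simp add: add_increasing)
qed

lemma absorb_linear:
  fixes y :: real
  assumes "y ^ 2 \<le> A * D" "0 \<le> y" "0 \<le> A" "0 \<le> D" "\<epsilon> > 0"
  shows "y \<le> \<epsilon> * D + A / \<epsilon>"
proof (cases "y \<le> \<epsilon> * D")
  case True then show ?thesis using assms by (simp add: add_increasing2)
next
  case False
  moreover have "0 \<le> \<epsilon> * D" using assms by simp
  ultimately have y: "y > 0" by linarith
  have D: "D \<le> y / \<epsilon>" using False assms by (simp add: field_simps)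
  have "y * y = y ^ 2" by (simp add: power2_eq_square)
  also have "\<dots> \<le> A * (y / \<epsilon>)"
    by (rule order_trans[OF assms(1)]) (intro mult_left_mono D assms)
  also have "\<dots> = A / \<epsilon> * y" by simp
  finally have "y \<le> A / \<epsilon>" using y by (rule mult_right_le_imp_le)
  then show ?thesis using assms by (simp add: add_increasing)
qed

section \<open>Bounds uniform in time, order by order\<close>

context bdf3_modes
begin

lemma alpha1_pos: "\<alpha> 1 > 0"
  using stencil by (simp add: bdf3_stencil_def)

lemma eps_pos: "\<nu>\<^sup>2 / 41472 > 0"
  using nu_pos by simp

lemma initial_energy:
  assumes "\<And>l. l \<in> {0, -1, -2} \<Longrightarrow> diss s l \<le> Y" "0 \<le> B"
  shows "energy s 0 \<le> level_bound \<alpha> \<nu> Y G B"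
proof -
  have "energy s 0 \<le> bdf3_const \<alpha> * (diss s 0 + diss s (-1) + diss s (-2))"
    using energy_upper[of 0 s] by simp
  also have "\<dots> \<le> bdf3_const \<alpha> * (Y + Y + Y)"
    using assms(1)[of 0] assms(1)[of "-1"] assms(1)[of "-2"] bdf3_const_pos[of \<alpha>]
    by (intro mult_left_mono add_mono) auto
  also have "\<dots> \<le> level_bound \<alpha> \<nu> Y G B"
    using nu_pos assms(2) bdf3_const_pos[of \<alpha>] by (simp add: level_bound_def)
  finally show ?thesis .
qed

lemma norm_le_of_energy:
  assumes "energy s n \<le> level_bound \<alpha> \<nu> Y G B" "0 \<le> Y"
  shows "(hc K s (w n))\<^sup>2 \<le> norm_bound \<alpha> \<nu> Y G B"
proof -
  have "(\<alpha> 1)\<^sup>2 * (hc K s (w n))\<^sup>2 \<le> level_bound \<alpha> \<nu> Y G B"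
    using energy_lower assms(1) by (rule order_trans)
  then have "(hc K s (w n))\<^sup>2 \<le> level_bound \<alpha> \<nu> Y G B / (\<alpha> 1)\<^sup>2"
    using alpha1_pos by (simp add: field_simps)
  then show ?thesis using assms(2) by (simp add: norm_bound_def)
qed

text \<open>Serves the guess levels, where the energy would reach back before level -2 and the bound
  has to come straight from the data.\<close>

lemma norm_le_of_initial:
  assumes "diss t n \<le> Y" "s \<le> Suc t" "n \<ge> -2" "0 \<le> B"
  shows "(hc K s (w n))\<^sup>2 \<le> norm_bound \<alpha> \<nu> Y G B"
proof -
  have "(hc K s (w n))\<^sup>2 \<le> Y"
    using assms w_0[of n] by (meson hc_mono_order hc_nonneg order_trans power_mono)
  moreover have "0 \<le> Y" using assms(1) by (meson order_trans zero_le_power2)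
  ultimately show ?thesis
    using level_bound_nonneg[OF nu_pos, of Y B \<alpha> G] assms(4) by (simp add: norm_bound_def add_increasing)
qed

text \<open>In squared norms the interpolated estimate bounds the fourth power of the left side by
  the cube of the dissipation, so any share of the latter absorbs it. What remains contains only the
  L2 bound \<open>L\<close>.\<close>

lemma nonlinear_L2:
  assumes "n \<ge> -2" "(hc K 0 (w n))\<^sup>2 \<le> L"
  shows "(hc K 0 (N n))\<^sup>2 \<le> \<nu>\<^sup>2 / 41472 * diss 1 n + 6 ^ 8 * lattice_bound ^ 4 * L ^ 5 / (\<nu>\<^sup>2 / 41472) ^ 3"
proof (rule absorb_cubic)
  have "((hc K 0 (N n))\<^sup>2) ^ 4 = hc K 0 (N n) ^ 8" by (simp flip: power_mult)
  also have "\<dots> \<le> (6 ^ 8 * lattice_bound ^ 4) * (hc K 0 (w n) ^ 10 * hc K 2 (w n) ^ 6)"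
    using transport_interpolated[OF transport[OF assms(1)]] by (simp add: hc_def)
  also have "hc K 0 (w n) ^ 10 * hc K 2 (w n) ^ 6 = ((hc K 0 (w n))\<^sup>2) ^ 5 * diss 1 n ^ 3"
  proof -
    have "diss 1 n = (hc K 2 (w n))\<^sup>2" by (simp add: numeral_2_eq_2)
    then show ?thesis by (simp only:) (simp flip: power_mult)
  qed
  also have "(6 ^ 8 * lattice_bound ^ 4) * \<dots> \<le> (6 ^ 8 * lattice_bound ^ 4) * (L ^ 5 * diss 1 n ^ 3)"
    using assms(2) by (intro mult_left_mono mult_right_mono power_mono) auto
  finally show "((hc K 0 (N n))\<^sup>2) ^ 4 \<le> 6 ^ 8 * lattice_bound ^ 4 * L ^ 5 * diss 1 n ^ 3"
    by (simp only: mult.assoc)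
  have "0 \<le> L" using assms(2) by (meson order_trans zero_le_power2)
  then show "0 \<le> 6 ^ 8 * lattice_bound ^ 4 * L ^ 5" by simp
qed (use eps_pos in auto)

text \<open>Interpolating order s + 2 between s + 1 and s + 3 makes the square of the left side
  linear in the dissipation, with the factor L^3.\<close>

lemma nonlinear_higher:
  assumes "n \<ge> -2" "(hc K (Suc s) (w n))\<^sup>2 \<le> L"
  shows "(hc K (Suc s) (N n))\<^sup>2 \<le> \<nu>\<^sup>2 / 41472 * diss (Suc (Suc s)) n
    + (12 * 2 ^ Suc s * sqrt lattice_bound) ^ 4 * L ^ 3 / (\<nu>\<^sup>2 / 41472)"
proof (rule absorb_linear)
  let ?c = "12 * 2 ^ Suc s * sqrt lattice_bound"
  let ?p = "hc K (Suc s) (w n)" and ?q = "hc K (Suc (Suc s)) (w n)"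
  have q: "?q\<^sup>2 \<le> ?p * hc K (Suc (Suc (Suc s))) (w n)"
    using hs_interpolation_Suc[of K "Suc s" "\<lambda>\<kappa>. cmod (w n \<kappa>)"] by (simp add: hc_def)
  have "((hc K (Suc s) (N n))\<^sup>2)\<^sup>2 = hc K (Suc s) (N n) ^ 4" by (simp flip: power_mult)
  also have "\<dots> \<le> (?c * (?p * ?q)) ^ 4"
    using transport_higher[OF transport[OF assms(1)], of "Suc s"] by (intro power_mono) (simp_all add: hc_def)
  also have "\<dots> = ?c ^ 4 * (?p ^ 4 * (?q\<^sup>2)\<^sup>2)" by (simp only: power_mult_distrib) (simp flip: power_mult)
  also have "\<dots> \<le> ?c ^ 4 * (?p ^ 4 * (?p * hc K (Suc (Suc (Suc s))) (w n))\<^sup>2)"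
    using q by (intro mult_left_mono power_mono) auto
  also have "\<dots> = ?c ^ 4 * ((?p\<^sup>2) ^ 3 * diss (Suc (Suc s)) n)"
    by (simp add: power_mult_distrib flip: power_mult power_add)
  also have "\<dots> \<le> ?c ^ 4 * (L ^ 3 * diss (Suc (Suc s)) n)"
    using assms(2) by (intro mult_left_mono mult_right_mono power_mono) auto
  finally show "((hc K (Suc s) (N n))\<^sup>2)\<^sup>2 \<le> ?c ^ 4 * L ^ 3 * diss (Suc (Suc s)) n"
    by (simp only: mult.assoc)
  have "0 \<le> L" using assms(2) by (meson order_trans zero_le_power2)
  then show "0 \<le> ?c ^ 4 * L ^ 3" by simp
qed (use eps_pos in auto)

text \<open>The energy of order 0 advances with the H1 bound on the past levels, the energy of order
  1 with their L2 bound. The data fix \<open>L\<close>, which fixes \<open>B\<close>, which fixes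
  \<open>M\<close>, so the time step condition refers to a constant known in advance. The data are
  measured in H2, the dissipation norm of order 1.\<close>

lemma H1_bounded:
  assumes Y: "\<And>l. l \<in> {0, -1, -2} \<Longrightarrow> (hc K 2 (w l))\<^sup>2 \<le> Y"
    and G: "\<And>n. n \<ge> 1 \<Longrightarrow> hc K 0 (g n) \<le> G"
    and small: "dt * H1_bound \<alpha> \<nu> Y G * (627264 * (36 * lattice_bound)) \<le> \<nu>"
    and n: "n \<ge> -2"
  shows "(hc K 1 (w n))\<^sup>2 \<le> H1_bound \<alpha> \<nu> Y G"
proof -
  define L where "L = norm_bound \<alpha> \<nu> Y G 0"
  define B where "B = 6 ^ 8 * lattice_bound ^ 4 * L ^ 5 / (\<nu>\<^sup>2 / 41472) ^ 3"
  define M where "M = sqrt (H1_bound \<alpha> \<nu> Y G)"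
  have Y0: "0 \<le> Y" using Y[of 0] by (meson insertI1 order_trans zero_le_power2)
  have L: "L \<ge> 0" unfolding L_def by (intro norm_bound_nonneg nu_pos Y0) simp
  have B: "B \<ge> 0" unfolding B_def using L by simp
  have H: "H1_bound \<alpha> \<nu> Y G = norm_bound \<alpha> \<nu> Y G B" by (simp add: H1_bound_def B_def L_def)
  have M: "M\<^sup>2 = H1_bound \<alpha> \<nu> Y G" "M \<ge> 0"
    unfolding M_def using H1_bound_nonneg[OF nu_pos Y0] by simp_all
  have d: "diss 1 l \<le> Y" if "l \<in> {0, -1, -2}" for l
    using Y[OF that] by (simp add: numeral_2_eq_2)
  have d0: "diss 0 l \<le> Y" if "l \<in> {0, -1, -2}" for l
  proof -
    have "hc K 1 (w l) \<le> hc K 2 (w l)" by (rule hc_mono_order) auto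
    then have "(hc K 1 (w l))\<^sup>2 \<le> (hc K 2 (w l))\<^sup>2" by (rule power_mono) simp
    from order_trans[OF this Y[OF that]] show ?thesis by simp
  qed
  have low: "(hc K 0 (w l))\<^sup>2 \<le> L \<and> (hc K 1 (w l))\<^sup>2 \<le> M\<^sup>2"
    if "-2 \<le> l" "l \<ge> 0 \<Longrightarrow> energy 0 l \<le> level_bound \<alpha> \<nu> Y G 0 \<and> energy 1 l \<le> level_bound \<alpha> \<nu> Y G B" for l
  proof (cases "l \<ge> 0")
    case True
    then show ?thesis
      unfolding L_def M(1) H using that norm_le_of_energy Y0 by blast
  next
    case False
    then have l: "l \<in> {0, -1, -2}" using that(1) by auto
    show ?thesis unfolding L_def M(1) H
      using norm_le_of_initial[OF d[OF l] _ that(1), of 0 0 G] norm_le_of_initial[OF d[OF l] _ that(1) B, of 1 G] by simp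
  qed
  \<comment> \<open>All levels up to \<open>k\<close> are carried along because the scheme reads
    three of them.\<close>
  have main: "\<forall>m. 0 \<le> m \<and> m \<le> int k \<longrightarrow> energy 0 m \<le> level_bound \<alpha> \<nu> Y G 0 \<and> energy 1 m \<le> level_bound \<alpha> \<nu> Y G B" for k
  proof (induction k)
    case 0
    have "energy 0 0 \<le> level_bound \<alpha> \<nu> Y G 0" by (rule initial_energy[OF d0]) simp_all
    moreover have "energy 1 0 \<le> level_bound \<alpha> \<nu> Y G B" by (rule initial_energy[OF d B])
    moreover have "m = 0" if "0 \<le> m" "m \<le> int 0" for m using that by simp
    ultimately show ?case by blast
  next
    case (Suc k)
    define n where "n = int k"
    have n: "n \<ge> 0" by (simp add: n_def)
    have IH: "energy 0 m \<le> level_bound \<alpha> \<nu> Y G 0 \<and> energy 1 m \<le> level_bound \<alpha> \<nu> Y G B" if "0 \<le> m" "m \<le> n" for m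
      using Suc that by (simp add: n_def)
    have l0: "(hc K 0 (w l))\<^sup>2 \<le> L" and l1: "(hc K 1 (w l))\<^sup>2 \<le> M\<^sup>2" if "l \<in> {n, n - 1, n - 2}" for l
      using low[of l] IH[of l] that n by auto
    have "energy 0 (n + 1) \<le> level_bound \<alpha> \<nu> Y G 0"
    proof (rule energy_bound_0[OF n G l1 M(2)])
      show "dt * M\<^sup>2 * (627264 * (36 * lattice_bound)) \<le> \<nu>" using small by (simp only: M(1))
      \<comment> \<open>Order 0 asks for 144 only; enlarging it to 576 allows one
        \<open>level_bound\<close> for both orders.\<close>
      have "16 * bdf3_const \<alpha> * (144 * G\<^sup>2 / \<nu>) / \<nu> \<le> 16 * bdf3_const \<alpha> * (576 * G\<^sup>2 / \<nu> + 3888 * 0 / \<nu>) / \<nu>"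
        using nu_pos bdf3_const_pos[of \<alpha>] by (intro divide_right_mono mult_left_mono) (auto simp: divide_right_mono)
      also have "\<dots> \<le> level_bound \<alpha> \<nu> Y G 0"
        using Y0 bdf3_const_pos[of \<alpha>] by (simp add: level_bound_def)
      finally show "16 * bdf3_const \<alpha> * (144 * G\<^sup>2 / \<nu>) / \<nu> \<le> level_bound \<alpha> \<nu> Y G 0" .
    qed (use n IH[of n] in auto)
    moreover have "energy (Suc 0) (n + 1) \<le> level_bound \<alpha> \<nu> Y G B"
    proof (rule energy_bound_Suc[OF n G])
      show "16 * bdf3_const \<alpha> * (576 * G\<^sup>2 / \<nu> + 3888 * B / \<nu>) / \<nu> \<le> level_bound \<alpha> \<nu> Y G B"
        using Y0 bdf3_const_pos[of \<alpha>] by (simp add: level_bound_def)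
      fix l assume l: "l \<in> {n, n - 1, n - 2}"
      show "(hc K 0 (N l))\<^sup>2 \<le> \<nu>\<^sup>2 / 41472 * diss (Suc 0) l + B"
        using nonlinear_L2[OF _ l0[OF l]] l n by (auto simp: B_def)
    qed (use n IH[of n] in auto)
    ultimately have "energy 0 (n + 1) \<le> level_bound \<alpha> \<nu> Y G 0 \<and> energy 1 (n + 1) \<le> level_bound \<alpha> \<nu> Y G B" by simp
    moreover have "m \<le> n \<or> m = n + 1" if "m \<le> int (Suc k)" for m using that by (auto simp: n_def)
    ultimately show ?case using IH by metis
  qed
  have "(hc K 1 (w n))\<^sup>2 \<le> M\<^sup>2"
    using low[OF n] main[of "nat n"] by simp
  then show ?thesis by (simp only: M(1))
qed

text \<open>Outer induction on the order, inner induction on time. The nonlinear term at the new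
  order is controlled by the previous order at all times, so the inner induction advances one level
  at a time. \<open>t\<close> is the top order, so that one \<open>Y\<close> bounds the initial data
  at every order.\<close>

lemma sob_bounded:
  assumes Y: "\<And>l. l \<in> {0, -1, -2} \<Longrightarrow> (hc K (t + 2) (w l))\<^sup>2 \<le> Y"
    and G: "\<And>n j. n \<ge> 1 \<Longrightarrow> j \<le> t \<Longrightarrow> hc K j (g n) \<le> G"
    and H1: "\<And>n. n \<ge> -2 \<Longrightarrow> (hc K 1 (w n))\<^sup>2 \<le> H1_bound \<alpha> \<nu> Y G"
    and st: "s \<le> t"
  shows "n \<ge> -2 \<Longrightarrow> (hc K (Suc s) (w n))\<^sup>2 \<le> sob_bound \<alpha> \<nu> Y G s"
  using st
proof (induction s arbitrary: n)
  case 0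
  then show ?case using H1 by simp
next
  case (Suc s)
  define B where "B = (12 * 2 ^ Suc s * sqrt lattice_bound) ^ 4 * sob_bound \<alpha> \<nu> Y G s ^ 3 / (\<nu>\<^sup>2 / 41472)"
  have Y0: "0 \<le> Y" using Y[of 0] by (meson insertI1 order_trans zero_le_power2)
  have B: "B \<ge> 0" unfolding B_def using sob_bound_nonneg[OF nu_pos Y0] by simp
  have d: "diss (Suc (Suc s)) l \<le> Y" if "l \<in> {0, -1, -2}" for l
  proof -
    have "hc K (Suc (Suc (Suc s))) (w l) \<le> hc K (t + 2) (w l)"
      using Suc.prems by (intro hc_mono_order) auto
    then have "(hc K (Suc (Suc (Suc s))) (w l))\<^sup>2 \<le> (hc K (t + 2) (w l))\<^sup>2" by (rule power_mono) simp
    from order_trans[OF this Y[OF that]] show ?thesis by simp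
  qed
  have E: "energy (Suc (Suc s)) (int k) \<le> level_bound \<alpha> \<nu> Y G B" for k
  proof (induction k)
    case 0
    show ?case using initial_energy[of "Suc (Suc s)" Y B G] d B by simp
  next
    case (Suc k)
    have k: "int k \<ge> 0" by simp
    have "energy (Suc (Suc s)) (int k + 1) \<le> level_bound \<alpha> \<nu> Y G B"
    proof (rule energy_bound_Suc[OF k _ _ Suc])
      show "16 * bdf3_const \<alpha> * (576 * G\<^sup>2 / \<nu> + 3888 * B / \<nu>) / \<nu> \<le> level_bound \<alpha> \<nu> Y G B"
        using Y0 bdf3_const_pos[of \<alpha>] by (simp add: level_bound_def)
      show "hc K (Suc s) (g (int k + 1)) \<le> G" using \<open>Suc s \<le> t\<close> by (intro G) auto
      fix l assume "l \<in> {int k, int k - 1, int k - 2}"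
      then have "l \<ge> -2" by auto
      then show "(hc K (Suc s) (N l))\<^sup>2 \<le> \<nu>\<^sup>2 / 41472 * diss (Suc (Suc s)) l + B"
        unfolding B_def using \<open>Suc s \<le> t\<close> by (intro nonlinear_higher \<open>\<And>n. - 2 \<le> n \<Longrightarrow> s \<le> t \<Longrightarrow> _ n\<close>) auto
    qed
    then show ?case by (simp add: add.commute)
  qed
  have "(hc K (Suc (Suc s)) (w n))\<^sup>2 \<le> norm_bound \<alpha> \<nu> Y G B"
  proof (cases "n \<ge> 0")
    case True
    then show ?thesis using E[of "nat n"] Y0 by (intro norm_le_of_energy) auto
  next
    case False
    then have "n \<in> {0, -1, -2}" using Suc.prems(1) by auto
    then show ?thesis using norm_le_of_initial[OF d _ Suc.prems(1) B] by simp
  qed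
  then show ?case by (simp add: B_def)
qed

end

section \<open>The scheme\<close>

lemma grid_fun_nonlin:
  assumes "grid_fun K (fst u)" "grid_fun K (snd u)"
  shows "grid_fun K (nonlin K u f)"
proof -
  have "grid_fun K (DNx K h)" "grid_fun K (DNy K h)" for h by simp_all
  then show ?thesis
    using assms by (simp add: nonlin_def advect_def divN_def grid_fun_def)
qed

text \<open>Skew-symmetry moves the nonlinear term from \<open>w\<close> to \<open>g\<close>, and
  its value on \<open>g\<close> paired with \<open>g\<close> vanishes, so \<open>w\<close> may be
  replaced by \<open>w - g\<close>. With \<open>g\<close> the test function this difference is made
  of increments.\<close>

lemma nonlin_skew_bound:
  assumes kin: "kinematic K w psi u" and g: "grid_fun K g" "dft K g 0 = 0"
  shows "\<bar>\<Sum>\<kappa>\<in>modes K. Re (dft K (nonlin K u w) \<kappa> * cnj (dft K g \<kappa>))\<bar>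
    \<le> 6 * sqrt lattice_bound * (hc K 1 (dft K w) * hc K 1 (dft K g)) * hc K 0 (\<lambda>\<kappa>. dft K w \<kappa> - dft K g \<kappa>)"
proof -
  note u = kinematic_velocity(1,2)[OF kin]
  have w: "grid_fun K w" using kin by (simp add: kinematic_def)
  have avg: "avgN K w = 0" "avgN K g = 0"
    using avgN_dft[of K w] avgN_dft[of K g] kinematic_dft_0[OF kin] g(2) by simp_all
  have "(\<Sum>\<kappa>\<in>modes K. Re (dft K (nonlin K u w) \<kappa> * cnj (dft K g \<kappa>))) = innerN K (nonlin K u w) g"
    by (simp only: parseval[OF grid_fun_nonlin[OF u]] Re_sum)
  also have "\<dots> = - innerN K (nonlin K u g) w"
    by (rule nonlin_skew[OF u w g(1) avg])
  also have "\<dots> = - innerN K (nonlin K u g) (\<lambda>i j. w i j - g i j)"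
    using nonlin_skew[OF u g(1) g(1) avg(2) avg(2)] by (simp add: innerN_diff_right)
  also have "\<bar>\<dots>\<bar> \<le> hc K 0 (dft K (nonlin K u g)) * hc K 0 (\<lambda>\<kappa>. dft K w \<kappa> - dft K g \<kappa>)"
    using sum_Re_mult_cnj_le[where s = 0 and t = 0 and c = "dft K (nonlin K u g)" and d = "\<lambda>\<kappa>. dft K w \<kappa> - dft K g \<kappa>" and K = K]
    by (simp only: abs_minus_cancel parseval[OF grid_fun_nonlin[OF u]] Re_sum dft_diff power_0 mult_1 add_0)
  also have "\<dots> \<le> 6 * sqrt lattice_bound * (hc K 1 (dft K w) * hc K 1 (dft K g)) * hc K 0 (\<lambda>\<kappa>. dft K w \<kappa> - dft K g \<kappa>)"
    using transport_bilinear[OF nonlin_transport_dominated[OF kin g(2,1)]]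
    by (intro mult_right_mono) (simp_all add: hc_def)
  finally show ?thesis .
qed

lemma imex_bdf3_modes:
  assumes "bdf3_stencil \<alpha>" "\<nu> > 0" "dt > 0" "\<nu> * dt \<le> 1"
    and sch: "imex_bdf3 K \<nu> dt \<omega>0 f \<omega> \<psi> u"
  shows "bdf3_modes \<alpha> K \<nu> dt (\<lambda>n. dft K (\<omega> n)) (\<lambda>n. dft K (nonlin K (u n) (\<omega> n)))
    (\<lambda>n. dft K (restrictN K (fproj K (f (of_int n * dt)))))"
proof
  have kin: "kinematic K (\<omega> n) (\<psi> n) (u n)" if "n \<ge> - 2" for n
    using sch that by (simp add: imex_bdf3_def)
  have gr: "grid_fun K (\<omega> n)" if "n \<ge> - 2" for n
    using kin[OF that] by (simp add: kinematic_def)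
  show "dft K (\<omega> n) 0 = 0" if "n \<ge> - 2" for n
    using kinematic_dft_0[OF kin[OF that]] .
  show "transport_dominated K (\<lambda>\<kappa>. cmod (dft K (\<omega> n) \<kappa>)) (\<lambda>\<kappa>. cmod (dft K (\<omega> n) \<kappa>)) (\<lambda>\<kappa>. cmod (dft K (nonlin K (u n) (\<omega> n)) \<kappa>))"
    if "n \<ge> - 2" for n
    by (rule nonlin_transport_dominated[OF kin[OF that] kinematic_dft_0[OF kin[OF that]] gr[OF that]])
  show "11/6 * dft K (\<omega> (n + 1)) \<kappa> - 3 * dft K (\<omega> n) \<kappa> + 3/2 * dft K (\<omega> (n - 1)) \<kappa> - 1/3 * dft K (\<omega> (n - 2)) \<kappa>
        + of_real (\<nu> * dt * (rad \<kappa>)\<^sup>2) * dft K (\<omega> (n + 1)) \<kappa>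
      = of_real dt * (dft K (restrictN K (fproj K (f (of_int (n + 1) * dt)))) \<kappa>
          - (3/2 * dft K (nonlin K (u n) (\<omega> n)) \<kappa> - 3/2 * dft K (nonlin K (u (n - 1)) (\<omega> (n - 1))) \<kappa>
             + 1/2 * dft K (nonlin K (u (n - 2)) (\<omega> (n - 2))) \<kappa>))"
    if n: "n \<ge> 0" and \<kappa>: "\<kappa> \<in> modes K" for n \<kappa>
  proof -
    let ?g = "restrictN K (fproj K (f (of_int (n + 1) * dt)))"
    define N where "N = (\<lambda>l. nonlin K (u l) (\<omega> l))"
    have "(\<lambda>i j. (11/6 * \<omega> (n + 1) i j - 3 * \<omega> n i j + 3/2 * \<omega> (n - 1) i j - 1/3 * \<omega> (n - 2) i j) / dt
        + 3/2 * N n i j - 3/2 * N (n - 1) i j + 1/2 * N (n - 2) i j)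
        = (\<lambda>i j. \<nu> * lapN K (\<omega> (n + 1)) i j + ?g i j)"
      using sch n by (simp add: imex_bdf3_def N_def)
    then have "dft K (\<lambda>i j. (11/6 * \<omega> (n + 1) i j - 3 * \<omega> n i j + 3/2 * \<omega> (n - 1) i j - 1/3 * \<omega> (n - 2) i j) / dt
        + 3/2 * N n i j - 3/2 * N (n - 1) i j + 1/2 * N (n - 2) i j) \<kappa>
        = dft K (\<lambda>i j. \<nu> * lapN K (\<omega> (n + 1)) i j + ?g i j) \<kappa>"
      by simp
    then have e: "(11/6 * dft K (\<omega> (n + 1)) \<kappa> - 3 * dft K (\<omega> n) \<kappa> + 3/2 * dft K (\<omega> (n - 1)) \<kappa> - 1/3 * dft K (\<omega> (n - 2)) \<kappa>) / of_real dt
        + 3/2 * dft K (N n) \<kappa> - 3/2 * dft K (N (n - 1)) \<kappa> + 1/2 * dft K (N (n - 2)) \<kappa>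
        = of_real \<nu> * (- of_real ((rad \<kappa>)\<^sup>2) * dft K (\<omega> (n + 1)) \<kappa>) + dft K ?g \<kappa>"
      unfolding dft_add dft_diff dft_divide dft_cmult dft_lapN[OF \<kappa>] by simp
    have dt: "complex_of_real dt \<noteq> 0" using \<open>dt > 0\<close> by simp
    have "x + of_real (\<nu> * dt * (rad \<kappa>)\<^sup>2) * w = of_real dt * (g - (a - b + c))"
      if "x / of_real dt + a - b + c = of_real \<nu> * (- of_real ((rad \<kappa>)\<^sup>2) * w) + g" for x a b c w g :: complex
    proof -
      have "x = of_real dt * (x / of_real dt)" using dt by simp
      also have "x / of_real dt = of_real \<nu> * (- of_real ((rad \<kappa>)\<^sup>2) * w) + g - a + b - c"
        using that by (simp add: algebra_simps)
      finally show ?thesis by (simp add: algebra_simps)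
    qed
    from this[OF e] show ?thesis by (simp only: N_def)
  qed
  show "\<bar>\<Sum>\<kappa>\<in>modes K. Re (dft K (nonlin K (u l) (\<omega> l)) \<kappa> * cnj (3 * dft K (\<omega> (n + 1)) \<kappa> - 2 * dft K (\<omega> n) \<kappa>))\<bar>
      \<le> 6 * sqrt lattice_bound * (hc K 1 (dft K (\<omega> l)) * hc K 1 (\<lambda>\<kappa>. 3 * dft K (\<omega> (n + 1)) \<kappa> - 2 * dft K (\<omega> n) \<kappa>))
        * hc K 0 (\<lambda>\<kappa>. dft K (\<omega> l) \<kappa> - (3 * dft K (\<omega> (n + 1)) \<kappa> - 2 * dft K (\<omega> n) \<kappa>))"
    if n: "n \<ge> 0" and l: "l \<in> {n, n - 1, n - 2}" for n l
  proof -
    define g where "g = (\<lambda>i j. 3 * \<omega> (n + 1) i j - 2 * \<omega> n i j)"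
    have g: "dft K g = (\<lambda>\<kappa>. 3 * dft K (\<omega> (n + 1)) \<kappa> - 2 * dft K (\<omega> n) \<kappa>)"
      unfolding g_def fun_eq_iff dft_diff dft_cmult by simp
    have l2: "l \<ge> - 2" using l n by auto
    have gg: "grid_fun K g" using gr[of n] gr[of "n + 1"] n by (simp add: g_def grid_fun_def)
    have g0: "dft K g 0 = 0"
      using kinematic_dft_0[OF kin[of n]] kinematic_dft_0[OF kin[of "n + 1"]] n by (simp add: g)
    from nonlin_skew_bound[OF kin[OF l2] gg g0] show ?thesis by (simp only: g)
  qed
qed (use assms in auto)

section \<open>Bounds from the data and the choice of constants\<close>

lemma G0_nonneg: "\<nu> > 0 \<Longrightarrow> dt > 0 \<Longrightarrow> 0 \<le> G0 \<alpha> K s \<nu> dt \<omega>"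
  unfolding G0_def by (intro add_nonneg_nonneg mult_nonneg_nonneg) auto

lemma LinfH_bounds:
  assumes "f \<in> LinfH m" "t > 0"
  shows "f t \<in> Hper m" "normH m (f t) \<le> normLinfH m f" "normL2 [f t] \<le> normLinfL2 f"
proof -
  show "f t \<in> Hper m" using assms by (simp add: LinfH_def)
  have b: "bdd_above ((\<lambda>t. normH m (f t)) ` {0<..})" using assms(1) by (simp add: LinfH_def)
  show "normH m (f t) \<le> normLinfH m f"
    unfolding normLinfH_def using assms(2) by (intro cSUP_upper b) simp
  have "bdd_above ((\<lambda>t. normL2 [f t]) ` {0<..})"
    using b normL2_le_normH unfolding bdd_above_def by (metis (no_types, lifting) image_iff order_trans)
  then show "normL2 [f t] \<le> normLinfL2 f"
    unfolding normLinfL2_def using assms(2) by (intro cSUP_upper) auto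
qed

text \<open>Order 0 goes through Bessel's inequality, since in \<open>normH\<close> the L2 part is
  an integral and only the orders from 1 on are sums over modes.\<close>

lemma hc_force_le:
  assumes "f \<in> LinfH m" "t > 0"
  shows "j \<le> m \<Longrightarrow> hc K j (dft K (restrictN K (fproj K (f t)))) \<le> normLinfH m f"
    and "hc K 0 (dft K (restrictN K (fproj K (f t)))) \<le> normLinfL2 f"
proof -
  note b = LinfH_bounds[OF assms]
  have e: "hc K j (dft K (restrictN K (fproj K (f t)))) = hs K j (\<lambda>\<kappa>. cmod (fourier (f t) \<kappa>))" for j
    unfolding hc_def hs_def by (intro L2_set_cong refl) (simp add: dft_restrict_fproj)
  have z: "hs K 0 (\<lambda>\<kappa>. cmod (fourier (f t) \<kappa>)) \<le> normL2 [f t]" by (rule bessel[OF b(1)])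
  then show "hc K 0 (dft K (restrictN K (fproj K (f t)))) \<le> normLinfL2 f" unfolding e using b(3) by linarith
  assume j: "j \<le> m"
  have "hs K j (\<lambda>\<kappa>. cmod (fourier (f t) \<kappa>)) \<le> normH m (f t)"
  proof (cases "j = 0")
    case True
    then show ?thesis using order_trans[OF z normL2_le_normH] by simp
  next
    case False
    then show ?thesis
      using b(1) j by (intro hs_fourier_le_normH[OF sob_term_summable_mono[of m]]) (auto simp: Hper_def)
  qed
  then show "hc K j (dft K (restrictN K (fproj K (f t)))) \<le> normLinfH m f" unfolding e using b(2) by linarith
qed

lemma uniform_Sobolev_bound:
  assumes st: "bdf3_stencil \<alpha>" and pos: "\<nu> > 0" "dt > 0"
    and \<omega>0: "\<omega>0 \<in> Hper (Suc t + 1)" and f: "f \<in> LinfH t"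
    and sch: "imex_bdf3 K \<nu> dt \<omega>0 f \<omega> \<psi> u"
    and b: "normHN K 2 (\<omega> (- 1)) \<le> b" "normHN K 2 (\<omega> (- 2)) \<le> b"
    and B: "normHN K (Suc t + 1) (\<omega> (- 1)) \<le> B" "normHN K (Suc t + 1) (\<omega> (- 2)) \<le> B"
    and nudt: "\<nu> * dt \<le> 1"
    and small: "dt * H1_bound \<alpha> \<nu> ((normH 2 \<omega>0)\<^sup>2 + b\<^sup>2) (normLinfL2 f) * (627264 * (36 * lattice_bound)) \<le> \<nu>"
  shows "(hc K (Suc t) (dft K (\<omega> (int n))))\<^sup>2
    \<le> sob_bound \<alpha> \<nu> ((normHN K (Suc t + 1) (\<omega> 0))\<^sup>2 + B\<^sup>2) (normLinfH t f) t"
proof -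
  interpret bdf3_modes \<alpha> K \<nu> dt "\<lambda>n. dft K (\<omega> n)" "\<lambda>n. dft K (nonlin K (u n) (\<omega> n))"
    "\<lambda>n. dft K (restrictN K (fproj K (f (of_int n * dt))))"
    by (rule imex_bdf3_modes[OF st pos nudt sch])
  define Y1 Y2 G1 G2 where "Y1 = (normH 2 \<omega>0)\<^sup>2 + b\<^sup>2" and "Y2 = (normHN K (Suc t + 1) (\<omega> 0))\<^sup>2 + B\<^sup>2"
    and "G1 = normLinfL2 f" and "G2 = normLinfH t f"
  have G: "0 \<le> G1" "0 \<le> G2"
    unfolding G1_def G2_def using LinfH_bounds(2,3)[OF f, of 1] normH_nonneg[of t "f 1"] normL2_nonneg[of "[f 1]"]
    by linarith+
  have Y: "0 \<le> Y1" "0 \<le> Y2" by (simp_all add: Y1_def Y2_def)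
  have sq: "x\<^sup>2 \<le> p\<^sup>2 + q\<^sup>2" "x\<^sup>2 \<le> q\<^sup>2 + p\<^sup>2" if "x \<le> p" "0 \<le> x" for x p q :: real
    using power_mono[OF that, of 2] by (simp_all add: add_increasing2 add_increasing)
  have hN: "hc K j (dft K (\<omega> l)) \<le> normHN K m (\<omega> l)" if "1 \<le> j" "j \<le> m" for j m l
    unfolding hc_def by (rule hs_le_normHN[OF that])
  have Y1: "(hc K 2 (dft K (\<omega> l)))\<^sup>2 \<le> Y1" if "l \<in> {0, -1, -2}" for l
  proof (cases "l = 0")
    case True
    have "\<omega> 0 = restrictN K (fproj K \<omega>0)" using sch by (simp add: imex_bdf3_def)
    then have "hc K 2 (dft K (\<omega> 0)) = hs K 2 (\<lambda>\<kappa>. cmod (fourier \<omega>0 \<kappa>))"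
      unfolding hc_def hs_def by (intro L2_set_cong refl) (simp add: dft_restrict_fproj)
    also have "\<dots> \<le> normH 2 \<omega>0"
      using \<omega>0 by (intro hs_fourier_le_normH[OF sob_term_summable_mono[of "Suc t + 1"]]) (auto simp: Hper_def)
    finally show ?thesis using True by (simp add: Y1_def sq)
  next
    case False
    then have "hc K 2 (dft K (\<omega> l)) \<le> b" using that b hN[of 2 2 l] by auto
    then show ?thesis by (simp add: Y1_def sq)
  qed
  have Y2: "(hc K (t + 2) (dft K (\<omega> l)))\<^sup>2 \<le> Y2" if "l \<in> {0, -1, -2}" for l
  proof (cases "l = 0")
    case True
    then show ?thesis using hN[of "t + 2" "Suc t + 1" 0] by (simp add: Y2_def sq)
  next
    case False
    then have "hc K (t + 2) (dft K (\<omega> l)) \<le> B" using that B hN[of "t + 2" "Suc t + 1" l] by auto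
    then show ?thesis by (simp add: Y2_def sq)
  qed
  \<comment> \<open>\<open>Y1\<close> belongs to the time step condition and \<open>Y2\<close> to
    the conclusion. Projection can lower the norm of the initial vorticity while the order
    \<open>t + 2\<close> can raise it, so the minimum is taken: it lies below both and still bounds
    the data.\<close>
  have Y12: "(hc K 2 (dft K (\<omega> l)))\<^sup>2 \<le> min Y1 Y2" if "l \<in> {0, -1, -2}" for l
  proof -
    have "(hc K 2 (dft K (\<omega> l)))\<^sup>2 \<le> (hc K (t + 2) (dft K (\<omega> l)))\<^sup>2"
      by (intro power_mono hc_mono_order) auto
    then show ?thesis using Y1[OF that] order_trans[OF _ Y2[OF that]] by (intro min.boundedI) blast+
  qed
  have force: "hc K 0 (dft K (restrictN K (fproj K (f (of_int n * dt))))) \<le> min G1 G2" if "n \<ge> 1" for n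
    using hc_force_le[OF f, of "of_int n * dt"] that pos by (simp add: G1_def G2_def)
  have "dt * H1_bound \<alpha> \<nu> (min Y1 Y2) (min G1 G2) * (627264 * (36 * lattice_bound))
      \<le> dt * H1_bound \<alpha> \<nu> Y1 G1 * (627264 * (36 * lattice_bound))"
    using pos Y G by (intro mult_right_mono mult_left_mono H1_bound_mono) auto
  also have "\<dots> \<le> \<nu>" using small by (simp only: Y1_def G1_def)
  finally have sm: "dt * H1_bound \<alpha> \<nu> (min Y1 Y2) (min G1 G2) * (627264 * (36 * lattice_bound)) \<le> \<nu>" .
  have "(hc K 1 (dft K (\<omega> n)))\<^sup>2 \<le> H1_bound \<alpha> \<nu> Y2 G2" if "n \<ge> - 2" for n
  proof -
    have "(hc K 1 (dft K (\<omega> n)))\<^sup>2 \<le> H1_bound \<alpha> \<nu> (min Y1 Y2) (min G1 G2)"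
      using Y12 force sm that by (rule H1_bounded)
    also have "\<dots> \<le> H1_bound \<alpha> \<nu> Y2 G2" using pos Y G by (intro H1_bound_mono) auto
    finally show ?thesis .
  qed
  moreover have "hc K j (dft K (restrictN K (fproj K (f (of_int n * dt))))) \<le> G2" if "n \<ge> 1" "j \<le> t" for n j
    using hc_force_le(1)[OF f, of "of_int n * dt"] that pos by (simp add: G2_def)
  ultimately have "(hc K (Suc t) (dft K (\<omega> (int n))))\<^sup>2 \<le> sob_bound \<alpha> \<nu> Y2 G2 t"
    using Y2 by (intro sob_bounded) auto
  then show ?thesis by (simp only: Y2_def G2_def)
qed

text \<open>The argument \<open>b\<close> of \<open>M\<^sub>0\<close> and the argument
  \<open>B\<close> of \<open>R\<close> bound the initial guesses, which enter the initial energies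
  on the same footing as \<open>\<omega> 0\<close>.\<close>

theorem theorem3p1:
  fixes \<alpha> :: "nat \<Rightarrow> real"
  assumes "bdf3_stencil \<alpha>"
  shows "\<exists>(C_w :: real) > 0. \<exists>(\<beta>\<^sub>0 :: real) > 0. \<exists>M\<^sub>0 :: real \<Rightarrow> real \<Rightarrow> real \<Rightarrow> real \<Rightarrow> real.
    (\<forall>a \<nu> F b. M\<^sub>0 a \<nu> F b > 0) \<and>
    (\<forall>s\<ge>2. \<exists>R :: real \<Rightarrow> real \<Rightarrow> real \<Rightarrow> real \<Rightarrow> real.
      \<forall>(\<nu> :: real) (dt :: real) (K :: nat) (\<omega>0 :: real \<times> real \<Rightarrow> real)
        (f :: real \<Rightarrow> real \<times> real \<Rightarrow> real) (\<omega> :: int \<Rightarrow> grid) (\<psi> :: int \<Rightarrow> grid)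
        (u :: int \<Rightarrow> grid \<times> grid) (b :: real) (B :: real).
        \<nu> > 0 \<and> dt > 0 \<and>
        \<omega>0 \<in> Hper (s + 1) \<and> zero_mean \<omega>0 \<and>
        f \<in> LinfH (s - 1) \<and> (\<forall>t>0. zero_mean (f t)) \<and>
        imex_bdf3 K \<nu> dt \<omega>0 f \<omega> \<psi> u \<and>
        normHN K 2 (\<omega> (- 1)) \<le> b \<and> normHN K 2 (\<omega> (- 2)) \<le> b \<and>
        normHN K (s + 1) (\<omega> (- 1)) \<le> B \<and> normHN K (s + 1) (\<omega> (- 2)) \<le> B \<and>
        dt \<le> \<nu> / (C_w * (M\<^sub>0 (normH 2 \<omega>0) \<nu> (normLinfL2 f) b)\<^sup>2)
        \<longrightarrow> (\<forall>n :: nat.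
          normL2 (nabla s (cont_ext K (\<omega> (int n))))
            \<le> 1 / \<alpha> 1 * (1 + \<beta>\<^sub>0 * \<nu> * dt) powr (- (real n / 2)) * sqrt (G0 \<alpha> K s \<nu> dt \<omega>)
              + R (normHN K (s + 1) (\<omega> 0)) (normLinfH (s - 1) f) \<nu> B))"
proof -
  \<comment> \<open>The factor from \<open>energy_bound_0\<close>; the added 1 makes it at least 1,
    which the derivation of \<nu> dt <= 1 relies on.\<close>
  define C where "C = 627264 * (36 * lattice_bound) + 1"
  \<comment> \<open>The maximum gives nonnegativity for all real arguments, while
    \<open>H1_bound_nonneg\<close> assumes \<nu> > 0.\<close>
  define H where "H = (\<lambda>a \<nu> F b. max 0 (H1_bound \<alpha> \<nu> (a\<^sup>2 + b\<^sup>2) F))"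
  \<comment> \<open>Under the root, 1 makes \<open>M\<close> positive, the square of \<nu> enforces
    \<nu> dt <= 1, and \<open>H\<close> yields the smallness condition of the H1 estimate.\<close>
  define M where "M = (\<lambda>a \<nu> F b. sqrt (1 + \<nu>\<^sup>2 + H a \<nu> F b))"
  have C: "C \<ge> 1" by (simp add: C_def)
  have Mpos: "1 + \<nu>\<^sup>2 + H a \<nu> F b > 0" for a \<nu> F b
    by (intro add_pos_nonneg) (auto simp: H_def)
  have main: "normL2 (nabla s (cont_ext K (\<omega> (int n))))
      \<le> 1 / \<alpha> 1 * (1 + 1 * \<nu> * dt) powr (- (real n / 2)) * sqrt (G0 \<alpha> K s \<nu> dt \<omega>)
        + sqrt (sob_bound \<alpha> \<nu> ((normHN K (s + 1) (\<omega> 0))\<^sup>2 + B\<^sup>2) (normLinfH (s - 1) f) (s - 1))"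
    if "s \<ge> 2" and pos: "\<nu> > 0" "dt > 0" and "\<omega>0 \<in> Hper (s + 1)" "f \<in> LinfH (s - 1)"
      and sch: "imex_bdf3 K \<nu> dt \<omega>0 f \<omega> \<psi> u"
      and b: "normHN K 2 (\<omega> (- 1)) \<le> b" "normHN K 2 (\<omega> (- 2)) \<le> b"
      and "normHN K (s + 1) (\<omega> (- 1)) \<le> B" "normHN K (s + 1) (\<omega> (- 2)) \<le> B"
      and dt: "dt \<le> \<nu> / (C * (M (normH 2 \<omega>0) \<nu> (normLinfL2 f) b)\<^sup>2)"
    for s n K and \<nu> dt b B :: real and \<omega>0 f \<omega> \<psi> u
  proof -
    define h where "h = H (normH 2 \<omega>0) \<nu> (normLinfL2 f) b"
    have h: "0 \<le> h" "H1_bound \<alpha> \<nu> ((normH 2 \<omega>0)\<^sup>2 + b\<^sup>2) (normLinfL2 f) \<le> h" by (simp_all add: h_def H_def)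
    have "(M (normH 2 \<omega>0) \<nu> (normLinfL2 f) b)\<^sup>2 = 1 + \<nu>\<^sup>2 + h"
      using Mpos[of \<nu> "normH 2 \<omega>0" "normLinfL2 f" b] by (simp add: M_def h_def)
    then have "dt \<le> \<nu> / (C * (1 + \<nu>\<^sup>2 + h))" using dt by simp
    moreover have "0 < C * (1 + \<nu>\<^sup>2 + h)"
      using C h by (intro mult_pos_pos add_pos_nonneg) auto
    ultimately have d: "dt * (C * (1 + \<nu>\<^sup>2 + h)) \<le> \<nu>" by (simp add: pos_le_divide_eq)
    have nudt: "\<nu> * dt \<le> 1"
    proof -
      have "1 * \<nu>\<^sup>2 \<le> C * (1 + \<nu>\<^sup>2 + h)" using C h by (intro mult_mono) auto
      then have "dt * \<nu>\<^sup>2 \<le> dt * (C * (1 + \<nu>\<^sup>2 + h))" using pos by simp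
      then have "\<nu> * (\<nu> * dt) \<le> \<nu> * 1" using d by (simp add: power2_eq_square mult_ac)
      then show ?thesis using pos by simp
    qed
    have small: "dt * H1_bound \<alpha> \<nu> ((normH 2 \<omega>0)\<^sup>2 + b\<^sup>2) (normLinfL2 f) * (627264 * (36 * lattice_bound)) \<le> \<nu>"
    proof -
      have "dt * H1_bound \<alpha> \<nu> ((normH 2 \<omega>0)\<^sup>2 + b\<^sup>2) (normLinfL2 f) * (627264 * (36 * lattice_bound)) \<le> dt * (1 + \<nu>\<^sup>2 + h) * C"
        using pos h by (intro mult_mono mult_left_mono) (auto simp: C_def add_increasing)
      then show ?thesis using d by (simp add: mult_ac)
    qed
    obtain t where s: "s = Suc t" using \<open>s \<ge> 2\<close> by (cases s) auto
    have "(hc K (Suc t) (dft K (\<omega> (int n))))\<^sup>2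
        \<le> sob_bound \<alpha> \<nu> ((normHN K (Suc t + 1) (\<omega> 0))\<^sup>2 + B\<^sup>2) (normLinfH t f) t"
      using that(4,5,9,10) unfolding s
      by (intro uniform_Sobolev_bound[OF assms pos _ _ sch b _ _ nudt small]) simp_all
    then have "hc K s (dft K (\<omega> (int n)))
        \<le> sqrt (sob_bound \<alpha> \<nu> ((normHN K (s + 1) (\<omega> 0))\<^sup>2 + B\<^sup>2) (normLinfH (s - 1) f) (s - 1))"
      using s by (simp add: real_le_rsqrt)
    moreover have "normL2 (nabla s (cont_ext K (\<omega> (int n)))) = hc K s (dft K (\<omega> (int n)))"
      by (simp add: cont_ext_trig normL2_nabla_trig hc_def)
    moreover have "0 \<le> 1 / \<alpha> 1 * (1 + 1 * \<nu> * dt) powr (- (real n / 2)) * sqrt (G0 \<alpha> K s \<nu> dt \<omega>)"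
      using assms G0_nonneg[OF pos] by (simp add: bdf3_stencil_def)
    ultimately show ?thesis by linarith
  qed
  have "C > 0" using C by simp
  show ?thesis
  \<comment> \<open>The witness for \<open>\<beta>\<^sub>0\<close> is 1: the factor containing it
    enters through its nonnegativity, so any positive value is admissible.\<close>
  proof (rule exI[of _ C], rule conjI[OF \<open>C > 0\<close>], rule exI[of _ 1], rule conjI[OF zero_less_one],
      rule exI[of _ M], intro conjI allI impI)
    show "0 < M a \<nu> F b" for a \<nu> F b using Mpos by (simp add: M_def)
    show "\<exists>R. \<forall>\<nu> dt K \<omega>0 f \<omega> \<psi> u b B.
        \<nu> > 0 \<and> dt > 0 \<and>
        \<omega>0 \<in> Hper (s + 1) \<and> zero_mean \<omega>0 \<and>
        f \<in> LinfH (s - 1) \<and> (\<forall>t>0. zero_mean (f t)) \<and>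
        imex_bdf3 K \<nu> dt \<omega>0 f \<omega> \<psi> u \<and>
        normHN K 2 (\<omega> (- 1)) \<le> b \<and> normHN K 2 (\<omega> (- 2)) \<le> b \<and>
        normHN K (s + 1) (\<omega> (- 1)) \<le> B \<and> normHN K (s + 1) (\<omega> (- 2)) \<le> B \<and>
        dt \<le> \<nu> / (C * (M (normH 2 \<omega>0) \<nu> (normLinfL2 f) b)\<^sup>2)
        \<longrightarrow> (\<forall>n :: nat.
          normL2 (nabla s (cont_ext K (\<omega> (int n))))
            \<le> 1 / \<alpha> 1 * (1 + 1 * \<nu> * dt) powr (- (real n / 2)) * sqrt (G0 \<alpha> K s \<nu> dt \<omega>)
              + R (normHN K (s + 1) (\<omega> 0)) (normLinfH (s - 1) f) \<nu> B)" if "s \<ge> 2" for s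
      by (rule exI[of _ "\<lambda>A F \<nu> B. sqrt (sob_bound \<alpha> \<nu> (A\<^sup>2 + B\<^sup>2) F (s - 1))"])
        (intro allI impI, elim conjE, rule main[OF that])
  qed
qed

end
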